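(* Let $\mathcal{H}$ be a Hilbert space, let $d\in\mathbb{N}$ (so $d\ge 1$), and let $S_0,\dots,S_d$ be bounded operators on $\mathcal{H}$; set $S_{-k}=S_k^*$ for $1\le k\le d$. Consider the truncated operator trigonometric moment problem with data $\{S_n\}_{n=0}^d$ and suppose that $$\sum_{k,l=0}^d (S_{l-k}h_l,h_k)_{\mathcal{H}}\ge 0\qquad\text{for all } h_0,\dots,h_d\in\mathcal{H}.$$ Let the Hilbert space $H$ and the closed isometric operator $A$ in $H$ be constructed from $\{S_n\}_{n=0}^d$ as described in the context. Then the moment problem is determinate if and only if at least one of the defect numbers of $A$ is zero.
   Context: All Hilbert spaces are complex and not necessarily separable; operators are linear; $[\mathcal{H}]$ is the set of bounded operators on $\mathcal{H}$; scalar products are linear in the first argument. Moment problem. The truncated operator trigonometric moment problem with data $\{S_n\}_{n=0}^d\subset[\mathcal{H}]$ consists of finding a non-decreasing $[\mathcal{H}]$-valued function $F(t)$, $t\in[0,2\pi]$ (i.e. $F(t)-F(s)\ge 0$ for $s\le t$), with $F(0)=0$, strongly left-continuous in $(0,2\pi]$, such that $\int_0^{2\pi}e^{int}\,dF(t)=S_n$ for $n=0,1,\dots,d$. The integrals are limits of integral (Riemann–Stieltjes) sums in the strong operator topology. Such an $F$ is called a solution. A solvable moment problem is determinate if it has a unique solution, and indeterminate otherwise. Construction of $H$ and $A$. Let $\mathfrak{B}$ be the complex vector space of formal sums $h=\sum_{j=0}^d h_j\varepsilon_j$ with $h_j\in\mathcal{H}$ ($\varepsilon_0,\dots,\varepsilon_d$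 abstract symbols, operations coefficientwise). For $h=\sum_j h_j\varepsilon_j$, $g=\sum_k g_k\varepsilon_k$ put $\langle h,g\rangle=\sum_{j,k=0}^d(S_{j-k}h_j,g_k)_{\mathcal{H}}$, a non-negative Hermitian sesquilinear form under the positivity hypothesis. Identify $h$ and $g$ when $\langle h-g,h-g\rangle=0$, write $[h]$ for the class of $h$, and let $H$ be the Hilbert space obtained by completing the space of classes with the induced scalar product. Put $x_{h,j}=[h\varepsilon_j]$ for $h\in\mathcal{H}$, $0\le j\le d$; thus $(x_{h,j},x_{g,k})_H=(S_{j-k}h,g)_{\mathcal{H}}$. Let $A_0$ be the (well-defined, isometric) linear operator in $H$ with domain $D(A_0)=\{\sum_{j=0}^{d-1}x_{h_j,j}: h_0,\dots,h_{d-1}\in\mathcal{H}\}$ given by $A_0\sum_{j=0}^{d-1}x_{h_j,j}=\sum_{j=0}^{d-1}x_{h_j,j+1}$, and let $A=\overline{A_0}$ be its closure, with (closed) domain $D(A)$ and range $R(A)$. The defect numbers of $A$ are the dimensions of the subspaces $H\ominus D(A)$ and $H\ominus R(A)$. *)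

theory Defs
  imports "HOL-Analysis.Analysis"
begin

section \<open>Complex Hilbert spaces and bounded operators\<close>

text \<open>The scalar product is linear in the first argument.\<close>

class complex_hilbert = banach +
  fixes scaleC :: "complex \<Rightarrow> 'a \<Rightarrow> 'a"  (infixr "*\<^sub>C" 75)
    and cinner :: "'a \<Rightarrow> 'a \<Rightarrow> complex"
  assumes scaleC_add_right: "c *\<^sub>C (x + y) = c *\<^sub>C x + c *\<^sub>C y"
    and scaleC_add_left: "(a + b) *\<^sub>C x = a *\<^sub>C x + b *\<^sub>C x"
    and scaleC_scaleC: "a *\<^sub>C (b *\<^sub>C x) = (a * b) *\<^sub>C x"
    and scaleR_eq_scaleC: "r *\<^sub>R x = complex_of_real r *\<^sub>C x"
    and cinner_commute: "cinner x y = cnj (cinner y x)"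
    and cinner_add_left: "cinner (x + y) z = cinner x z + cinner y z"
    and cinner_scaleC_left: "cinner (c *\<^sub>C x) y = c * cinner x y"
    and cinner_self: "cinner x x = complex_of_real ((norm x)\<^sup>2)"

definition bounded_clinear :: "('a::complex_hilbert \<Rightarrow> 'a) \<Rightarrow> bool" where
  "bounded_clinear T \<longleftrightarrow> bounded_linear T \<and> (\<forall>c x. T (c *\<^sub>C x) = c *\<^sub>C T x)"

definition cadjoint :: "('a::complex_hilbert \<Rightarrow> 'a) \<Rightarrow> 'a \<Rightarrow> 'a" where
  "cadjoint T = (THE T'. \<forall>x y. cinner (T x) y = cinner x (T' y))"

definition positive_op :: "('a::complex_hilbert \<Rightarrow> 'a) \<Rightarrow> bool" where
  "positive_op T \<longleftrightarrow> (\<forall>x. cinner (T x) x \<in> \<real>\<^sub>\<ge>\<^sub>0)"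

section \<open>The truncated operator trigonometric moment problem\<close>

definition tagged_partition ::
    "real \<Rightarrow> real \<Rightarrow> nat \<Rightarrow> (nat \<Rightarrow> real) \<Rightarrow> (nat \<Rightarrow> real) \<Rightarrow> bool" where
  "tagged_partition a b N t \<xi> \<longleftrightarrow>
     t 0 = a \<and> t N = b \<and> (\<forall>k<N. t k < t (Suc k) \<and> \<xi> k \<in> {t k..t (Suc k)})"

definition RS_sum ::
    "(real \<Rightarrow> complex) \<Rightarrow> (real \<Rightarrow> 'a::complex_hilbert \<Rightarrow> 'a) \<Rightarrow>
     nat \<Rightarrow> (nat \<Rightarrow> real) \<Rightarrow> (nat \<Rightarrow> real) \<Rightarrow> 'a \<Rightarrow> 'a" where
  "RS_sum f F N t \<xi> x = (\<Sum>k<N. f (\<xi> k) *\<^sub>C (F (t (Suc k)) x - F (t k) x))"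

text \<open>Strong operator convergence of the Riemann--Stieltjes sums as the mesh tends to \<open>0\<close>.\<close>

definition has_strong_RS_integral ::
    "(real \<Rightarrow> complex) \<Rightarrow> (real \<Rightarrow> 'a::complex_hilbert \<Rightarrow> 'a) \<Rightarrow>
     real \<Rightarrow> real \<Rightarrow> ('a \<Rightarrow> 'a) \<Rightarrow> bool" where
  "has_strong_RS_integral f F a b T \<longleftrightarrow>
     (\<forall>x. \<forall>e>0. \<exists>\<delta>>0. \<forall>N t \<xi>.
        tagged_partition a b N t \<xi> \<and> (\<forall>k<N. t (Suc k) - t k < \<delta>) \<longrightarrow>
        norm (RS_sum f F N t \<xi> x - T x) < e)"

text \<open>Only the values of \<open>F\<close> on \<open>[0, 2\<pi>]\<close> are relevant: also the left limits at points
  of \<open>(0, 2\<pi>]\<close> do not depend on the others.\<close>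

definition moment_solution ::
    "(nat \<Rightarrow> 'a::complex_hilbert \<Rightarrow> 'a) \<Rightarrow> nat \<Rightarrow> (real \<Rightarrow> 'a \<Rightarrow> 'a) \<Rightarrow> bool" where
  "moment_solution S d F \<longleftrightarrow>
     (\<forall>t\<in>{0..2*pi}. bounded_clinear (F t)) \<and>
     (\<forall>s\<in>{0..2*pi}. \<forall>t\<in>{0..2*pi}. s \<le> t \<longrightarrow> positive_op (\<lambda>x. F t x - F s x)) \<and>
     F 0 = (\<lambda>x. 0) \<and>
     (\<forall>t\<in>{0<..2*pi}. \<forall>x. ((\<lambda>s. F s x) \<longlongrightarrow> F t x) (at_left t)) \<and>
     (\<forall>n\<le>d. has_strong_RS_integral (\<lambda>t. exp (\<i> * of_nat n * of_real t)) F 0 (2*pi) (S n))"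

definition determinate :: "(nat \<Rightarrow> 'a::complex_hilbert \<Rightarrow> 'a) \<Rightarrow> nat \<Rightarrow> bool" where
  "determinate S d \<longleftrightarrow>
     (\<exists>F. moment_solution S d F) \<and>
     (\<forall>F G. moment_solution S d F \<and> moment_solution S d G \<longrightarrow> (\<forall>t\<in>{0..2*pi}. F t = G t))"

section \<open>Inner product spaces given by a carrier\<close>

text \<open>
  The space \<open>H\<close> depends on the data of the moment problem, so it cannot be a type and is
  represented by a carrier set with explicit operations.
\<close>

record 'v ip_space =
  ip_carrier :: "'v set"
  ip_zero :: 'v
  ip_add :: "'v \<Rightarrow> 'v \<Rightarrow> 'v"
  ip_scale :: "complex \<Rightarrow> 'v \<Rightarrow> 'v"
  ip_inner :: "'v \<Rightarrow> 'v \<Rightarrow> complex"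

definition ip_diff :: "'v ip_space \<Rightarrow> 'v \<Rightarrow> 'v \<Rightarrow> 'v" where
  "ip_diff V x y = ip_add V x (ip_scale V (- 1) y)"

definition ip_norm :: "'v ip_space \<Rightarrow> 'v \<Rightarrow> real" where
  "ip_norm V x = sqrt (Re (ip_inner V x x))"

primrec ip_sum :: "'v ip_space \<Rightarrow> (nat \<Rightarrow> 'v) \<Rightarrow> nat \<Rightarrow> 'v" where
  "ip_sum V f 0 = ip_zero V"
| "ip_sum V f (Suc n) = ip_add V (ip_sum V f n) (f n)"

definition ip_tendsto :: "'v ip_space \<Rightarrow> (nat \<Rightarrow> 'v) \<Rightarrow> 'v \<Rightarrow> bool" where
  "ip_tendsto V u x \<longleftrightarrow> (\<lambda>n. ip_norm V (ip_diff V (u n) x)) \<longlonglongrightarrow> 0"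

text \<open>Orthogonal complement in \<open>V\<close>; it is only applied to subspaces.\<close>

definition ip_ominus :: "'v ip_space \<Rightarrow> 'v set \<Rightarrow> 'v set" where
  "ip_ominus V M = {x \<in> ip_carrier V. \<forall>y\<in>M. ip_inner V x y = 0}"

definition orthonormal_basis :: "'v ip_space \<Rightarrow> 'v set \<Rightarrow> 'v set \<Rightarrow> bool" where
  "orthonormal_basis V M B \<longleftrightarrow>
     B \<subseteq> M \<and>
     (\<forall>x\<in>B. \<forall>y\<in>B. ip_inner V x y = (if x = y then 1 else 0)) \<and>
     (\<forall>z\<in>M. (\<forall>x\<in>B. ip_inner V z x = 0) \<longrightarrow> z = ip_zero V)"

text \<open>Hilbert dimension of a closed subspace, as a cardinal; the cardinal \<open>0\<close> is
  \<open>BNF_Cardinal_Arithmetic.czero\<close>.\<close>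

definition hilbert_dim :: "'v ip_space \<Rightarrow> 'v set \<Rightarrow> 'v rel" where
  "hilbert_dim V M = card_of (SOME B. orthonormal_basis V M B)"

text \<open>
  Completion of a space with a non-negative, possibly degenerate, Hermitian form:
  Cauchy sequences modulo null sequences. This also identifies elements at distance \<open>0\<close>,
  so it is the completion of the quotient by the null vectors.
\<close>

definition ip_Cauchy :: "'v ip_space \<Rightarrow> (nat \<Rightarrow> 'v) set" where
  "ip_Cauchy V = {u. (\<forall>n. u n \<in> ip_carrier V) \<and>
     (\<forall>e>0. \<exists>M. \<forall>m\<ge>M. \<forall>n\<ge>M. ip_norm V (ip_diff V (u m) (u n)) < e)}"

definition ip_null_rel :: "'v ip_space \<Rightarrow> ((nat \<Rightarrow> 'v) \<times> (nat \<Rightarrow> 'v)) set" where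
  "ip_null_rel V = {(u, v). u \<in> ip_Cauchy V \<and> v \<in> ip_Cauchy V \<and>
     (\<lambda>n. ip_norm V (ip_diff V (u n) (v n))) \<longlonglongrightarrow> 0}"

definition ip_completion :: "'v ip_space \<Rightarrow> (nat \<Rightarrow> 'v) set ip_space" where
  "ip_completion V =
     \<lparr> ip_carrier = ip_Cauchy V // ip_null_rel V,
       ip_zero = ip_null_rel V `` {\<lambda>n. ip_zero V},
       ip_add = (\<lambda>X Y. \<Union>u\<in>X. \<Union>v\<in>Y. ip_null_rel V `` {\<lambda>n. ip_add V (u n) (v n)}),
       ip_scale = (\<lambda>c X. \<Union>u\<in>X. ip_null_rel V `` {\<lambda>n. ip_scale V c (u n)}),
       ip_inner = (\<lambda>X Y. THE z. \<forall>u\<in>X. \<forall>v\<in>Y. (\<lambda>n. ip_inner V (u n) (v n)) \<longlonglongrightarrow> z) \<rparr>"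

definition ip_class :: "'v ip_space \<Rightarrow> 'v \<Rightarrow> (nat \<Rightarrow> 'v) set" where
  "ip_class V x = ip_null_rel V `` {\<lambda>n. x}"

text \<open>Operators in \<open>V\<close> are represented by their graphs.\<close>

definition graph_closure :: "'v ip_space \<Rightarrow> ('v \<times> 'v) set \<Rightarrow> ('v \<times> 'v) set" where
  "graph_closure V G = {(x, y). x \<in> ip_carrier V \<and> y \<in> ip_carrier V \<and>
     (\<exists>p q. (\<forall>n. (p n, q n) \<in> G) \<and> ip_tendsto V p x \<and> ip_tendsto V q y)}"

section \<open>The Hilbert space \<open>H\<close> and the isometric operator \<open>A\<close>\<close>

definition S_ext :: "(nat \<Rightarrow> 'a::complex_hilbert \<Rightarrow> 'a) \<Rightarrow> int \<Rightarrow> 'a \<Rightarrow> 'a" where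
  "S_ext S k = (if k \<ge> 0 then S (nat k) else cadjoint (S (nat (- k))))"

text \<open>The formal sum \<open>\<Sum>j\<le>d. h\<^sub>j \<epsilon>\<^sub>j\<close> is the function \<open>j \<mapsto> h\<^sub>j\<close> vanishing beyond \<open>d\<close>.\<close>

definition formal_space ::
    "(nat \<Rightarrow> 'a::complex_hilbert \<Rightarrow> 'a) \<Rightarrow> nat \<Rightarrow> (nat \<Rightarrow> 'a) ip_space" where
  "formal_space S d =
     \<lparr> ip_carrier = {h. \<forall>j>d. h j = 0},
       ip_zero = (\<lambda>j. 0),
       ip_add = (\<lambda>h g j. h j + g j),
       ip_scale = (\<lambda>c h j. c *\<^sub>C h j),
       ip_inner = (\<lambda>h g. \<Sum>j\<le>d. \<Sum>k\<le>d. cinner (S_ext S (int j - int k) (h j)) (g k)) \<rparr>"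

definition moment_H ::
    "(nat \<Rightarrow> 'a::complex_hilbert \<Rightarrow> 'a) \<Rightarrow> nat \<Rightarrow> (nat \<Rightarrow> nat \<Rightarrow> 'a) set ip_space" where
  "moment_H S d = ip_completion (formal_space S d)"

definition moment_x ::
    "(nat \<Rightarrow> 'a::complex_hilbert \<Rightarrow> 'a) \<Rightarrow> nat \<Rightarrow> 'a \<Rightarrow> nat \<Rightarrow> (nat \<Rightarrow> nat \<Rightarrow> 'a) set" where
  "moment_x S d h j = ip_class (formal_space S d) (\<lambda>i. if i = j then h else 0)"

definition moment_A0 ::
    "(nat \<Rightarrow> 'a::complex_hilbert \<Rightarrow> 'a) \<Rightarrow> nat \<Rightarrow>
     ((nat \<Rightarrow> nat \<Rightarrow> 'a) set \<times> (nat \<Rightarrow> nat \<Rightarrow> 'a) set) set" where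
  "moment_A0 S d =
     {(ip_sum (moment_H S d) (\<lambda>j. moment_x S d (h j) j) d,
       ip_sum (moment_H S d) (\<lambda>j. moment_x S d (h j) (Suc j)) d) | h. True}"

definition moment_A ::
    "(nat \<Rightarrow> 'a::complex_hilbert \<Rightarrow> 'a) \<Rightarrow> nat \<Rightarrow>
     ((nat \<Rightarrow> nat \<Rightarrow> 'a) set \<times> (nat \<Rightarrow> nat \<Rightarrow> 'a) set) set" where
  "moment_A S d = graph_closure (moment_H S d) (moment_A0 S d)"

definition defect_domain ::
    "'v ip_space \<Rightarrow> ('v \<times> 'v) set \<Rightarrow> 'v rel" where
  "defect_domain V A = hilbert_dim V (ip_ominus V (Domain A))"

definition defect_range ::
    "'v ip_space \<Rightarrow> ('v \<times> 'v) set \<Rightarrow> 'v rel" where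
  "defect_range V A = hilbert_dim V (ip_ominus V (Range A))"

end

theory Submission
  imports Defs
begin

text \<open>
  Write \<open>s\<^sub>n(x, y) = (S\<^sub>n x, y)\<close>. A defect number of \<open>A\<close> vanishes iff every \<open>x\<^bsub>h,d\<^esub>\<close> (respectively
  \<open>x\<^bsub>h,0\<^esub>\<close>) is a limit of sums of \<open>x\<^bsub>g,j\<^esub>\<close> with \<open>j < d\<close> (respectively \<open>1 \<le> j \<le> d\<close>). If this holds, then for every
  solution the same approximation may be translated by any power of the shift, so each further
  moment is determined by those of smaller order, and the trigonometric moments determine \<open>F\<close>.

  Conversely, each contraction \<open>B\<close> extending \<open>A\<close> yields a form \<open>s\<^bsub>d+1\<^esub>(h, g) = (B x\<^bsub>h,d\<^esub>, x\<^bsub>g,0\<^esub>)\<close> that keeps the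
  Toeplitz form non-negative. With \<open>P\<close> the orthogonal projection onto \<open>D(A)\<close>, one choice is \<open>B = A P\<close>.
  If both defect numbers are positive, adding to \<open>A P\<close> a small rank one operator from \<open>H \<ominus> D(A)\<close> to \<open>H \<ominus> R(A)\<close> changes \<open>s\<^bsub>d+1\<^esub>\<close>, since \<open>x\<^bsub>h,d\<^esub>\<close> is not always orthogonal to
  \<open>H \<ominus> D(A)\<close> and \<open>x\<^bsub>g,0\<^esub>\<close> not always to \<open>H \<ominus> R(A)\<close>. Each extended sequence comes from a solution: it is continued
  to an infinite one, and a solution is a pointwise cluster point of the discrete measures given by
  its Fejer means.
\<close>

text \<open>The space H is a quotient of Cauchy sequences, on which operators are awkward to handle,
  so they are avoided. A vector of H is represented by a Cauchy sequence of formal sums, a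
  projection by a minimizing sequence, and a vanishing defect number by an approximation statement
  about formal sums. Moments are kept as sesquilinear forms, because limits of forms can be taken
  pointwise; Riesz representation turns them into operators at the end. The original space need not
  be separable, so the Fejer distributions are followed along a filter supplied by Tychonoff's
  theorem instead of a subsequence. For uniqueness, no dilation or spectral theorem is invoked: the
  Riemann sums of a solution over uniform partitions form a finite model in which the shift,
  multiplication by e^(it), is isometric. As these sums are not known to converge for orders above
  \<open>d\<close>, only the differences between two solutions are studied. Finally, e^(int) takes
  the same value at 0 and 2 pi, so only left-continuity at 2 pi excludes mass there. This shapes
  both the normalization of the constructed solution and the comparison of two solutions.\<close>

lemma quadratic_nonneg_imp_le:
  fixes a b :: real and z :: complex
  assumes "\<And>c::complex. 0 \<le> a + 2 * Re (c * z) + (cmod c)\<^sup>2 * b"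
  shows "(cmod z)\<^sup>2 \<le> a * b"
proof (cases "b = 0")
  case True
  show ?thesis
  proof (rule ccontr)
    assume "\<not> ?thesis"
    then have z: "(cmod z)\<^sup>2 > 0" using True by auto
    \<comment> \<open>The expression is affine in \<open>c\<close> here, and this multiple of
      \<open>cnj z\<close> gives it the value -1.\<close>
    define r where "r = - (a + 1) / (2 * (cmod z)\<^sup>2)"
    have "Re (of_real r * cnj z * z) = r * (cmod z)\<^sup>2"
      by (simp add: cmod_power2) (simp add: power2_eq_square algebra_simps)
    then have "0 \<le> a + 2 * (r * (cmod z)\<^sup>2)"
      using assms[of "of_real r * cnj z"] True by simp
    also have "2 * (r * (cmod z)\<^sup>2) = - (a + 1)" using z by (simp add: r_def)
    finally show False by simp
  qed
next
  case False
  have b: "b > 0"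
  proof (rule ccontr)
    assume "\<not> b > 0"
    with False have b: "b < 0" by simp
    \<comment> \<open>Averaging the values at \<open>t\<close> and \<open>- t\<close> cancels the
      linear term and leaves a - (|a| + 1), which is negative.\<close>
    define t where "t = sqrt ((\<bar>a\<bar> + 1) / (- b))"
    have t2: "t\<^sup>2 * b = - (\<bar>a\<bar> + 1)"
      using b by (simp add: t_def divide_nonneg_neg field_simps)
    have "0 \<le> a + 2 * Re (of_real t * z) + (cmod (of_real t :: complex))\<^sup>2 * b"
      by (rule assms)
    moreover have "0 \<le> a + 2 * Re (- of_real t * z) + (cmod (- of_real t :: complex))\<^sup>2 * b"
      by (rule assms)
    ultimately have "0 \<le> a + t\<^sup>2 * b" by simp
    with t2 show False by simp
  qed
  \<comment> \<open>The minimizer of the quadratic in the direction of \<open>cnj z\<close>.\<close>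
  define r where "r = - 1 / b"
  have "Re (of_real r * cnj z * z) = r * (cmod z)\<^sup>2"
    by (simp add: cmod_power2) (simp add: power2_eq_square algebra_simps)
  moreover have "(cmod (of_real r * cnj z))\<^sup>2 = r\<^sup>2 * (cmod z)\<^sup>2"
    by (simp add: norm_mult power_mult_distrib)
  ultimately have "0 \<le> a + 2 * (r * (cmod z)\<^sup>2) + r\<^sup>2 * (cmod z)\<^sup>2 * b"
    using assms[of "of_real r * cnj z"] by simp
  also have "\<dots> = a - (cmod z)\<^sup>2 / b"
    using b by (simp add: r_def field_simps power2_eq_square)
  finally show ?thesis using b by (simp add: field_simps)
qed

section \<open>Semi-inner product spaces\<close>

text \<open>Only the form is constrained: no vector space laws are imposed on the carrier, and null
  vectors may be non-zero. Two arrangements of a vector sum are therefore compared by expanding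
  inner products. The locale covers the formal sums, their completion, and the original Hilbert
  space alike.\<close>

locale semi_ip_space =
  fixes V :: "'v ip_space"
  assumes zero_closed: "ip_zero V \<in> ip_carrier V"
    and add_closed: "\<lbrakk>x \<in> ip_carrier V; y \<in> ip_carrier V\<rbrakk> \<Longrightarrow> ip_add V x y \<in> ip_carrier V"
    and scale_closed: "x \<in> ip_carrier V \<Longrightarrow> ip_scale V c x \<in> ip_carrier V"
    and inner_add_left: "\<lbrakk>x \<in> ip_carrier V; y \<in> ip_carrier V; z \<in> ip_carrier V\<rbrakk> \<Longrightarrow>
      ip_inner V (ip_add V x y) z = ip_inner V x z + ip_inner V y z"
    and inner_scale_left: "\<lbrakk>x \<in> ip_carrier V; z \<in> ip_carrier V\<rbrakk> \<Longrightarrow>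
      ip_inner V (ip_scale V c x) z = c * ip_inner V x z"
    and inner_commute: "\<lbrakk>x \<in> ip_carrier V; y \<in> ip_carrier V\<rbrakk> \<Longrightarrow>
      ip_inner V x y = cnj (ip_inner V y x)"
    and inner_zero_left: "z \<in> ip_carrier V \<Longrightarrow> ip_inner V (ip_zero V) z = 0"
    and inner_nonneg: "x \<in> ip_carrier V \<Longrightarrow> 0 \<le> Re (ip_inner V x x)"
begin

abbreviation "C \<equiv> ip_carrier V"
abbreviation "inn \<equiv> ip_inner V"
abbreviation "nrm \<equiv> ip_norm V"
abbreviation "dif \<equiv> ip_diff V"

lemma diff_closed: "\<lbrakk>x \<in> C; y \<in> C\<rbrakk> \<Longrightarrow> dif x y \<in> C"
  by (simp add: ip_diff_def add_closed scale_closed)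

lemmas closed = zero_closed add_closed scale_closed diff_closed

lemma inner_add_right:
  "\<lbrakk>x \<in> C; y \<in> C; z \<in> C\<rbrakk> \<Longrightarrow> inn z (ip_add V x y) = inn z x + inn z y"
  by (metis inner_add_left inner_commute add_closed complex_cnj_add)

lemma inner_scale_right:
  "\<lbrakk>x \<in> C; z \<in> C\<rbrakk> \<Longrightarrow> inn z (ip_scale V c x) = cnj c * inn z x"
  by (metis inner_scale_left inner_commute scale_closed complex_cnj_mult)

lemma inner_zero_right: "z \<in> C \<Longrightarrow> inn z (ip_zero V) = 0"
  by (metis inner_zero_left inner_commute zero_closed complex_cnj_zero)

lemma inner_diff_left:
  "\<lbrakk>x \<in> C; y \<in> C; z \<in> C\<rbrakk> \<Longrightarrow> inn (dif x y) z = inn x z - inn y z"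
  by (simp add: ip_diff_def inner_add_left inner_scale_left closed)

lemma inner_diff_right:
  "\<lbrakk>x \<in> C; y \<in> C; z \<in> C\<rbrakk> \<Longrightarrow> inn z (dif x y) = inn z x - inn z y"
  by (simp add: ip_diff_def inner_add_right inner_scale_right closed)

lemmas inner_simps = inner_add_left inner_add_right inner_scale_left inner_scale_right
  inner_diff_left inner_diff_right inner_zero_left inner_zero_right

lemma Im_inner_self: "x \<in> C \<Longrightarrow> Im (inn x x) = 0"
  using inner_commute[of x x] by (metis cnj.sel(2) neg_equal_zero)

lemma norm_nonneg: "x \<in> C \<Longrightarrow> 0 \<le> nrm x"
  by (simp add: ip_norm_def inner_nonneg)

lemma norm_sq: "x \<in> C \<Longrightarrow> (nrm x)\<^sup>2 = Re (inn x x)"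
  by (simp add: ip_norm_def inner_nonneg)

lemma inner_self: "x \<in> C \<Longrightarrow> inn x x = complex_of_real ((nrm x)\<^sup>2)"
  by (simp add: norm_sq Im_inner_self complex_eq_iff)

lemma norm_zero: "nrm (ip_zero V) = 0"
  by (simp add: ip_norm_def inner_zero_left zero_closed)

lemma norm_scale: "x \<in> C \<Longrightarrow> nrm (ip_scale V c x) = cmod c * nrm x"
proof -
  assume x: "x \<in> C"
  have "inn (ip_scale V c x) (ip_scale V c x) = c * cnj c * inn x x"
    by (simp add: inner_simps x closed)
  also have "\<dots> = of_real ((cmod c)\<^sup>2) * inn x x"
    by (simp only: complex_norm_square)
  finally have "inn (ip_scale V c x) (ip_scale V c x) = of_real ((cmod c)\<^sup>2) * inn x x" .
  then show ?thesis
    by (simp add: ip_norm_def real_sqrt_mult)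
qed

lemma norm_add_sq:
  "\<lbrakk>x \<in> C; y \<in> C\<rbrakk> \<Longrightarrow> (nrm (ip_add V x y))\<^sup>2 = (nrm x)\<^sup>2 + 2 * Re (inn x y) + (nrm y)\<^sup>2"
  using inner_commute[of x y] by (simp add: norm_sq closed inner_simps)

lemma norm_diff_sq:
  "\<lbrakk>x \<in> C; y \<in> C\<rbrakk> \<Longrightarrow> (nrm (dif x y))\<^sup>2 = (nrm x)\<^sup>2 - 2 * Re (inn x y) + (nrm y)\<^sup>2"
  using inner_commute[of x y] by (simp add: norm_sq closed inner_simps)

lemma Cauchy_Schwarz:
  assumes x: "x \<in> C" and y: "y \<in> C"
  shows "cmod (inn x y) \<le> nrm x * nrm y"
proof -
  have "(cmod (inn y x))\<^sup>2 \<le> (nrm x)\<^sup>2 * (nrm y)\<^sup>2"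
  proof (rule quadratic_nonneg_imp_le)
    fix c :: complex
    have "Re (inn x (ip_scale V c y)) = Re (c * inn y x)"
      using inner_commute[OF x y] by (simp add: inner_simps x y)
    then show "0 \<le> (nrm x)\<^sup>2 + 2 * Re (c * inn y x) + (cmod c)\<^sup>2 * (nrm y)\<^sup>2"
      using norm_add_sq[of x "ip_scale V c y"] x y
      by (simp add: closed norm_scale power_mult_distrib flip: add.assoc) (metis zero_le_power2)
  qed
  moreover have "cmod (inn y x) = cmod (inn x y)"
    using inner_commute[OF x y] by simp
  ultimately have "(cmod (inn x y))\<^sup>2 \<le> (nrm x * nrm y)\<^sup>2"
    by (simp add: power_mult_distrib)
  then show ?thesis
    by (rule power2_le_imp_le) (simp add: norm_nonneg x y)
qed

lemma norm_add_le:
  assumes x: "x \<in> C" and y: "y \<in> C"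
  shows "nrm (ip_add V x y) \<le> nrm x + nrm y"
proof -
  have "Re (inn x y) \<le> nrm x * nrm y"
    using Cauchy_Schwarz[OF x y] complex_Re_le_cmod order_trans by blast
  then have "(nrm (ip_add V x y))\<^sup>2 \<le> (nrm x + nrm y)\<^sup>2"
    using norm_add_sq[OF x y] by (simp add: power2_sum)
  then show ?thesis
    by (rule power2_le_imp_le) (simp add: norm_nonneg x y)
qed

lemma norm_diff_commute: "\<lbrakk>x \<in> C; y \<in> C\<rbrakk> \<Longrightarrow> nrm (dif x y) = nrm (dif y x)"
  by (simp add: ip_norm_def inner_simps closed)

lemma norm_diff_self: "x \<in> C \<Longrightarrow> nrm (dif x x) = 0"
  by (simp add: ip_norm_def inner_simps closed)

lemma norm_diff_triangle:
  assumes "x \<in> C" "y \<in> C" "z \<in> C"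
  shows "nrm (dif x z) \<le> nrm (dif x y) + nrm (dif y z)"
proof -
  have "nrm (dif x z) = nrm (ip_add V (dif x y) (dif y z))"
    using assms by (simp add: ip_norm_def inner_simps closed algebra_simps)
  with norm_add_le[of "dif x y" "dif y z"] show ?thesis
    using assms by (simp add: closed)
qed

lemma norm_le_diff:
  assumes "x \<in> C" "y \<in> C"
  shows "nrm x \<le> nrm (dif x y) + nrm y"
proof -
  have "nrm x = nrm (ip_add V (dif x y) y)"
    using assms by (simp add: ip_norm_def inner_simps closed algebra_simps)
  with norm_add_le[of "dif x y" y] show ?thesis
    using assms by (simp add: closed)
qed

lemma abs_norm_diff_le:
  "\<lbrakk>x \<in> C; y \<in> C\<rbrakk> \<Longrightarrow> \<bar>nrm x - nrm y\<bar> \<le> nrm (dif x y)"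
  using norm_le_diff[of x y] norm_le_diff[of y x] norm_diff_commute[of x y] by linarith

lemma norm_diff_add_le:
  assumes "x \<in> C" "y \<in> C" "x' \<in> C" "y' \<in> C"
  shows "nrm (dif (ip_add V x y) (ip_add V x' y')) \<le> nrm (dif x x') + nrm (dif y y')"
proof -
  have "nrm (dif (ip_add V x y) (ip_add V x' y')) = nrm (ip_add V (dif x x') (dif y y'))"
    using assms by (simp add: ip_norm_def inner_simps closed algebra_simps)
  with norm_add_le[of "dif x x'" "dif y y'"] show ?thesis
    using assms by (simp add: closed)
qed

lemma norm_diff_scale:
  assumes "x \<in> C" "y \<in> C"
  shows "nrm (dif (ip_scale V c x) (ip_scale V c y)) = cmod c * nrm (dif x y)"
proof -
  have "nrm (dif (ip_scale V c x) (ip_scale V c y)) = nrm (ip_scale V c (dif x y))"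
    using assms by (simp add: ip_norm_def inner_simps closed algebra_simps)
  then show ?thesis
    using assms by (simp add: norm_scale closed)
qed

lemma inner_diff_bound:
  assumes "x \<in> C" "y \<in> C" "x' \<in> C" "y' \<in> C"
  shows "cmod (inn x y - inn x' y') \<le> nrm (dif x x') * nrm y + nrm x' * nrm (dif y y')"
proof -
  have "inn x y - inn x' y' = inn (dif x x') y + inn x' (dif y y')"
    using assms by (simp add: inner_simps closed)
  also have "cmod \<dots> \<le> cmod (inn (dif x x') y) + cmod (inn x' (dif y y'))"
    by (rule norm_triangle_ineq)
  also have "\<dots> \<le> nrm (dif x x') * nrm y + nrm x' * nrm (dif y y')"
    using assms by (intro add_mono Cauchy_Schwarz) (simp_all add: closed)
  finally show ?thesis .
qed

definition subsp :: "'v set \<Rightarrow> bool" where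
  "subsp M \<longleftrightarrow> M \<subseteq> C \<and> ip_zero V \<in> M \<and> (\<forall>x\<in>M. \<forall>y\<in>M. ip_add V x y \<in> M) \<and>
     (\<forall>c. \<forall>x\<in>M. ip_scale V c x \<in> M)"

lemma subsp_diff: "\<lbrakk>subsp M; x \<in> M; y \<in> M\<rbrakk> \<Longrightarrow> dif x y \<in> M"
  by (simp add: subsp_def ip_diff_def)

lemma Cauchy_norm_diff:
  "u \<in> ip_Cauchy V \<Longrightarrow> e > 0 \<Longrightarrow> \<exists>M. \<forall>m\<ge>M. \<forall>n\<ge>M. nrm (dif (u m) (u n)) < e"
  by (simp add: ip_Cauchy_def)

lemma Cauchy_closed: "u \<in> ip_Cauchy V \<Longrightarrow> u n \<in> C"
  by (simp add: ip_Cauchy_def)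

lemma Cauchy_bounded:
  assumes u: "u \<in> ip_Cauchy V"
  shows "\<exists>K>0. \<forall>n. nrm (u n) \<le> K"
proof -
  have "Cauchy (\<lambda>n. nrm (u n))"
    unfolding Cauchy_def dist_real_def
    using Cauchy_norm_diff[OF u] abs_norm_diff_le Cauchy_closed[OF u] by (meson le_less_trans)
  then have "Bseq (\<lambda>n. nrm (u n))"
    by (rule Cauchy_Bseq)
  then obtain K where "K > 0" "\<And>n. norm (nrm (u n)) \<le> K"
    by (auto simp: Bseq_def)
  then show ?thesis
    by (metis abs_ge_self order_trans real_norm_def)
qed

lemma Cauchy_const: "x \<in> C \<Longrightarrow> (\<lambda>n. x) \<in> ip_Cauchy V"
  by (simp add: ip_Cauchy_def norm_diff_self)

lemma Cauchy_add:
  assumes u: "u \<in> ip_Cauchy V" and v: "v \<in> ip_Cauchy V"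
  shows "(\<lambda>n. ip_add V (u n) (v n)) \<in> ip_Cauchy V"
  unfolding ip_Cauchy_def
proof (intro CollectI conjI allI impI)
  fix e :: real assume "e > 0"
  then obtain M N where M: "\<forall>m\<ge>M. \<forall>n\<ge>M. nrm (dif (u m) (u n)) < e/2"
    and N: "\<forall>m\<ge>N. \<forall>n\<ge>N. nrm (dif (v m) (v n)) < e/2"
    using Cauchy_norm_diff[OF u, of "e/2"] Cauchy_norm_diff[OF v, of "e/2"] by auto
  show "\<exists>M. \<forall>m\<ge>M. \<forall>n\<ge>M. nrm (dif (ip_add V (u m) (v m)) (ip_add V (u n) (v n))) < e"
  proof (intro exI allI impI)
    fix m n assume "m \<ge> max M N" "n \<ge> max M N"
    then have "nrm (dif (u m) (u n)) < e/2" "nrm (dif (v m) (v n)) < e/2"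
      using M N by auto
    then show "nrm (dif (ip_add V (u m) (v m)) (ip_add V (u n) (v n))) < e"
      using norm_diff_add_le[of "u m" "v m" "u n" "v n"] Cauchy_closed[OF u] Cauchy_closed[OF v]
      by fastforce
  qed
qed (simp add: closed Cauchy_closed u v)

lemma Cauchy_scale:
  assumes u: "u \<in> ip_Cauchy V"
  shows "(\<lambda>n. ip_scale V c (u n)) \<in> ip_Cauchy V"
  unfolding ip_Cauchy_def
proof (intro CollectI conjI allI impI)
  fix e :: real assume e: "e > 0"
  then obtain M where M: "\<forall>m\<ge>M. \<forall>n\<ge>M. nrm (dif (u m) (u n)) < e / (cmod c + 1)"
    using Cauchy_norm_diff[OF u, of "e / (cmod c + 1)"] by (auto simp: add_nonneg_pos)
  show "\<exists>M. \<forall>m\<ge>M. \<forall>n\<ge>M. nrm (dif (ip_scale V c (u m)) (ip_scale V c (u n))) < e"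
  proof (intro exI allI impI)
    fix m n assume "m \<ge> M" "n \<ge> M"
    then have "nrm (dif (u m) (u n)) < e / (cmod c + 1)" using M by auto
    then have "nrm (dif (u m) (u n)) * (cmod c + 1) < e"
      by (simp add: pos_less_divide_eq add_nonneg_pos)
    moreover have "0 \<le> nrm (dif (u m) (u n))"
      using Cauchy_closed[OF u] by (simp add: norm_nonneg closed)
    ultimately show "nrm (dif (ip_scale V c (u m)) (ip_scale V c (u n))) < e"
      using Cauchy_closed[OF u] by (simp add: norm_diff_scale algebra_simps)
  qed
qed (simp add: closed Cauchy_closed u)

lemma Cauchy_diff:
  "\<lbrakk>u \<in> ip_Cauchy V; v \<in> ip_Cauchy V\<rbrakk> \<Longrightarrow> (\<lambda>n. dif (u n) (v n)) \<in> ip_Cauchy V"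
  unfolding ip_diff_def by (intro Cauchy_add Cauchy_scale)

lemma convergent_inner:
  assumes u: "u \<in> ip_Cauchy V" and v: "v \<in> ip_Cauchy V"
  shows "convergent (\<lambda>n. inn (u n) (v n))"
proof -
  obtain K L where K: "K > 0" "\<And>n. nrm (u n) \<le> K" and L: "L > 0" "\<And>n. nrm (v n) \<le> L"
    using Cauchy_bounded[OF u] Cauchy_bounded[OF v] by auto
  note cl = Cauchy_closed[OF u] Cauchy_closed[OF v]
  have "Cauchy (\<lambda>n. inn (u n) (v n))"
    unfolding Cauchy_def dist_norm
  proof (intro allI impI)
    fix e :: real assume e: "e > 0"
    obtain M N where M: "\<forall>m\<ge>M. \<forall>n\<ge>M. nrm (dif (u m) (u n)) < e/(2*L)"
      and N: "\<forall>m\<ge>N. \<forall>n\<ge>N. nrm (dif (v m) (v n)) < e/(2*K)"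
      using Cauchy_norm_diff[OF u, of "e/(2*L)"] Cauchy_norm_diff[OF v, of "e/(2*K)"] e K L by auto
    show "\<exists>M. \<forall>m\<ge>M. \<forall>n\<ge>M. cmod (inn (u m) (v m) - inn (u n) (v n)) < e"
    proof (intro exI allI impI)
      fix m n assume "m \<ge> max M N" "n \<ge> max M N"
      then have *: "nrm (dif (u m) (u n)) < e/(2*L)" "nrm (dif (v m) (v n)) < e/(2*K)"
        using M N by auto
      have "cmod (inn (u m) (v m) - inn (u n) (v n)) \<le>
          nrm (dif (u m) (u n)) * nrm (v m) + nrm (u n) * nrm (dif (v m) (v n))"
        by (rule inner_diff_bound) (simp_all add: cl)
      also have "\<dots> \<le> nrm (dif (u m) (u n)) * L + K * nrm (dif (v m) (v n))"
        by (intro add_mono mult_left_mono mult_right_mono K L) (simp_all add: norm_nonneg cl closed)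
      also have "\<dots> < e/(2*L) * L + K * (e/(2*K))"
        by (intro add_strict_mono mult_strict_left_mono mult_strict_right_mono * K L)
      also have "\<dots> = e" using K L by simp
      finally show "cmod (inn (u m) (v m) - inn (u n) (v n)) < e" .
    qed
  qed
  then show ?thesis by (rule Cauchy_convergent)
qed

lemma null_relD:
  assumes "(u, u') \<in> ip_null_rel V"
  shows "u \<in> ip_Cauchy V" "u' \<in> ip_Cauchy V" "(\<lambda>n. nrm (dif (u n) (u' n))) \<longlonglongrightarrow> 0"
  using assms by (simp_all add: ip_null_rel_def)

lemma inner_null_rel:
  assumes uu: "(u, u') \<in> ip_null_rel V" and vv: "(v, v') \<in> ip_null_rel V"
  shows "(\<lambda>n. inn (u n) (v n) - inn (u' n) (v' n)) \<longlonglongrightarrow> 0"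
proof -
  note u = null_relD[OF uu] and v = null_relD[OF vv]
  note cl = Cauchy_closed[OF u(1)] Cauchy_closed[OF u(2)] Cauchy_closed[OF v(1)] Cauchy_closed[OF v(2)]
  obtain K L where K: "K > 0" "\<And>n. nrm (u' n) \<le> K" and L: "L > 0" "\<And>n. nrm (v n) \<le> L"
    using Cauchy_bounded[OF u(2)] Cauchy_bounded[OF v(1)] by auto
  show ?thesis
  proof (rule Lim_null_comparison)
    show "eventually (\<lambda>n. norm (inn (u n) (v n) - inn (u' n) (v' n)) \<le>
        nrm (dif (u n) (u' n)) * L + K * nrm (dif (v n) (v' n))) sequentially"
    proof (rule always_eventually, rule allI)
      fix n
      have "cmod (inn (u n) (v n) - inn (u' n) (v' n)) \<le>
          nrm (dif (u n) (u' n)) * nrm (v n) + nrm (u' n) * nrm (dif (v n) (v' n))"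
        by (rule inner_diff_bound) (simp_all add: cl)
      also have "\<dots> \<le> nrm (dif (u n) (u' n)) * L + K * nrm (dif (v n) (v' n))"
        by (intro add_mono mult_left_mono mult_right_mono K L) (simp_all add: norm_nonneg cl closed)
      finally show "cmod (inn (u n) (v n) - inn (u' n) (v' n)) \<le> \<dots>" .
    qed
    show "(\<lambda>n. nrm (dif (u n) (u' n)) * L + K * nrm (dif (v n) (v' n))) \<longlonglongrightarrow> 0"
      using tendsto_add[OF tendsto_mult_left_zero[OF u(3), of L] tendsto_mult_right_zero[OF v(3), of K]]
      by simp
  qed
qed

text \<open>The approximants form a minimizing sequence for the distance from \<open>x\<close> to \<open>M\<close>, so they
  represent the orthogonal projection of \<open>x\<close> in the completion.\<close>

lemma projection_sequence:
  assumes M: "subsp M" and x: "x \<in> C"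
  obtains p \<eta> where "\<And>n. p n \<in> M" "p \<in> ip_Cauchy V" "\<eta> \<longlonglongrightarrow> (0::real)"
    "\<And>n z. z \<in> M \<Longrightarrow> cmod (inn (dif x (p n)) z) \<le> \<eta> n * nrm z"
proof -
  define D where "D = (\<lambda>z. (nrm (dif x z))\<^sup>2) ` M"
  define \<delta> where "\<delta> = Inf D"
  have ne: "D \<noteq> {}" using M by (auto simp: D_def subsp_def)
  have bdd: "bdd_below D" unfolding D_def by (rule bdd_belowI2[of _ 0]) simp
  have MC: "z \<in> M \<Longrightarrow> z \<in> C" for z using M by (auto simp: subsp_def)
  have le: "z \<in> M \<Longrightarrow> \<delta> \<le> (nrm (dif x z))\<^sup>2" for z
    unfolding \<delta>_def by (rule cInf_lower[OF _ bdd]) (simp add: D_def)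
  \<comment> \<open>The root of the excess 1/(n+1) of the squared distance over its infimum; this is
    the rate that the discriminant bound yields.\<close>
  define \<eta> where "\<eta> n = sqrt (1 / real (Suc n))" for n
  have "\<exists>z\<in>M. (nrm (dif x z))\<^sup>2 < \<delta> + 1 / real (Suc n)" for n
  proof -
    have "Inf D < \<delta> + 1 / real (Suc n)" unfolding \<delta>_def by simp
    then obtain y where "y \<in> D" "y < \<delta> + 1 / real (Suc n)"
      using cInf_lessD[OF ne] by blast
    then show ?thesis by (auto simp: D_def)
  qed
  then obtain p where p: "\<And>n. p n \<in> M" "\<And>n. (nrm (dif x (p n)))\<^sup>2 < \<delta> + 1 / real (Suc n)"
    by metis
  have orth: "cmod (inn (dif x (p n)) z) \<le> \<eta> n * nrm z" if z: "z \<in> M" for n z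
  proof -
    \<comment> \<open>Moving the near-minimizer \<open>p n\<close> along \<open>z\<close> stays in
      \<open>M\<close>, so the squared distance cannot fall below \<open>\<delta>\<close>. As a
      quadratic in the coefficient of \<open>z\<close>, this bounds the linear term.\<close>
    have "(cmod (inn (dif x (p n)) z))\<^sup>2 \<le> ((nrm (dif x (p n)))\<^sup>2 - \<delta>) * (nrm z)\<^sup>2"
    proof (rule quadratic_nonneg_imp_le)
      fix c :: complex
      define w where "w = ip_scale V (- cnj c) z"
      have w: "w \<in> M" using M z by (simp add: w_def subsp_def)
      then have wp: "ip_add V (p n) w \<in> M" using M p by (simp add: subsp_def)
      have "nrm (dif x (ip_add V (p n) w)) = nrm (dif (dif x (p n)) w)"
        using x MC[OF p(1)[of n]] MC[OF w] by (simp add: ip_norm_def inner_simps closed algebra_simps)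
      then have "\<delta> \<le> (nrm (dif x (p n)))\<^sup>2 - 2 * Re (inn (dif x (p n)) w) + (nrm w)\<^sup>2"
        using le[OF wp] x MC[OF p(1)[of n]] MC[OF w] by (simp add: norm_diff_sq closed)
      moreover have "inn (dif x (p n)) w = - (c * inn (dif x (p n)) z)"
        using x MC[OF p(1)[of n]] MC[OF z] by (simp add: w_def inner_scale_right closed)
      moreover have "(nrm w)\<^sup>2 = (cmod c)\<^sup>2 * (nrm z)\<^sup>2"
        using MC[OF z] by (simp add: w_def norm_scale power_mult_distrib)
      ultimately show "0 \<le> ((nrm (dif x (p n)))\<^sup>2 - \<delta>) + 2 * Re (c * inn (dif x (p n)) z)
          + (cmod c)\<^sup>2 * (nrm z)\<^sup>2"
        by simp
    qed
    also have "\<dots> \<le> (1 / real (Suc n)) * (nrm z)\<^sup>2"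
      using p(2)[of n] by (intro mult_right_mono) auto
    also have "\<dots> = (\<eta> n * nrm z)\<^sup>2"
      by (simp add: \<eta>_def power_mult_distrib)
    finally show ?thesis
      by (rule power2_le_imp_le) (simp add: \<eta>_def norm_nonneg MC z)
  qed
  have \<eta>0: "\<eta> \<longlonglongrightarrow> 0"
    unfolding \<eta>_def using tendsto_real_sqrt[OF lim_inverse_n'[THEN LIMSEQ_Suc]] by simp
  \<comment> \<open>The difference of two approximants lies in \<open>M\<close>, so both
    almost-orthogonality relations can be tested on it.\<close>
  have pp: "nrm (dif (p m) (p n)) \<le> \<eta> m + \<eta> n" for m n
  proof -
    define r where "r = dif (p m) (p n)"
    have r: "r \<in> M" unfolding r_def by (rule subsp_diff[OF M p(1) p(1)])
    have "inn r r = inn (dif x (p n)) r - inn (dif x (p m)) r"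
      unfolding r_def using x MC[OF p(1)] by (simp add: inner_simps closed)
    then have "(nrm r)\<^sup>2 \<le> cmod (inn (dif x (p n)) r - inn (dif x (p m)) r)"
      using inner_self[OF MC[OF r]] by (metis norm_of_real abs_of_nonneg zero_le_power2 order_refl)
    also have "\<dots> \<le> cmod (inn (dif x (p n)) r) + cmod (inn (dif x (p m)) r)"
      by (rule norm_triangle_ineq4)
    also have "\<dots> \<le> \<eta> n * nrm r + \<eta> m * nrm r"
      by (intro add_mono orth r)
    finally have *: "nrm r * nrm r \<le> (\<eta> m + \<eta> n) * nrm r"
      by (simp add: power2_eq_square algebra_simps)
    show ?thesis
    proof (cases "nrm r = 0")
      case True
      then show ?thesis unfolding r_def by (simp add: \<eta>_def)
    next
      case False
      then have "nrm r > 0" using norm_nonneg[OF MC[OF r]] by simp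
      with * have "nrm r \<le> \<eta> m + \<eta> n" by simp
      then show ?thesis unfolding r_def .
    qed
  qed
  have "p \<in> ip_Cauchy V"
    unfolding ip_Cauchy_def
  proof (intro CollectI conjI allI impI)
    fix e :: real assume "e > 0"
    then have "eventually (\<lambda>n. \<eta> n < e/2) sequentially"
      using \<eta>0 by (intro order_tendstoD(2)[of _ 0]) auto
    then obtain M where "\<And>n. n \<ge> M \<Longrightarrow> \<eta> n < e/2"
      by (auto simp: eventually_sequentially)
    then have "nrm (dif (p m) (p n)) < e" if "m \<ge> M" "n \<ge> M" for m n
      using pp[of m n] that by (smt (verit) field_sum_of_halves)
    then show "\<exists>M. \<forall>m\<ge>M. \<forall>n\<ge>M. nrm (dif (p m) (p n)) < e" by blast
  qed (rule MC[OF p(1)])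
  with p(1) \<eta>0 orth show ?thesis using that by blast
qed

end

section \<open>The completion\<close>

context semi_ip_space
begin

lemma equiv_null_rel: "equiv (ip_Cauchy V) (ip_null_rel V)"
proof (rule equivI)
  show "ip_null_rel V \<subseteq> ip_Cauchy V \<times> ip_Cauchy V"
    by (auto simp: ip_null_rel_def)
  show "refl_on (ip_Cauchy V) (ip_null_rel V)"
    by (rule refl_onI) (simp add: ip_null_rel_def norm_diff_self Cauchy_closed)
  show "sym (ip_null_rel V)"
  proof (rule symI)
    fix u v assume "(u, v) \<in> ip_null_rel V"
    note uv = null_relD[OF this]
    have "(\<lambda>n. nrm (dif (v n) (u n))) = (\<lambda>n. nrm (dif (u n) (v n)))"
      using Cauchy_closed[OF uv(1)] Cauchy_closed[OF uv(2)] by (simp add: norm_diff_commute)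
    with uv show "(v, u) \<in> ip_null_rel V" by (simp add: ip_null_rel_def)
  qed
  show "trans (ip_null_rel V)"
  proof (rule transI)
    fix u v w assume "(u, v) \<in> ip_null_rel V" "(v, w) \<in> ip_null_rel V"
    note uv = null_relD[OF this(1)] and vw = null_relD[OF this(2)]
    note cl = Cauchy_closed[OF uv(1)] Cauchy_closed[OF uv(2)] Cauchy_closed[OF vw(2)]
    have "(\<lambda>n. nrm (dif (u n) (w n))) \<longlonglongrightarrow> 0"
    proof (rule Lim_null_comparison)
      show "(\<lambda>n. nrm (dif (u n) (v n)) + nrm (dif (v n) (w n))) \<longlonglongrightarrow> 0"
        using tendsto_add[OF uv(3) vw(3)] by simp
      show "eventually (\<lambda>n. norm (nrm (dif (u n) (w n))) \<le>
          nrm (dif (u n) (v n)) + nrm (dif (v n) (w n))) sequentially"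
        by (simp add: norm_nonneg closed cl norm_diff_triangle)
    qed
    with uv vw show "(u, w) \<in> ip_null_rel V" by (simp add: ip_null_rel_def)
  qed
qed

definition cls :: "(nat \<Rightarrow> 'v) \<Rightarrow> (nat \<Rightarrow> 'v) set" where
  "cls u = ip_null_rel V `` {u}"

abbreviation "W \<equiv> ip_completion V"

lemma carrier_completion: "X \<in> ip_carrier W \<longleftrightarrow> (\<exists>u\<in>ip_Cauchy V. X = cls u)"
  by (auto simp: ip_completion_def quotient_def cls_def)

lemma cls_closed: "u \<in> ip_Cauchy V \<Longrightarrow> cls u \<in> ip_carrier W"
  by (auto simp: carrier_completion)

lemma cls_eq: "(u, v) \<in> ip_null_rel V \<Longrightarrow> cls u = cls v"
  unfolding cls_def by (rule equiv_class_eq[OF equiv_null_rel])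

lemma null_rel_add:
  assumes "(u, u') \<in> ip_null_rel V" "(v, v') \<in> ip_null_rel V"
  shows "(\<lambda>n. ip_add V (u n) (v n), \<lambda>n. ip_add V (u' n) (v' n)) \<in> ip_null_rel V"
proof -
  note u = null_relD[OF assms(1)] and v = null_relD[OF assms(2)]
  note cl = Cauchy_closed[OF u(1)] Cauchy_closed[OF u(2)] Cauchy_closed[OF v(1)] Cauchy_closed[OF v(2)]
  have "(\<lambda>n. nrm (dif (ip_add V (u n) (v n)) (ip_add V (u' n) (v' n)))) \<longlonglongrightarrow> 0"
  proof (rule Lim_null_comparison)
    show "(\<lambda>n. nrm (dif (u n) (u' n)) + nrm (dif (v n) (v' n))) \<longlonglongrightarrow> 0"
      using tendsto_add[OF u(3) v(3)] by simp
  qed (simp add: norm_nonneg closed cl norm_diff_add_le)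
  with u v show ?thesis
    by (simp add: ip_null_rel_def Cauchy_add)
qed

lemma null_rel_scale:
  assumes "(u, u') \<in> ip_null_rel V"
  shows "(\<lambda>n. ip_scale V c (u n), \<lambda>n. ip_scale V c (u' n)) \<in> ip_null_rel V"
proof -
  note u = null_relD[OF assms]
  note cl = Cauchy_closed[OF u(1)] Cauchy_closed[OF u(2)]
  have "(\<lambda>n. nrm (dif (ip_scale V c (u n)) (ip_scale V c (u' n)))) \<longlonglongrightarrow> 0"
    using tendsto_mult_right_zero[OF u(3), of "cmod c"] by (simp add: norm_diff_scale cl)
  with u show ?thesis
    by (simp add: ip_null_rel_def Cauchy_scale)
qed

lemma completion_add:
  assumes "u \<in> ip_Cauchy V" "v \<in> ip_Cauchy V"
  shows "ip_add W (cls u) (cls v) = cls (\<lambda>n. ip_add V (u n) (v n))"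
proof -
  have "congruent2 (ip_null_rel V) (ip_null_rel V)
      (\<lambda>u v. ip_null_rel V `` {\<lambda>n. ip_add V (u n) (v n)})"
    by (rule congruent2I') (rule cls_eq[OF null_rel_add, unfolded cls_def])
  from UN_equiv_class2[OF equiv_null_rel equiv_null_rel this assms]
  show ?thesis by (simp add: ip_completion_def cls_def)
qed

lemma completion_scale:
  assumes "u \<in> ip_Cauchy V"
  shows "ip_scale W c (cls u) = cls (\<lambda>n. ip_scale V c (u n))"
proof -
  have "congruent (ip_null_rel V) (\<lambda>u. ip_null_rel V `` {\<lambda>n. ip_scale V c (u n)})"
    by (rule congruentI) (rule cls_eq[OF null_rel_scale, unfolded cls_def])
  from UN_equiv_class[OF equiv_null_rel this assms]
  show ?thesis by (simp add: ip_completion_def cls_def)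
qed

lemma completion_zero: "ip_zero W = cls (\<lambda>n. ip_zero V)"
  by (simp add: ip_completion_def cls_def)

lemma completion_diff:
  assumes "u \<in> ip_Cauchy V" "v \<in> ip_Cauchy V"
  shows "ip_diff W (cls u) (cls v) = cls (\<lambda>n. dif (u n) (v n))"
  unfolding ip_diff_def using assms by (simp add: completion_scale completion_add Cauchy_scale)

lemma completion_inner:
  assumes u: "u \<in> ip_Cauchy V" and v: "v \<in> ip_Cauchy V"
  shows "(\<lambda>n. inn (u n) (v n)) \<longlonglongrightarrow> ip_inner W (cls u) (cls v)"
proof -
  obtain z where z: "(\<lambda>n. inn (u n) (v n)) \<longlonglongrightarrow> z"
    using convergent_inner[OF u v] by (auto simp: convergent_def)
  have "ip_inner W (cls u) (cls v) = (THE z. \<forall>u\<in>cls u. \<forall>v\<in>cls v. (\<lambda>n. inn (u n) (v n)) \<longlonglongrightarrow> z)"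
    by (simp add: ip_completion_def)
  also have "\<dots> = z"
  proof (rule the_equality)
    show "\<forall>u'\<in>cls u. \<forall>v'\<in>cls v. (\<lambda>n. inn (u' n) (v' n)) \<longlonglongrightarrow> z"
    proof (intro ballI)
      fix u' v' assume "u' \<in> cls u" "v' \<in> cls v"
      then have "(\<lambda>n. inn (u n) (v n) - inn (u' n) (v' n)) \<longlonglongrightarrow> 0"
        by (intro inner_null_rel) (auto simp: cls_def)
      from tendsto_diff[OF z this] show "(\<lambda>n. inn (u' n) (v' n)) \<longlonglongrightarrow> z" by simp
    qed
    fix z' assume *: "\<forall>u\<in>cls u. \<forall>v\<in>cls v. (\<lambda>n. inn (u n) (v n)) \<longlonglongrightarrow> z'"
    have "u \<in> cls u" "v \<in> cls v"
      using u v equiv_class_self[OF equiv_null_rel] by (auto simp: cls_def)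
    with * have "(\<lambda>n. inn (u n) (v n)) \<longlonglongrightarrow> z'" by blast
    with z show "z' = z" using LIMSEQ_unique by blast
  qed
  finally show ?thesis using z by simp
qed

lemma completion_inner_eqI:
  "\<lbrakk>u \<in> ip_Cauchy V; v \<in> ip_Cauchy V; (\<lambda>n. inn (u n) (v n)) \<longlonglongrightarrow> z\<rbrakk> \<Longrightarrow> ip_inner W (cls u) (cls v) = z"
  using completion_inner LIMSEQ_unique by blast

lemma completion_norm:
  assumes "u \<in> ip_Cauchy V"
  shows "(\<lambda>n. nrm (u n)) \<longlonglongrightarrow> ip_norm W (cls u)"
  unfolding ip_norm_def by (intro tendsto_real_sqrt tendsto_Re completion_inner assms)

lemma semi_ip_completion: "semi_ip_space W"
proof
  fix X Y Z :: "(nat \<Rightarrow> 'v) set" and c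
  show "ip_zero W \<in> ip_carrier W"
    by (auto simp: completion_zero intro!: cls_closed Cauchy_const zero_closed)
  show "ip_add W X Y \<in> ip_carrier W" if "X \<in> ip_carrier W" "Y \<in> ip_carrier W"
    using that by (auto simp: carrier_completion completion_add intro!: Cauchy_add)
  show "ip_scale W c X \<in> ip_carrier W" if "X \<in> ip_carrier W"
    using that by (auto simp: carrier_completion completion_scale intro!: Cauchy_scale)
  show "ip_inner W (ip_add W X Y) Z = ip_inner W X Z + ip_inner W Y Z"
    if XYZ: "X \<in> ip_carrier W" "Y \<in> ip_carrier W" "Z \<in> ip_carrier W"
  proof -
    obtain u v w where u: "u \<in> ip_Cauchy V" "X = cls u" and v: "v \<in> ip_Cauchy V" "Y = cls v"
      and w: "w \<in> ip_Cauchy V" "Z = cls w"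
      using XYZ by (auto simp: carrier_completion)
    show ?thesis
      unfolding u v w completion_add[OF u(1) v(1)]
      using tendsto_add[OF completion_inner[OF u(1) w(1)] completion_inner[OF v(1) w(1)]]
      by (intro completion_inner_eqI Cauchy_add u v w)
        (simp add: inner_add_left Cauchy_closed u v w)
  qed
  show "ip_inner W (ip_scale W c X) Z = c * ip_inner W X Z"
    if XYZ: "X \<in> ip_carrier W" "Z \<in> ip_carrier W"
  proof -
    obtain u w where u: "u \<in> ip_Cauchy V" "X = cls u" and w: "w \<in> ip_Cauchy V" "Z = cls w"
      using XYZ by (auto simp: carrier_completion)
    show ?thesis
      unfolding u w completion_scale[OF u(1)]
      using tendsto_mult_left[OF completion_inner[OF u(1) w(1)], of c]
      by (intro completion_inner_eqI Cauchy_scale u w)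
        (simp add: inner_scale_left Cauchy_closed u w)
  qed
  show "ip_inner W X Y = cnj (ip_inner W Y X)" if XYZ: "X \<in> ip_carrier W" "Y \<in> ip_carrier W"
  proof -
    obtain u w where u: "u \<in> ip_Cauchy V" "X = cls u" and w: "w \<in> ip_Cauchy V" "Y = cls w"
      using XYZ by (auto simp: carrier_completion)
    have "(\<lambda>n. cnj (inn (w n) (u n))) \<longlonglongrightarrow> cnj (ip_inner W (cls w) (cls u))"
      by (intro tendsto_cnj completion_inner u w)
    then show ?thesis
      unfolding u w by (intro completion_inner_eqI u w)
        (simp add: inner_commute[OF Cauchy_closed[OF u(1)] Cauchy_closed[OF w(1)]])
  qed
  show "ip_inner W (ip_zero W) Z = 0" if XYZ: "Z \<in> ip_carrier W"
  proof -
    obtain w where w: "w \<in> ip_Cauchy V" "Z = cls w"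
      using XYZ by (auto simp: carrier_completion)
    then show ?thesis
      unfolding completion_zero w
      by (intro completion_inner_eqI Cauchy_const zero_closed w) (simp add: inner_zero_left Cauchy_closed)
  qed
  show "0 \<le> Re (ip_inner W X X)" if XYZ: "X \<in> ip_carrier W"
  proof -
    obtain u where u: "u \<in> ip_Cauchy V" "X = cls u"
      using XYZ by (auto simp: carrier_completion)
    show ?thesis
      unfolding u by (rule LIMSEQ_le_const[OF tendsto_Re[OF completion_inner[OF u(1) u(1)]]])
        (simp add: inner_nonneg Cauchy_closed u)
  qed
qed

lemma completion_definite:
  assumes "X \<in> ip_carrier W" "ip_norm W X = 0"
  shows "X = ip_zero W"
proof -
  obtain u where u: "u \<in> ip_Cauchy V" "X = cls u"
    using assms by (auto simp: carrier_completion)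
  have "(\<lambda>n. nrm (dif (u n) (ip_zero V))) = (\<lambda>n. nrm (u n))"
    using Cauchy_closed[OF u(1)] by (simp add: ip_norm_def inner_simps closed)
  then have "(\<lambda>n. nrm (dif (u n) (ip_zero V))) \<longlonglongrightarrow> 0"
    using completion_norm[OF u(1)] assms u(2) by simp
  then show ?thesis
    unfolding u completion_zero
    by (intro cls_eq) (simp add: ip_null_rel_def u Cauchy_const zero_closed)
qed

lemma ip_class_eq: "ip_class V x = cls (\<lambda>n. x)"
  by (simp add: ip_class_def cls_def)

lemma class_closed: "x \<in> C \<Longrightarrow> ip_class V x \<in> ip_carrier W"
  by (simp add: ip_class_eq cls_closed Cauchy_const)

lemma class_add: "\<lbrakk>x \<in> C; y \<in> C\<rbrakk> \<Longrightarrow> ip_add W (ip_class V x) (ip_class V y) = ip_class V (ip_add V x y)"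
  by (simp add: ip_class_eq completion_add Cauchy_const)

lemma norm_diff_class:
  "\<lbrakk>x \<in> C; y \<in> C\<rbrakk> \<Longrightarrow> ip_norm W (ip_diff W (ip_class V x) (ip_class V y)) = nrm (dif x y)"
  using completion_norm[of "\<lambda>n. dif x y"]
  by (simp add: ip_class_eq completion_diff Cauchy_const closed LIMSEQ_const_iff)

lemma inner_class_right:
  "\<lbrakk>u \<in> ip_Cauchy V; x \<in> C\<rbrakk> \<Longrightarrow> (\<lambda>n. inn (u n) x) \<longlonglongrightarrow> ip_inner W (cls u) (ip_class V x)"
  unfolding ip_class_eq by (intro completion_inner Cauchy_const)

text \<open>Density of the original space in its completion: the distance from \<open>u m\<close> to
  the class of \<open>u\<close> is a limit of distances within the tail of \<open>u\<close>.\<close>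

lemma class_tendsto:
  assumes u: "u \<in> ip_Cauchy V"
  shows "ip_tendsto W (\<lambda>n. ip_class V (u n)) (cls u)"
  unfolding ip_tendsto_def
proof (rule LIMSEQ_I)
  fix e :: real assume "e > 0"
  then obtain M where M: "\<forall>m\<ge>M. \<forall>n\<ge>M. nrm (dif (u m) (u n)) < e/2"
    using Cauchy_norm_diff[OF u, of "e/2"] by auto
  interpret W: semi_ip_space W by (rule semi_ip_completion)
  show "\<exists>no. \<forall>n\<ge>no. norm (ip_norm W (ip_diff W (ip_class V (u n)) (cls u)) - 0) < e"
  proof (intro exI allI impI)
    fix m assume m: "m \<ge> M"
    have um: "u m \<in> C" by (rule Cauchy_closed[OF u])
    have "(\<lambda>n. nrm (dif (u m) (u n))) \<longlonglongrightarrow> ip_norm W (ip_diff W (ip_class V (u m)) (cls u))"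
      using completion_norm[OF Cauchy_diff[OF Cauchy_const[OF um] u]]
      by (simp add: ip_class_eq completion_diff Cauchy_const um u)
    then have "ip_norm W (ip_diff W (ip_class V (u m)) (cls u)) \<le> e/2"
      by (rule LIMSEQ_le_const2) (use M m in \<open>auto intro!: exI[of _ M] less_imp_le\<close>)
    moreover have "0 \<le> ip_norm W (ip_diff W (ip_class V (u m)) (cls u))"
      by (intro W.norm_nonneg W.closed class_closed um cls_closed u)
    ultimately show "norm (ip_norm W (ip_diff W (ip_class V (u m)) (cls u)) - 0) < e"
      using \<open>e > 0\<close> by simp
  qed
qed

lemma inner_tendsto:
  assumes z: "z \<in> C" and p: "\<And>n. p n \<in> C" and x: "x \<in> C" and lim: "ip_tendsto V p x"
  shows "(\<lambda>n. inn z (p n)) \<longlonglongrightarrow> inn z x"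
proof -
  have "(\<lambda>n. inn z (p n) - inn z x) \<longlonglongrightarrow> 0"
  proof (rule Lim_null_comparison)
    show "eventually (\<lambda>n. norm (inn z (p n) - inn z x) \<le> nrm z * nrm (dif (p n) x)) sequentially"
      using Cauchy_Schwarz[OF z diff_closed[OF p x]] by (simp add: inner_diff_right z p x)
    show "(\<lambda>n. nrm z * nrm (dif (p n) x)) \<longlonglongrightarrow> 0"
      using lim by (auto simp: ip_tendsto_def intro: tendsto_mult_right_zero)
  qed
  then show ?thesis by (simp add: LIM_zero_iff)
qed

text \<open>Translates a trivial orthogonal complement in the completion into approximability in the
  space itself. If some \<open>x\<close> stays away from \<open>M\<close>, the residual of its
  projection sequence represents a non-zero vector orthogonal to \<open>D\<close>. Conversely, a
  vector orthogonal to \<open>M\<close> is orthogonal to the approximable \<open>Xs\<close>, then by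
  \<open>dec\<close> to the whole space, and by density to itself. The set \<open>D\<close> lies
  between the classes of \<open>M\<close> and their closure, as the domain and the range of a graph
  closure do.\<close>

lemma ominus_completion_trivial_iff:
  assumes M: "subsp M" and Xs: "Xs \<subseteq> C"
    and dec: "\<And>y. y \<in> C \<Longrightarrow> \<exists>m\<in>M. \<exists>x\<in>Xs. \<forall>z\<in>C. inn z y = inn z m + inn z x"
    and D: "ip_class V ` M \<subseteq> D" "D \<subseteq> ip_carrier W"
    and D_lim: "\<And>X. X \<in> D \<Longrightarrow> \<exists>p. (\<forall>n. p n \<in> ip_class V ` M) \<and> ip_tendsto W p X"
  shows "ip_ominus W D \<subseteq> {ip_zero W} \<longleftrightarrow> (\<forall>x\<in>Xs. \<forall>e>0. \<exists>m\<in>M. nrm (dif x m) < e)"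
    (is "?L \<longleftrightarrow> ?R")
proof
  interpret W: semi_ip_space W by (rule semi_ip_completion)
  have MC: "m \<in> M \<Longrightarrow> m \<in> C" for m using M by (auto simp: subsp_def)
  show ?R if ?L
  proof (rule ccontr)
    assume "\<not> ?R"
    then obtain x e where x: "x \<in> Xs" and e: "e > 0" and far: "\<And>m. m \<in> M \<Longrightarrow> nrm (dif x m) \<ge> e"
      by (force simp: not_less)
    have xC: "x \<in> C" using x Xs by auto
    obtain p \<eta> where p: "\<And>n. p n \<in> M" "p \<in> ip_Cauchy V" and \<eta>: "\<eta> \<longlonglongrightarrow> (0::real)"
      and orth: "\<And>n z. z \<in> M \<Longrightarrow> cmod (inn (dif x (p n)) z) \<le> \<eta> n * nrm z"
      using projection_sequence[OF M xC] by metis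
    define u where "u n = dif x (p n)" for n
    have u: "u \<in> ip_Cauchy V"
      unfolding u_def[abs_def] by (intro Cauchy_diff Cauchy_const xC p)
    have u0: "ip_inner W (cls u) (ip_class V m) = 0" if m: "m \<in> M" for m
    proof -
      have "(\<lambda>n. inn (u n) m) \<longlonglongrightarrow> 0"
      proof (rule Lim_null_comparison)
        show "eventually (\<lambda>n. norm (inn (u n) m) \<le> \<eta> n * nrm m) sequentially"
          using orth[OF m] by (simp add: u_def)
        show "(\<lambda>n. \<eta> n * nrm m) \<longlonglongrightarrow> 0"
          by (intro tendsto_mult_left_zero \<eta>)
      qed
      then show ?thesis
        using inner_class_right[OF u MC[OF m]] LIMSEQ_unique by blast
    qed
    have "cls u \<in> ip_ominus W D"
      unfolding ip_ominus_def
    proof (intro CollectI conjI ballI)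
      fix Y assume Y: "Y \<in> D"
      then obtain q where q: "\<And>n. q n \<in> ip_class V ` M" "ip_tendsto W q Y"
        using D_lim by metis
      have "(\<lambda>n. ip_inner W (cls u) (q n)) \<longlonglongrightarrow> ip_inner W (cls u) Y"
        using q Y D by (intro W.inner_tendsto cls_closed u) auto
      moreover have "ip_inner W (cls u) (q n) = 0" for n
        using q(1)[of n] u0 by auto
      ultimately show "ip_inner W (cls u) Y = 0"
        by (simp add: LIMSEQ_const_iff)
    qed (rule cls_closed[OF u])
    with \<open>?L\<close> have "ip_norm W (cls u) = 0"
      using W.norm_zero by auto
    moreover have "e \<le> ip_norm W (cls u)"
      by (rule LIMSEQ_le_const[OF completion_norm[OF u]]) (simp add: u_def far p)
    ultimately show False using e by simp
  qed
  show ?L if ?R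
  proof
    fix X assume X: "X \<in> ip_ominus W D"
    then obtain u where u: "u \<in> ip_Cauchy V" "X = cls u"
      by (auto simp: ip_ominus_def carrier_completion)
    have XC: "X \<in> ip_carrier W" using X by (simp add: ip_ominus_def)
    have XM: "ip_inner W X (ip_class V m) = 0" if "m \<in> M" for m
      using X that D by (auto simp: ip_ominus_def)
    have Xx: "ip_inner W X (ip_class V x) = 0" if x: "x \<in> Xs" for x
    proof -
      have xC: "x \<in> C" using x Xs by auto
      have "cmod (ip_inner W X (ip_class V x)) \<le> 0 + e" if "e > 0" for e
      proof -
        have "0 < e / (ip_norm W X + 1)"
          using \<open>e > 0\<close> W.norm_nonneg[OF XC] by (simp add: add_nonneg_pos)
        then obtain m where m: "m \<in> M" "nrm (dif x m) < e / (ip_norm W X + 1)"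
          using \<open>?R\<close> x by blast
        have "ip_inner W X (ip_class V x) = ip_inner W X (ip_diff W (ip_class V x) (ip_class V m))"
          by (simp add: W.inner_diff_right class_closed xC MC m(1) XC XM)
        also have "cmod \<dots> \<le> ip_norm W X * nrm (dif x m)"
          using W.Cauchy_Schwarz[OF XC W.diff_closed[OF class_closed[OF xC] class_closed[OF MC[OF m(1)]]]]
          by (simp add: norm_diff_class xC MC m)
        also have "\<dots> \<le> (ip_norm W X + 1) * nrm (dif x m)"
          by (intro mult_right_mono) (simp_all add: norm_nonneg closed xC MC m)
        also have "\<dots> \<le> e"
          using m(2) W.norm_nonneg[OF XC] by (simp add: pos_less_divide_eq add_nonneg_pos mult.commute)
        finally show ?thesis by simp
      qed
      then have "cmod (ip_inner W X (ip_class V x)) \<le> 0"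
        by (rule field_le_epsilon)
      then show ?thesis by simp
    qed
    have Xy: "ip_inner W X (ip_class V y) = 0" if y: "y \<in> C" for y
    proof -
      obtain m x where mx: "m \<in> M" "x \<in> Xs" "\<forall>z\<in>C. inn z y = inn z m + inn z x"
        using dec[OF y] by blast
      have "x \<in> C" using mx Xs by auto
      then have "(\<lambda>n. inn (u n) m + inn (u n) x) \<longlonglongrightarrow>
          ip_inner W X (ip_class V m) + ip_inner W X (ip_class V x)"
        unfolding u by (intro tendsto_add inner_class_right u(1) MC[OF mx(1)])
      then have "(\<lambda>n. inn (u n) y) \<longlonglongrightarrow> 0"
        using mx Xx[OF mx(2)] XM[OF mx(1)] Cauchy_closed[OF u(1)] by simp
      then show ?thesis
        using inner_class_right[OF u(1) y] LIMSEQ_unique u(2) by blast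
    qed
    \<comment> \<open>\<open>X\<close> is a limit of classes of vectors of \<open>C\<close>, all of
      which are orthogonal to it.\<close>
    have "(\<lambda>n. ip_inner W X (ip_class V (u n))) \<longlonglongrightarrow> ip_inner W X X"
      using class_tendsto[OF u(1)] Cauchy_closed[OF u(1)]
      by (intro W.inner_tendsto XC class_closed) (auto simp: u(2))
    then have "ip_inner W X X = 0"
      by (simp add: Xy Cauchy_closed[OF u(1)] LIMSEQ_const_iff)
    then have "ip_norm W X = 0" by (simp add: ip_norm_def)
    then show "X \<in> {ip_zero W}"
      using completion_definite[OF XC] by simp
  qed
qed

end

section \<open>Orthonormal bases and defect numbers\<close>

text \<open>A non-zero vector orthogonal to a maximal orthonormal set could be normalized and added
  to it. Existence has to be known before anything can be said about the basis that
  \<open>hilbert_dim\<close> picks with \<open>SOME\<close>.\<close>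

lemma (in semi_ip_space) orthonormal_basis_exists:
  assumes M: "M \<subseteq> C" "\<And>c x. x \<in> M \<Longrightarrow> ip_scale V c x \<in> M"
    and definite: "\<And>x. \<lbrakk>x \<in> C; nrm x = 0\<rbrakk> \<Longrightarrow> x = ip_zero V"
  shows "\<exists>B. orthonormal_basis V M B"
proof -
  define ons where "ons = {B. B \<subseteq> M \<and> (\<forall>x\<in>B. \<forall>y\<in>B. inn x y = (if x = y then 1 else 0))}"
  have "\<exists>B\<in>ons. \<forall>X\<in>ons. B \<subseteq> X \<longrightarrow> X = B"
  proof (rule subset_Zorn_nonempty)
    show "ons \<noteq> {}" by (auto simp: ons_def intro!: exI[of _ "{}"])
    fix c assume c: "c \<noteq> {}" "subset.chain ons c"
    then have *: "B \<in> c \<Longrightarrow> B \<in> ons" "\<lbrakk>B \<in> c; B' \<in> c\<rbrakk> \<Longrightarrow> B \<subseteq> B' \<or> B' \<subseteq> B" for B B'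
      by (auto simp: subset.chain_def subset_chain_def)
    show "\<Union>c \<in> ons"
      unfolding ons_def
    proof (intro CollectI conjI ballI)
      show "\<Union>c \<subseteq> M" using *(1) by (auto simp: ons_def)
      fix x y assume "x \<in> \<Union>c" "y \<in> \<Union>c"
      then obtain B where "B \<in> c" "x \<in> B" "y \<in> B" using *(2) by blast
      then show "inn x y = (if x = y then 1 else 0)" using *(1) by (auto simp: ons_def)
    qed
  qed
  then obtain B where B: "B \<in> ons" and max: "\<And>X. \<lbrakk>X \<in> ons; B \<subseteq> X\<rbrakk> \<Longrightarrow> X = B" by blast
  have "z = ip_zero V" if z: "z \<in> M" "\<forall>x\<in>B. inn z x = 0" for z
  proof (rule ccontr)
    assume "z \<noteq> ip_zero V"
    then have nz: "nrm z \<noteq> 0" using definite z M by blast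
    define w where "w = ip_scale V (of_real (1 / nrm z)) z"
    have zC: "z \<in> C" using z M by auto
    have w: "w \<in> M" "w \<in> C" using z M by (auto simp: w_def)
    have ww: "inn w w = 1"
    proof -
      have "nrm w = 1"
        using nz norm_nonneg[OF zC] norm_scale[OF zC] by (simp add: w_def norm_divide)
      then show ?thesis by (simp add: inner_self w)
    qed
    have wB: "inn w x = 0" "inn x w = 0" if "x \<in> B" for x
    proof -
      have xC: "x \<in> C" using that B M by (auto simp: ons_def)
      show "inn w x = 0" using z(2) that by (simp add: w_def inner_scale_left zC xC)
      then show "inn x w = 0" using inner_commute[OF xC w(2)] by simp
    qed
    have "insert w B \<in> ons"
      using B w ww wB by (auto simp: ons_def)
    then have "w \<in> B" using max[of "insert w B"] by auto
    then show False using wB(1) ww by simp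
  qed
  then have "orthonormal_basis V M B"
    using B unfolding orthonormal_basis_def ons_def by blast
  then show ?thesis ..
qed

lemma (in semi_ip_space) hilbert_dim_eq_czero_iff:
  assumes M: "M \<subseteq> C" "\<And>c x. x \<in> M \<Longrightarrow> ip_scale V c x \<in> M"
    and definite: "\<And>x. \<lbrakk>x \<in> C; nrm x = 0\<rbrakk> \<Longrightarrow> x = ip_zero V"
  shows "hilbert_dim V M = BNF_Cardinal_Arithmetic.czero \<longleftrightarrow> M \<subseteq> {ip_zero V}"
proof -
  define B where "B = (SOME B. orthonormal_basis V M B)"
  have B: "orthonormal_basis V M B"
    unfolding B_def by (rule someI_ex[OF orthonormal_basis_exists[OF assms]])
  have "B = {} \<longleftrightarrow> M \<subseteq> {ip_zero V}"
  proof
    show "B = {}" if "M \<subseteq> {ip_zero V}"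
    proof (rule ccontr)
      assume "B \<noteq> {}"
      then obtain x where x: "x \<in> B" by blast
      then have "inn x x = 1" "x = ip_zero V"
        using B that unfolding orthonormal_basis_def by auto
      then show False by (simp add: inner_zero_left zero_closed)
    qed
    show "M \<subseteq> {ip_zero V}" if "B = {}"
      using B that unfolding orthonormal_basis_def by blast
  qed
  \<comment> \<open>The equation is one between well-orders, not an isomorphism; equal orders have
    equal fields, and the field of \<open>card_of B\<close> is \<open>B\<close>.\<close>
  moreover have "(card_of B = card_of ({} :: 'v set)) \<longleftrightarrow> B = {}"
    by (metis Field_card_of)
  ultimately show ?thesis
    by (simp add: hilbert_dim_def czero_def B_def)
qed

section \<open>Complex Hilbert spaces\<close>

lemma cinner_add_right: "cinner x (y + z) = cinner x y + cinner x (z::'a::complex_hilbert)"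
  by (metis cinner_add_left cinner_commute complex_cnj_add)

lemma cinner_scaleC_right: "cinner x (c *\<^sub>C y) = cnj c * cinner x (y::'a::complex_hilbert)"
  by (metis cinner_scaleC_left cinner_commute complex_cnj_mult)

lemma scaleC_zero_right [simp]: "c *\<^sub>C (0::'a::complex_hilbert) = 0"
  using scaleC_add_right[of c 0 "0::'a"] by simp

lemma scaleC_zero_left [simp]: "0 *\<^sub>C (x::'a::complex_hilbert) = 0"
  using scaleC_add_left[of 0 0 x] by simp

lemma scaleC_one [simp]: "1 *\<^sub>C (x::'a::complex_hilbert) = x"
  using scaleR_eq_scaleC[of 1 x] by simp

lemma scaleC_minus_one: "(- 1) *\<^sub>C (x::'a::complex_hilbert) = - x"
  using scaleR_eq_scaleC[of "- 1" x] by simp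

lemma cinner_zero_left [simp]: "cinner 0 (x::'a::complex_hilbert) = 0"
  using cinner_add_left[of 0 0 x] by simp

lemma cinner_zero_right [simp]: "cinner (x::'a::complex_hilbert) 0 = 0"
  using cinner_add_right[of x 0 0] by simp

lemma cinner_minus_left: "cinner (- x) (y::'a::complex_hilbert) = - cinner x y"
  using cinner_scaleC_left[of "- 1" x y] by (simp add: scaleC_minus_one)

lemma cinner_minus_right: "cinner x (- y::'a::complex_hilbert) = - cinner x y"
  using cinner_scaleC_right[of x "- 1" y] by (simp add: scaleC_minus_one)

lemma cinner_diff_left: "cinner (x - y) (z::'a::complex_hilbert) = cinner x z - cinner y z"
  using cinner_add_left[of x "- y" z] by (simp add: cinner_minus_left)

lemma cinner_diff_right: "cinner x (y - z::'a::complex_hilbert) = cinner x y - cinner x z"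
  using cinner_add_right[of x y "- z"] by (simp add: cinner_minus_right)

lemma cinner_sum_left: "cinner (sum f A) (y::'a::complex_hilbert) = (\<Sum>i\<in>A. cinner (f i) y)"
  by (induction A rule: infinite_finite_induct) (simp_all add: cinner_add_left)

lemma cinner_eqI: "(\<And>z. cinner x z = cinner y z) \<Longrightarrow> x = (y::'a::complex_hilbert)"
proof -
  assume "\<And>z. cinner x z = cinner y z"
  then have "cinner (x - y) (x - y) = 0" by (simp add: cinner_diff_left)
  then show ?thesis by (simp add: cinner_self)
qed

text \<open>Views the type as a space with a carrier, so that Cauchy-Schwarz and the projection
  sequences apply to it as well.\<close>

definition hilbert_ip :: "'a::complex_hilbert ip_space" where
  "hilbert_ip = \<lparr> ip_carrier = UNIV, ip_zero = 0, ip_add = (+), ip_scale = scaleC, ip_inner = cinner \<rparr>"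

lemma hilbert_ip_simps [simp]:
  "ip_carrier hilbert_ip = UNIV" "ip_zero hilbert_ip = 0" "ip_add hilbert_ip = (+)"
  "ip_scale hilbert_ip = scaleC" "ip_inner hilbert_ip = cinner"
  by (simp_all add: hilbert_ip_def)

lemma ip_norm_hilbert [simp]: "ip_norm hilbert_ip x = norm x"
  by (simp add: ip_norm_def cinner_self)

lemma ip_diff_hilbert [simp]: "ip_diff hilbert_ip x y = x - y"
  by (simp add: ip_diff_def scaleC_minus_one)

interpretation hilbert: semi_ip_space "hilbert_ip :: 'a::complex_hilbert ip_space"
  by unfold_locales
    (auto simp: cinner_add_left cinner_scaleC_left cinner_self intro: cinner_commute)

lemma cinner_Cauchy_Schwarz: "cmod (cinner x y) \<le> norm x * norm (y::'a::complex_hilbert)"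
  using hilbert.Cauchy_Schwarz[of x y] by simp

lemma tendsto_cinner_right:
  assumes "(f \<longlongrightarrow> l) F"
  shows "((\<lambda>x. cinner y (f x)) \<longlongrightarrow> cinner y (l::'a::complex_hilbert)) F"
proof -
  have "((\<lambda>x. cinner y (f x) - cinner y l) \<longlongrightarrow> 0) F"
  proof (rule Lim_null_comparison)
    show "\<forall>\<^sub>F x in F. norm (cinner y (f x) - cinner y l) \<le> norm y * norm (f x - l)"
      using cinner_Cauchy_Schwarz[of y "_ - l"] by (simp add: cinner_diff_right)
    show "((\<lambda>x. norm y * norm (f x - l)) \<longlongrightarrow> 0) F"
      using assms by (intro tendsto_mult_right_zero) (simp add: LIM_zero tendsto_norm_zero)
  qed
  then show ?thesis by (simp add: LIM_zero_iff)
qed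

lemma tendsto_cinner_left:
  assumes "(f \<longlongrightarrow> l) F"
  shows "((\<lambda>x. cinner (f x) y) \<longlongrightarrow> cinner l (y::'a::complex_hilbert)) F"
  using tendsto_cnj[OF tendsto_cinner_right[OF assms, of y]]
  by (simp flip: cinner_commute)

lemma norm_leI_cinner:
  assumes "0 \<le> K" "\<And>y. cmod (cinner v y) \<le> K * norm (y::'a::complex_hilbert)"
  shows "norm v \<le> K"
proof (cases "v = 0")
  case False
  have "norm v * norm v \<le> K * norm v"
    using assms(2)[of v] by (simp add: cinner_self power2_eq_square norm_mult)
  then show ?thesis using False by simp
qed (use assms in simp)

text \<open>The representing vector is a multiple of the component of some \<open>x\<close> with
  \<phi> x \<noteq> 0 orthogonal to the kernel. Completeness of the space provides the limit
  \<open>q\<close> of the projection sequence.\<close>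

lemma Riesz_representation:
  fixes \<phi> :: "'a::complex_hilbert \<Rightarrow> complex"
  assumes add: "\<And>x y. \<phi> (x + y) = \<phi> x + \<phi> y" and scale: "\<And>c x. \<phi> (c *\<^sub>C x) = c * \<phi> x"
    and bound: "\<And>x. cmod (\<phi> x) \<le> K * norm x"
  shows "\<exists>w. \<forall>x. \<phi> x = cinner x w"
proof (cases "\<forall>x. \<phi> x = 0")
  case True
  then show ?thesis by (intro exI[of _ 0]) simp
next
  case False
  then obtain x where x: "\<phi> x \<noteq> 0" by blast
  have diff: "\<phi> (y - z) = \<phi> y - \<phi> z" for y z
    using add[of "y - z" z] by simp
  have \<phi>0: "\<phi> 0 = 0" using scale[of 0 0] by simp
  have lim: "(\<lambda>n. \<phi> (f n)) \<longlonglongrightarrow> \<phi> l" if "f \<longlonglongrightarrow> l" for f l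
  proof -
    have "(\<lambda>n. \<phi> (f n) - \<phi> l) \<longlonglongrightarrow> 0"
    proof (rule Lim_null_comparison)
      show "\<forall>\<^sub>F n in sequentially. norm (\<phi> (f n) - \<phi> l) \<le> K * norm (f n - l)"
        using bound[of "_ - l"] by (simp add: diff)
      show "(\<lambda>n. K * norm (f n - l)) \<longlonglongrightarrow> 0"
        using that by (intro tendsto_mult_right_zero) (simp add: LIM_zero tendsto_norm_zero)
    qed
    then show ?thesis by (simp add: LIM_zero_iff)
  qed
  define M where "M = {x. \<phi> x = 0}"
  have "hilbert.subsp M"
    by (auto simp: hilbert.subsp_def M_def add scale \<phi>0)
  then obtain p \<eta> where p: "\<And>n. p n \<in> M" "p \<in> ip_Cauchy hilbert_ip" and \<eta>: "\<eta> \<longlonglongrightarrow> (0::real)"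
    and orth: "\<And>n z. z \<in> M \<Longrightarrow> cmod (cinner (x - p n) z) \<le> \<eta> n * norm z"
    using hilbert.projection_sequence[of M x] by (metis UNIV_I hilbert_ip_simps(1,5) ip_diff_hilbert ip_norm_hilbert)
  have "Cauchy p"
    using p(2) by (simp add: ip_Cauchy_def Cauchy_def dist_norm)
  then obtain q where q: "p \<longlonglongrightarrow> q"
    using Cauchy_convergent convergent_def by blast
  have "\<phi> q = 0"
    using lim[OF q] p(1) by (simp add: M_def LIMSEQ_const_iff)
  define w where "w = x - q"
  have \<phi>w: "\<phi> w = \<phi> x" by (simp add: w_def diff \<open>\<phi> q = 0\<close>)
  have w0: "cinner z w = 0" if z: "\<phi> z = 0" for z
  proof -
    have "(\<lambda>n. cinner (x - p n) z) \<longlonglongrightarrow> 0"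
    proof (rule Lim_null_comparison)
      show "\<forall>\<^sub>F n in sequentially. norm (cinner (x - p n) z) \<le> \<eta> n * norm z"
        using orth[of z] z by (simp add: M_def)
      show "(\<lambda>n. \<eta> n * norm z) \<longlonglongrightarrow> 0" by (intro tendsto_mult_left_zero \<eta>)
    qed
    moreover have "(\<lambda>n. cinner (x - p n) z) \<longlonglongrightarrow> cinner w z"
      unfolding w_def by (intro tendsto_cinner_left tendsto_diff tendsto_const q)
    ultimately have "cinner w z = 0" using LIMSEQ_unique by blast
    then show ?thesis using cinner_commute[of z w] by simp
  qed
  have ww: "cinner w w \<noteq> 0" using \<phi>w x \<phi>0 by (auto simp: cinner_self)
  show ?thesis
  proof (intro exI allI)
    fix y
    \<comment> \<open>Subtracting a multiple of \<open>w\<close> moves \<open>y\<close> into the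
      kernel, to which \<open>w\<close> is orthogonal.\<close>
    have "\<phi> (y - (\<phi> y / \<phi> w) *\<^sub>C w) = 0"
      using x \<phi>w by (simp add: diff scale)
    from w0[OF this] have "cinner y w = \<phi> y / \<phi> w * cinner w w"
      by (simp add: cinner_diff_left cinner_scaleC_left)
    then show "\<phi> y = cinner y (cnj (\<phi> w / cinner w w) *\<^sub>C w)"
      using ww x \<phi>w by (simp add: cinner_scaleC_right)
  qed
qed

section \<open>Sesquilinear forms\<close>

definition sesquilinear :: "('a::complex_hilbert \<Rightarrow> 'a \<Rightarrow> complex) \<Rightarrow> bool" where
  "sesquilinear b \<longleftrightarrow> (\<forall>x y z. b (x + y) z = b x z + b y z) \<and> (\<forall>x y z. b z (x + y) = b z x + b z y) \<and>
     (\<forall>c x y. b (c *\<^sub>C x) y = c * b x y) \<and> (\<forall>c x y. b x (c *\<^sub>C y) = cnj c * b x y)"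

lemma sesquilinearD:
  assumes "sesquilinear b"
  shows "b (x + y) z = b x z + b y z" "b z (x + y) = b z x + b z y"
    "b (c *\<^sub>C x) y = c * b x y" "b x (c *\<^sub>C y) = cnj c * b x y" "b 0 x = 0" "b x 0 = 0"
proof -
  show "b (x + y) z = b x z + b y z" "b z (x + y) = b z x + b z y"
    "b (c *\<^sub>C x) y = c * b x y" "b x (c *\<^sub>C y) = cnj c * b x y"
    using assms by (simp_all add: sesquilinear_def)
  have "b (0 *\<^sub>C 0) x = 0 * b 0 x" "b x (0 *\<^sub>C 0) = cnj 0 * b x 0"
    using assms unfolding sesquilinear_def by blast+
  then show "b 0 x = 0" "b x 0 = 0" by simp_all
qed

lemma sesquilinear_cinner:
  assumes "bounded_clinear T"
  shows "sesquilinear (\<lambda>x y. cinner (T x) y)"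
  using assms unfolding bounded_clinear_def sesquilinear_def
  by (simp add: linear_simps cinner_add_left cinner_add_right cinner_scaleC_left cinner_scaleC_right)

lemma sesquilinear_swap: "sesquilinear b \<Longrightarrow> sesquilinear (\<lambda>x y. cnj (b y x))"
  by (simp add: sesquilinear_def)

lemma sesquilinear_add:
  "\<lbrakk>sesquilinear b; sesquilinear b'\<rbrakk> \<Longrightarrow> sesquilinear (\<lambda>x y. b x y + b' x y)"
  by (simp add: sesquilinear_def algebra_simps)

lemma sesquilinear_diff:
  "\<lbrakk>sesquilinear b; sesquilinear b'\<rbrakk> \<Longrightarrow> sesquilinear (\<lambda>x y. b x y - b' x y)"
  by (simp add: sesquilinear_def algebra_simps)

lemma sesquilinear_mult:
  "sesquilinear b \<Longrightarrow> sesquilinear (\<lambda>x y. a * b x y)"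
  by (simp add: sesquilinear_def algebra_simps)

lemma sesquilinear_sum:
  "(\<And>i. i \<in> A \<Longrightarrow> sesquilinear (b i)) \<Longrightarrow> sesquilinear (\<lambda>x y. \<Sum>i\<in>A. b i x y)"
  by (simp add: sesquilinear_def sum.distrib sum_distrib_left)

text \<open>Stated for filters because the limits occur along the filter of a cluster point and as
  one-sided limits in the real variable.\<close>

lemma sesquilinear_limit:
  fixes b' :: "'a::complex_hilbert \<Rightarrow> 'a \<Rightarrow> complex"
  assumes "F \<noteq> bot" "\<forall>\<^sub>F i in F. sesquilinear (b i)" "\<And>x y. ((\<lambda>i. b i x y) \<longlongrightarrow> b' x y) F"
  shows "sesquilinear b'"
  unfolding sesquilinear_def
proof (intro conjI allI)
  fix x y z :: 'a and c
  show "b' (x + y) z = b' x z + b' y z"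
    by (rule tendsto_unique[OF assms(1) assms(3)], rule Lim_transform_eventually,
      rule tendsto_add[OF assms(3) assms(3)], rule eventually_mono[OF assms(2)])
      (simp add: sesquilinearD)
  show "b' z (x + y) = b' z x + b' z y"
    by (rule tendsto_unique[OF assms(1) assms(3)], rule Lim_transform_eventually,
      rule tendsto_add[OF assms(3) assms(3)], rule eventually_mono[OF assms(2)])
      (simp add: sesquilinearD)
  show "b' (c *\<^sub>C x) y = c * b' x y"
    by (rule tendsto_unique[OF assms(1) assms(3)], rule Lim_transform_eventually,
      rule tendsto_mult_left[OF assms(3)], rule eventually_mono[OF assms(2)])
      (simp add: sesquilinearD)
  show "b' x (c *\<^sub>C y) = cnj c * b' x y"
    by (rule tendsto_unique[OF assms(1) assms(3)], rule Lim_transform_eventually,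
      rule tendsto_mult_left[OF assms(3)], rule eventually_mono[OF assms(2)])
      (simp add: sesquilinearD)
qed

text \<open>Riesz representation needs a functional linear in \<open>y\<close>, whereas
  \<open>b x\<close> is conjugate linear; hence the conjugates.\<close>

lemma bounded_sesquilinear_operator:
  assumes b: "sesquilinear b" and bound: "\<And>x y. cmod (b x y) \<le> K * norm x * norm y"
  shows "\<exists>T. bounded_clinear T \<and> (\<forall>x y. cinner (T x) y = b x y)"
proof -
  have "\<exists>w. \<forall>y. cnj (b x y) = cinner y w" for x
    by (rule Riesz_representation[where K = "K * norm x"])
      (use bound in \<open>simp_all add: sesquilinearD[OF b]\<close>)
  then obtain T where "\<And>x y. cnj (b x y) = cinner y (T x)" by metis
  then have T: "cinner (T x) y = b x y" for x y
    by (metis cinner_commute complex_cnj_cnj)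
  have add: "T (x + y) = T x + T y" for x y
    by (rule cinner_eqI) (simp add: T cinner_add_left sesquilinearD[OF b])
  have scale: "T (c *\<^sub>C x) = c *\<^sub>C T x" for c x
    by (rule cinner_eqI) (simp add: T cinner_scaleC_left sesquilinearD[OF b])
  have "norm (T x) \<le> norm x * \<bar>K\<bar>" for x
  proof (rule norm_leI_cinner)
    fix y
    have "cmod (cinner (T x) y) \<le> K * (norm x * norm y)" using bound[of x y] by (simp add: T)
    also have "\<dots> \<le> \<bar>K\<bar> * (norm x * norm y)" by (intro mult_right_mono) auto
    finally show "cmod (cinner (T x) y) \<le> norm x * \<bar>K\<bar> * norm y" by (simp add: ac_simps)
  qed simp
  then have "bounded_linear T"
    by (intro bounded_linear_intro[where K = "\<bar>K\<bar>"]) (simp_all add: add scale scaleR_eq_scaleC)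
  then show ?thesis using scale T by (auto simp: bounded_clinear_def)
qed

lemma bounded_clinear_norm_bound:
  assumes "bounded_clinear T"
  shows "\<exists>K\<ge>0. \<forall>x. norm (T x) \<le> K * norm x"
  using assms bounded_linear.nonneg_bounded[of T] by (auto simp: bounded_clinear_def mult.commute)

text \<open>As \<open>cadjoint\<close> is a definite description, an operator with its defining
  property must first be constructed by Riesz representation and shown to be the only one.\<close>

lemma cinner_cadjoint:
  assumes T: "bounded_clinear T"
  shows "cinner (cadjoint T x) y = cnj (cinner (T y) x)"
proof -
  obtain K where K: "K \<ge> 0" "\<And>x. norm (T x) \<le> K * norm x"
    using bounded_clinear_norm_bound[OF T] by blast
  have "cmod (cnj (cinner (T y) x)) \<le> K * norm x * norm y" for x y
  proof -
    have "cmod (cnj (cinner (T y) x)) \<le> norm (T y) * norm x"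
      using cinner_Cauchy_Schwarz[of "T y" x] by simp
    also have "\<dots> \<le> K * norm y * norm x" by (intro mult_right_mono K) simp
    finally show ?thesis by (simp add: ac_simps)
  qed
  from bounded_sesquilinear_operator[OF sesquilinear_swap[OF sesquilinear_cinner[OF T]] this]
  obtain T' where T': "\<And>x y. cinner (T' x) y = cnj (cinner (T y) x)" by blast
  have "cadjoint T = T'"
    unfolding cadjoint_def
  proof (rule the_equality)
    show "\<forall>x y. cinner (T x) y = cinner x (T' y)"
      using T' by (metis cinner_commute complex_cnj_cnj)
    fix R assume R: "\<forall>x y. cinner (T x) y = cinner x (R y)"
    show "R = T'"
    proof
      fix x show "R x = T' x"
        by (rule cinner_eqI) (metis R T' cinner_commute)
    qed
  qed
  then show ?thesis by (simp add: T')
qed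

text \<open>A real value at \<open>x + y\<close> determines the imaginary parts, one at
  \<open>x + \<i> *\<^sub>C y\<close> the real parts.\<close>

lemma sesquilinear_hermitian:
  assumes b: "sesquilinear b" and real: "\<And>x. b x x \<in> \<real>"
  shows "b x y = cnj (b y x)"
proof -
  have *: "Im (b x x) = 0" for x using real[of x] by (simp add: complex_is_Real_iff)
  have "Im (b x y) + Im (b y x) = 0"
    using *[of "x + y"] *[of x] *[of y] by (simp add: sesquilinearD[OF b])
  moreover have "Re (b x y) - Re (b y x) = 0"
    using *[of "x + \<i> *\<^sub>C y"] *[of x] *[of y] by (simp add: sesquilinearD[OF b])
  ultimately show ?thesis by (simp add: complex_eq_iff)
qed

lemma sesquilinear_polarization:
  assumes b: "sesquilinear b"
  shows "4 * b x y = b (x + y) (x + y) - b (x + (- 1) *\<^sub>C y) (x + (- 1) *\<^sub>C y)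
    + \<i> * b (x + \<i> *\<^sub>C y) (x + \<i> *\<^sub>C y) - \<i> * b (x + (- \<i>) *\<^sub>C y) (x + (- \<i>) *\<^sub>C y)"
  by (simp only: sesquilinearD[OF b]) (simp add: algebra_simps)

definition positive_form :: "('a::complex_hilbert \<Rightarrow> 'a \<Rightarrow> complex) \<Rightarrow> bool" where
  "positive_form b \<longleftrightarrow> sesquilinear b \<and> (\<forall>x. b x x \<in> \<real>\<^sub>\<ge>\<^sub>0)"

lemma positive_form_hermitian: "positive_form b \<Longrightarrow> b x y = cnj (b y x)"
  by (rule sesquilinear_hermitian) (auto simp: positive_form_def nonneg_Reals_subset_Reals[THEN subsetD])

lemma positive_form_Re: "positive_form b \<Longrightarrow> 0 \<le> Re (b x x)"
  by (auto simp: positive_form_def complex_nonneg_Reals_iff)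

text \<open>Cauchy-Schwarz in the direct sum of the spaces with forms \<open>b i\<close>. When the
  \<open>b i\<close> are the masses of a discrete operator measure, this is Cauchy-Schwarz for
  vector functions \<open>X\<close> and \<open>Y\<close> integrated against that measure.\<close>

lemma positive_form_sum_Cauchy_Schwarz:
  assumes b: "\<And>i. i \<in> I \<Longrightarrow> positive_form (b i)"
  shows "cmod (\<Sum>i\<in>I. b i (X i) (Y i)) \<le>
    sqrt (\<Sum>i\<in>I. Re (b i (X i) (X i))) * sqrt (\<Sum>i\<in>I. Re (b i (Y i) (Y i)))"
proof -
  have "(cmod (\<Sum>i\<in>I. b i (Y i) (X i)))\<^sup>2 \<le>
      (\<Sum>i\<in>I. Re (b i (X i) (X i))) * (\<Sum>i\<in>I. Re (b i (Y i) (Y i)))"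
  proof (rule quadratic_nonneg_imp_le)
    fix c :: complex
    have "0 \<le> (\<Sum>i\<in>I. Re (b i (X i + c *\<^sub>C Y i) (X i + c *\<^sub>C Y i)))"
      by (intro sum_nonneg positive_form_Re b)
    also have "\<dots> = (\<Sum>i\<in>I. Re (b i (X i) (X i)) + 2 * Re (c * b i (Y i) (X i)) +
        (cmod c)\<^sup>2 * Re (b i (Y i) (Y i)))"
    proof (rule sum.cong)
      fix i assume i: "i \<in> I"
      have s: "sesquilinear (b i)" using b[OF i] by (simp add: positive_form_def)
      have "b i (X i + c *\<^sub>C Y i) (X i + c *\<^sub>C Y i) = b i (X i) (X i) + c * b i (Y i) (X i)
          + cnj c * b i (X i) (Y i) + c * cnj c * b i (Y i) (Y i)"
        by (simp add: sesquilinearD[OF s] algebra_simps)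
      moreover have "Re (cnj c * b i (X i) (Y i)) = Re (c * b i (Y i) (X i))"
        using positive_form_hermitian[OF b[OF i], of "X i" "Y i"] by simp
      moreover have "c * cnj c = of_real ((cmod c)\<^sup>2)"
        by (simp only: complex_norm_square)
      ultimately show "Re (b i (X i + c *\<^sub>C Y i) (X i + c *\<^sub>C Y i)) =
          Re (b i (X i) (X i)) + 2 * Re (c * b i (Y i) (X i)) + (cmod c)\<^sup>2 * Re (b i (Y i) (Y i))"
        by simp
    qed simp
    also have "\<dots> = (\<Sum>i\<in>I. Re (b i (X i) (X i))) + 2 * Re (c * (\<Sum>i\<in>I. b i (Y i) (X i))) +
        (cmod c)\<^sup>2 * (\<Sum>i\<in>I. Re (b i (Y i) (Y i)))"
      by (simp only: sum.distrib sum_distrib_left Re_sum)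
    finally show "0 \<le> \<dots>" .
  qed
  moreover have "(\<Sum>i\<in>I. b i (X i) (Y i)) = cnj (\<Sum>i\<in>I. b i (Y i) (X i))"
    unfolding cnj_sum by (intro sum.cong refl positive_form_hermitian b)
  ultimately have "(cmod (\<Sum>i\<in>I. b i (X i) (Y i)))\<^sup>2 \<le>
      (\<Sum>i\<in>I. Re (b i (X i) (X i))) * (\<Sum>i\<in>I. Re (b i (Y i) (Y i)))"
    by (simp del: cnj_sum)
  then show ?thesis
    by (metis real_sqrt_mult real_le_rsqrt)
qed

section \<open>Positive definite sequences of forms\<close>

text \<open>The analogue of \<open>S_ext\<close> for forms: swapping and conjugating the arguments
  replaces the adjoint.\<close>

definition form_ext :: "(nat \<Rightarrow> 'a::complex_hilbert \<Rightarrow> 'a \<Rightarrow> complex) \<Rightarrow> int \<Rightarrow> 'a \<Rightarrow> 'a \<Rightarrow> complex" where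
  "form_ext s k x y = (if k \<ge> 0 then s (nat k) x y else cnj (s (nat (- k)) y x))"

definition toeplitz_form ::
    "(nat \<Rightarrow> 'a::complex_hilbert \<Rightarrow> 'a \<Rightarrow> complex) \<Rightarrow> nat \<Rightarrow> (nat \<Rightarrow> 'a) \<Rightarrow> (nat \<Rightarrow> 'a) \<Rightarrow> complex" where
  "toeplitz_form s d h g = (\<Sum>j\<le>d. \<Sum>k\<le>d. form_ext s (int j - int k) (h j) (g k))"

definition positive_definite ::
    "(nat \<Rightarrow> 'a::complex_hilbert \<Rightarrow> 'a \<Rightarrow> complex) \<Rightarrow> nat \<Rightarrow> bool" where
  "positive_definite s d \<longleftrightarrow> (\<forall>n\<le>d. sesquilinear (s n)) \<and> (\<forall>h. toeplitz_form s d h h \<in> \<real>\<^sub>\<ge>\<^sub>0)"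

text \<open>This is \<open>formal_space\<close> with forms in place of operators, which admits
  candidate moments before they are known to come from operators.\<close>

definition toeplitz_space ::
    "(nat \<Rightarrow> 'a::complex_hilbert \<Rightarrow> 'a \<Rightarrow> complex) \<Rightarrow> nat \<Rightarrow> (nat \<Rightarrow> 'a) ip_space" where
  "toeplitz_space s d =
     \<lparr> ip_carrier = {h. \<forall>j>d. h j = 0}, ip_zero = (\<lambda>j. 0), ip_add = (\<lambda>h g j. h j + g j),
       ip_scale = (\<lambda>c h j. c *\<^sub>C h j), ip_inner = toeplitz_form s d \<rparr>"

abbreviation single :: "nat \<Rightarrow> 'a::complex_hilbert \<Rightarrow> nat \<Rightarrow> 'a" where
  "single j x \<equiv> (\<lambda>i. if i = j then x else 0)"

lemma toeplitz_space_simps [simp]: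
  "ip_carrier (toeplitz_space s d) = {h. \<forall>j>d. h j = 0}" "ip_zero (toeplitz_space s d) = (\<lambda>j. 0)"
  "ip_add (toeplitz_space s d) = (\<lambda>h g j. h j + g j)"
  "ip_scale (toeplitz_space s d) = (\<lambda>c h j. c *\<^sub>C h j)"
  "ip_inner (toeplitz_space s d) = toeplitz_form s d"
  by (simp_all add: toeplitz_space_def)

lemma sesquilinear_form_ext:
  "(\<And>n. n \<le> d \<Longrightarrow> sesquilinear (s n)) \<Longrightarrow> \<bar>k\<bar> \<le> int d \<Longrightarrow> sesquilinear (form_ext s k)"
  unfolding form_ext_def by (cases "k \<ge> 0") (simp_all add: sesquilinear_swap)

lemma positive_definite_ext:
  "positive_definite s d \<Longrightarrow> \<bar>k\<bar> \<le> int d \<Longrightarrow> sesquilinear (form_ext s k)"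
  by (rule sesquilinear_form_ext) (auto simp: positive_definite_def)

lemma toeplitz_form_cong:
  "(\<And>n. n \<le> d \<Longrightarrow> s n = t n) \<Longrightarrow> toeplitz_form s d = toeplitz_form t d"
  by (intro ext) (auto simp: toeplitz_form_def form_ext_def intro!: sum.cong)

lemma positive_definite_cong:
  "(\<And>n. n \<le> d \<Longrightarrow> s n = t n) \<Longrightarrow> positive_definite s d = positive_definite t d"
  using toeplitz_form_cong[of d s t] by (auto simp: positive_definite_def)

lemma toeplitz_form_single:
  assumes "positive_definite s d" "j \<le> d"
  shows "toeplitz_form s d (single j x) g = (\<Sum>k\<le>d. form_ext s (int j - int k) x (g k))"
proof -
  have "toeplitz_form s d (single j x) g =
      (\<Sum>i\<le>d. if i = j then \<Sum>k\<le>d. form_ext s (int j - int k) x (g k) else 0)"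
    unfolding toeplitz_form_def
    by (intro sum.cong refl) (auto intro!: sum.neutral simp: sesquilinearD[OF positive_definite_ext[OF assms(1)]])
  then show ?thesis using assms by simp
qed

lemma toeplitz_form_single_single:
  assumes "positive_definite s d" "j \<le> d" "k \<le> d"
  shows "toeplitz_form s d (single j x) (single k y) = form_ext s (int j - int k) x y"
proof -
  have "toeplitz_form s d (single j x) (single k y) =
      (\<Sum>i\<le>d. if i = k then form_ext s (int j - int k) x y else 0)"
    unfolding toeplitz_form_single[OF assms(1,2)] using assms
    by (intro sum.cong refl) (auto simp: sesquilinearD[OF positive_definite_ext[OF assms(1)]])
  then show ?thesis using assms by simp
qed

lemma positive_definite_0:
  assumes "positive_definite s d"
  shows "positive_form (s 0)"
proof -
  have "s 0 x x \<in> \<real>\<^sub>\<ge>\<^sub>0" for x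
    using assms toeplitz_form_single_single[OF assms, of 0 0 x x]
    unfolding positive_definite_def by (auto simp: form_ext_def) (metis (full_types))
  then show ?thesis using assms by (auto simp: positive_form_def positive_definite_def)
qed

lemma form_ext_commute:
  assumes "positive_form (s 0)"
  shows "form_ext s k x y = cnj (form_ext s (- k) y x)"
  using positive_form_hermitian[OF assms, of x y] by (cases "k = 0") (auto simp: form_ext_def)

lemma semi_ip_toeplitz:
  assumes pd: "positive_definite s d"
  shows "semi_ip_space (toeplitz_space s d)"
proof
  have sq: "j \<le> d \<Longrightarrow> k \<le> d \<Longrightarrow> sesquilinear (form_ext s (int j - int k))" for j k
    by (rule positive_definite_ext[OF pd]) simp
  fix x y z :: "nat \<Rightarrow> 'a" and c
  show "ip_inner (toeplitz_space s d) (ip_add (toeplitz_space s d) x y) z =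
      ip_inner (toeplitz_space s d) x z + ip_inner (toeplitz_space s d) y z"
    unfolding toeplitz_space_simps toeplitz_form_def sum.distrib[symmetric]
    by (intro sum.cong refl) (simp add: sesquilinearD[OF sq])
  show "ip_inner (toeplitz_space s d) (ip_scale (toeplitz_space s d) c x) z =
      c * ip_inner (toeplitz_space s d) x z"
    unfolding toeplitz_space_simps toeplitz_form_def sum_distrib_left
    by (intro sum.cong refl) (simp add: sesquilinearD[OF sq])
  show "ip_inner (toeplitz_space s d) (ip_zero (toeplitz_space s d)) z = 0"
    unfolding toeplitz_space_simps toeplitz_form_def
    by (intro sum.neutral ballI) (simp add: sesquilinearD[OF sq])
  show "ip_inner (toeplitz_space s d) x y = cnj (ip_inner (toeplitz_space s d) y x)"
    unfolding toeplitz_space_simps toeplitz_form_def cnj_sum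
    by (subst sum.swap, intro sum.cong refl, subst form_ext_commute[of s, OF positive_definite_0[OF pd]])
      simp
  show "0 \<le> Re (ip_inner (toeplitz_space s d) x x)"
    using pd by (auto simp: positive_definite_def complex_nonneg_Reals_iff)
qed (simp_all)

section \<open>The shift on formal sums and the splitting of the Toeplitz form\<close>

definition shift_up :: "(nat \<Rightarrow> 'a::complex_hilbert) \<Rightarrow> nat \<Rightarrow> 'a" where
  "shift_up h j = (if j = 0 then 0 else h (j - 1))"

definition shift_down :: "(nat \<Rightarrow> 'a::complex_hilbert) \<Rightarrow> nat \<Rightarrow> 'a" where
  "shift_down h j = h (Suc j)"

text \<open>The formal sums with indices below \<open>d\<close> represent the domain of the
  isometry; those of \<open>ran_set\<close>, with indices from 1 to \<open>d\<close>, represent its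
  range.\<close>

definition dom_set :: "nat \<Rightarrow> (nat \<Rightarrow> 'a::complex_hilbert) set" where
  "dom_set d = {h. \<forall>j\<ge>d. h j = 0}"

definition ran_set :: "nat \<Rightarrow> (nat \<Rightarrow> 'a::complex_hilbert) set" where
  "ran_set d = {h. h 0 = 0 \<and> (\<forall>j>d. h j = 0)}"

lemma shift_up_ran: "h \<in> dom_set d \<Longrightarrow> shift_up h \<in> ran_set d"
  by (auto simp: dom_set_def ran_set_def shift_up_def)

lemma shift_down_dom: "h \<in> ran_set d \<Longrightarrow> shift_down h \<in> dom_set d"
  by (auto simp: dom_set_def ran_set_def shift_down_def)

lemma shift_up_down: "h \<in> ran_set d \<Longrightarrow> shift_up (shift_down h) = h"
  by (auto simp: ran_set_def shift_down_def shift_up_def)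

text \<open>The entries depend only on the difference of the indices, so raising both changes
  nothing: the shift is isometric.\<close>

lemma toeplitz_form_shift:
  assumes pd: "positive_definite s d" and p: "p \<in> dom_set d" and q: "q \<in> dom_set d"
  shows "toeplitz_form s d (shift_up p) (shift_up q) = toeplitz_form s d p q"
proof (cases d)
  case 0
  then show ?thesis using p q by (simp add: toeplitz_form_def shift_up_def dom_set_def)
next
  case (Suc e)
  have sq: "j \<le> Suc e \<Longrightarrow> k \<le> Suc e \<Longrightarrow> sesquilinear (form_ext s (int j - int k))" for j k
    by (rule positive_definite_ext[OF pd]) (simp add: Suc)
  have 1: "(\<Sum>k\<le>Suc e. form_ext s (int (Suc j) - int k) x (shift_up q k)) =
      (\<Sum>k\<le>e. form_ext s (int j - int k) x (q k))" if "j \<le> e" for j x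
    unfolding sum.atMost_Suc_shift using that sq[of "Suc j" 0]
    by (simp add: shift_up_def sesquilinearD)
  have "toeplitz_form s d (shift_up p) (shift_up q) =
      (\<Sum>j\<le>e. \<Sum>k\<le>Suc e. form_ext s (int (Suc j) - int k) (p j) (shift_up q k))"
    unfolding toeplitz_form_def Suc
      sum.atMost_Suc_shift[of "\<lambda>j. \<Sum>k\<le>Suc e. form_ext s (int j - int k) (shift_up p j) (shift_up q k)"]
    using sq[of 0] by (simp add: shift_up_def sesquilinearD del: sum.atMost_Suc of_nat_Suc)
  also have "\<dots> = (\<Sum>j\<le>e. \<Sum>k\<le>e. form_ext s (int j - int k) (p j) (q k))"
    by (intro sum.cong refl 1) simp
  also have "\<dots> = toeplitz_form s d p q"
  proof -
    have "p (Suc e) = 0" "q (Suc e) = 0" using p q by (auto simp: Suc dom_set_def)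
    moreover have "form_ext s (int (Suc e) - int k) 0 y = 0" "form_ext s (int k - int (Suc e)) y 0 = 0"
      if "k \<le> Suc e" for k y
      using sesquilinearD(5,6)[OF sq] that by blast+
    moreover have "form_ext s 0 0 0 = 0"
      using sesquilinearD(5)[OF sq[of 0 0]] by simp
    ultimately show ?thesis
      unfolding toeplitz_form_def Suc sum.atMost_Suc sum.distrib by (simp del: of_nat_Suc)
  qed
  finally show ?thesis .
qed

text \<open>The new moment occurs only in the pairing of index d+1 with index 0. The pairings of d+1
  with indices k from 1 to \<open>d\<close> equal those of \<open>d\<close> with k-1. Positivity in
  order d+1 thus becomes an inequality in the space of order \<open>d\<close>; setting entry d+1 to
  0 makes the lowered sum end at index d-1.\<close>

lemma toeplitz_form_Suc:
  assumes pd: "positive_definite s d" and b: "sesquilinear b"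
  shows "toeplitz_form (s(Suc d := b)) (Suc d) h h = toeplitz_form s d h h
    + of_real (2 * Re (b (h (Suc d)) (h 0) + toeplitz_form s d (single d (h (Suc d))) (shift_down (h(Suc d := 0)))))
    + s 0 (h (Suc d)) (h (Suc d))"
proof -
  define s' where "s' = s(Suc d := b)"
  define X where "X = h (Suc d)"
  have ext: "form_ext s' k = form_ext s k" if "\<bar>k\<bar> \<le> int d" for k
    using that by (auto simp: s'_def form_ext_def fun_eq_iff)
  have s'0: "positive_form (s' 0)"
    using positive_definite_0[OF pd] by (simp add: s'_def)
  define L where "L = (\<Sum>k\<le>d. form_ext s' (int (Suc d) - int k) X (h k))"
  have L: "L = b X (h 0) + toeplitz_form s d (single d X) (shift_down (h(Suc d := 0)))"
  proof (cases d)
    case 0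
    then show ?thesis
      using sesquilinearD(6)[OF positive_definite_ext[OF pd, of 0]]
      by (simp add: L_def toeplitz_form_def shift_down_def form_ext_def s'_def)
  next
    case (Suc e)
    have "L = form_ext s' (int (Suc d)) X (h 0) + (\<Sum>k\<le>e. form_ext s' (int (Suc d) - int (Suc k)) X (h (Suc k)))"
      unfolding L_def Suc by (subst sum.atMost_Suc_shift) simp
    also have "form_ext s' (int (Suc d)) X (h 0) = b X (h 0)"
      by (simp add: form_ext_def s'_def del: of_nat_Suc)
    \<comment> \<open>Both indices drop by one, which leads back to moments of order at most
      \<open>d\<close>.\<close>
    also have "(\<Sum>k\<le>e. form_ext s' (int (Suc d) - int (Suc k)) X (h (Suc k))) =
        (\<Sum>k\<le>e. form_ext s (int d - int k) X (shift_down (h(Suc d := 0)) k))"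
    proof (intro sum.cong refl)
      fix k assume "k \<in> {..e}"
      then show "form_ext s' (int (Suc d) - int (Suc k)) X (h (Suc k)) =
          form_ext s (int d - int k) X (shift_down (h(Suc d := 0)) k)"
        using ext[of "int d - int k"] Suc by (simp add: shift_down_def algebra_simps)
    qed
    also have "\<dots> = toeplitz_form s d (single d X) (shift_down (h(Suc d := 0)))"
      unfolding toeplitz_form_single[OF pd order_refl]
      using sesquilinearD(6)[OF positive_definite_ext[OF pd, of 0]]
      by (simp add: Suc shift_down_def)
    finally show ?thesis .
  qed
  have L': "(\<Sum>k\<le>d. form_ext s' (int k - int (Suc d)) (h k) X) = cnj L"
    unfolding L_def cnj_sum
    by (intro sum.cong refl, subst form_ext_commute[of s', OF s'0]) (simp add: algebra_simps)
  have "toeplitz_form s' (Suc d) h h =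
      (\<Sum>j\<le>d. (\<Sum>k\<le>d. form_ext s' (int j - int k) (h j) (h k)) + form_ext s' (int j - int (Suc d)) (h j) X)
      + (L + form_ext s' 0 X X)"
    by (simp add: toeplitz_form_def L_def X_def)
  also have "\<dots> = (\<Sum>j\<le>d. \<Sum>k\<le>d. form_ext s' (int j - int k) (h j) (h k)) + cnj L + (L + s 0 X X)"
    unfolding sum.distrib L' by (simp add: form_ext_def s'_def)
  also have "(\<Sum>j\<le>d. \<Sum>k\<le>d. form_ext s' (int j - int k) (h j) (h k)) = toeplitz_form s d h h"
    unfolding toeplitz_form_def by (intro sum.cong refl) (subst ext, auto)
  also have "toeplitz_form s d h h + cnj L + (L + s 0 X X) =
      toeplitz_form s d h h + of_real (2 * Re L) + s 0 X X"
    by (simp add: complex_eq_iff)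
  finally show ?thesis unfolding L s'_def X_def .
qed

section \<open>One-step extensions\<close>

lemma tendsto_zero_bounded_mult:
  fixes f :: "nat \<Rightarrow> complex"
  assumes "\<eta> \<longlonglongrightarrow> (0::real)" "\<And>n. cmod (f n) \<le> \<eta> n * k n" "\<And>n. 0 \<le> k n" "\<And>n. k n \<le> K"
  shows "f \<longlonglongrightarrow> 0"
proof (rule Lim_null_comparison)
  show "\<forall>\<^sub>F n in sequentially. norm (f n) \<le> \<bar>\<eta> n\<bar> * K"
  proof (rule always_eventually, rule allI)
    fix n
    have "cmod (f n) \<le> \<eta> n * k n" by (rule assms)
    also have "\<dots> \<le> \<bar>\<eta> n\<bar> * k n" by (intro mult_right_mono assms) simp
    also have "\<dots> \<le> \<bar>\<eta> n\<bar> * K" by (intro mult_left_mono assms) simp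
    finally show "norm (f n) \<le> \<bar>\<eta> n\<bar> * K" .
  qed
  show "(\<lambda>n. \<bar>\<eta> n\<bar> * K) \<longlonglongrightarrow> 0"
    using assms(1) by (intro tendsto_mult_left_zero tendsto_rabs_zero)
qed

lemma single_add: "single j (x + y) = (\<lambda>i. single j x i + single j (y::'a::complex_hilbert) i)"
  by auto

lemma single_scale: "single j (c *\<^sub>C x) = (\<lambda>i. c *\<^sub>C single j (x::'a::complex_hilbert) i)"
  by auto

locale pd_forms =
  fixes s :: "nat \<Rightarrow> 'a::complex_hilbert \<Rightarrow> 'a \<Rightarrow> complex" and d :: nat
  assumes pd: "positive_definite s d"
begin

sublocale semi_ip_space "toeplitz_space s d"
  by (rule semi_ip_toeplitz[OF pd])

abbreviation "V \<equiv> toeplitz_space s d"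
abbreviation "T \<equiv> toeplitz_form s d"

lemma subsp_dom: "subsp (dom_set d)"
  by (auto simp: subsp_def dom_set_def)

lemma subsp_ran: "subsp (ran_set d)"
  by (auto simp: subsp_def ran_set_def)

lemma dom_C: "z \<in> dom_set d \<Longrightarrow> z \<in> C"
  by (auto simp: dom_set_def)

lemma ran_C: "z \<in> ran_set d \<Longrightarrow> z \<in> C"
  by (auto simp: ran_set_def)

lemma single_C: "j \<le> d \<Longrightarrow> single j x \<in> C"
  by auto

lemma norm_shift_up: "z \<in> dom_set d \<Longrightarrow> nrm (shift_up z) = nrm z"
  by (simp add: ip_norm_def toeplitz_form_shift[OF pd])

lemma norm_shift_down: "z \<in> ran_set d \<Longrightarrow> nrm (shift_down z) = nrm z"
  using norm_shift_up[OF shift_down_dom] shift_up_down by metis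

lemma T_shift_up: "\<lbrakk>p \<in> dom_set d; z \<in> ran_set d\<rbrakk> \<Longrightarrow> T (shift_up p) z = T p (shift_down z)"
  using toeplitz_form_shift[OF pd _ shift_down_dom] shift_up_down by metis

lemma Cauchy_shift_up:
  assumes "u \<in> ip_Cauchy V" "\<And>n. u n \<in> dom_set d"
  shows "(\<lambda>n. shift_up (u n)) \<in> ip_Cauchy V"
proof -
  have "nrm (dif (shift_up (u m)) (shift_up (u n))) = nrm (dif (u m) (u n))" for m n
  proof -
    have "dif (shift_up (u m)) (shift_up (u n)) = shift_up (dif (u m) (u n))"
      by (auto simp: ip_diff_def shift_up_def)
    then show ?thesis
      using norm_shift_up[OF subsp_diff[OF subsp_dom assms(2) assms(2)]] by simp
  qed
  then show ?thesis
    using assms ran_C[OF shift_up_ran[OF assms(2)]] by (simp add: ip_Cauchy_def)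
qed

lemma Cauchy_shift_down:
  assumes "u \<in> ip_Cauchy V" "\<And>n. u n \<in> ran_set d"
  shows "(\<lambda>n. shift_down (u n)) \<in> ip_Cauchy V"
proof -
  have "nrm (dif (shift_down (u m)) (shift_down (u n))) = nrm (dif (u m) (u n))" for m n
  proof -
    have "dif (shift_down (u m)) (shift_down (u n)) = shift_down (dif (u m) (u n))"
      by (auto simp: ip_diff_def shift_down_def)
    then show ?thesis
      using norm_shift_down[OF subsp_diff[OF subsp_ran assms(2) assms(2)]] by simp
  qed
  then show ?thesis
    using assms dom_C[OF shift_down_dom[OF assms(2)]] by (simp add: ip_Cauchy_def)
qed

text \<open>Represents a vector of the completion orthogonal to \<open>M\<close>. The rate
  \<open>\<eta>\<close> is uniform in \<open>z\<close>, so such a sequence may also be paired with a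
  Cauchy sequence that varies within \<open>M\<close>.\<close>

definition asymp_orthogonal :: "(nat \<Rightarrow> nat \<Rightarrow> 'a) \<Rightarrow> (nat \<Rightarrow> 'a) set \<Rightarrow> bool" where
  "asymp_orthogonal u M \<longleftrightarrow> u \<in> ip_Cauchy V \<and>
     (\<exists>\<eta>. \<eta> \<longlonglongrightarrow> (0::real) \<and> (\<forall>n. \<forall>z\<in>M. cmod (T (u n) z) \<le> \<eta> n * nrm z))"

lemma asymp_orthogonal_tendsto:
  assumes u: "asymp_orthogonal u M" and z: "\<And>n. z n \<in> M" "z \<in> ip_Cauchy V"
  shows "(\<lambda>n. T (u n) (z n)) \<longlonglongrightarrow> 0" "(\<lambda>n. T (z n) (u n)) \<longlonglongrightarrow> 0"
proof -
  obtain \<eta> where \<eta>: "\<eta> \<longlonglongrightarrow> (0::real)" "\<And>n z. z \<in> M \<Longrightarrow> cmod (T (u n) z) \<le> \<eta> n * nrm z"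
    using u unfolding asymp_orthogonal_def by blast
  obtain K where K: "\<And>n. nrm (z n) \<le> K" using Cauchy_bounded[OF z(2)] by blast
  show *: "(\<lambda>n. T (u n) (z n)) \<longlonglongrightarrow> 0"
    by (rule tendsto_zero_bounded_mult[OF \<eta>(1)]) (rule \<eta>(2) z norm_nonneg Cauchy_closed[OF z(2)] K)+
  have "T (z n) (u n) = cnj (T (u n) (z n))" for n
    using inner_commute[of "z n" "u n"] Cauchy_closed[OF z(2)] u Cauchy_closed
    unfolding asymp_orthogonal_def toeplitz_space_simps by blast
  then show "(\<lambda>n. T (z n) (u n)) \<longlonglongrightarrow> 0"
    using tendsto_cnj[OF *] by simp
qed

lemma projection_exists:
  assumes "subsp M" "x \<in> C"
  obtains p where "\<And>n. p n \<in> M" "p \<in> ip_Cauchy V" "asymp_orthogonal (\<lambda>n. dif x (p n)) M"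
proof -
  obtain p \<eta> where p: "\<And>n. p n \<in> M" "p \<in> ip_Cauchy V" "\<eta> \<longlonglongrightarrow> (0::real)"
    "\<And>n z. z \<in> M \<Longrightarrow> cmod (T (dif x (p n)) z) \<le> \<eta> n * nrm z"
    using projection_sequence[OF assms] unfolding toeplitz_space_simps by metis
  then have "asymp_orthogonal (\<lambda>n. dif x (p n)) M"
    unfolding asymp_orthogonal_def by (auto intro!: Cauchy_diff Cauchy_const assms(2))
  with p show ?thesis using that by blast
qed

lemma lim_T: "\<lbrakk>u \<in> ip_Cauchy V; v \<in> ip_Cauchy V\<rbrakk> \<Longrightarrow> (\<lambda>n. T (u n) (v n)) \<longlonglongrightarrow> lim (\<lambda>n. T (u n) (v n))"
  using convergent_inner by (simp add: convergent_LIMSEQ_iff)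

lemma T_single_left:
  assumes "j \<le> d" "z \<in> C"
  shows "T (single j (x + y)) z = T (single j x) z + T (single j y) z"
    "T (single j (c *\<^sub>C x)) z = c * T (single j x) z"
  using inner_add_left[of "single j x" "single j y" z] inner_scale_left[of "single j x" z c] assms
  unfolding single_add single_scale by (simp_all del: toeplitz_space_simps(1) add: single_C)

lemma T_single_right:
  assumes "j \<le> d" "z \<in> C"
  shows "T z (single j (x + y)) = T z (single j x) + T z (single j y)"
    "T z (single j (c *\<^sub>C x)) = cnj c * T z (single j x)"
  using inner_add_right[of "single j x" "single j y" z] inner_scale_right[of "single j x" z c] assms
  unfolding single_add single_scale by (simp_all del: toeplitz_space_simps(1) add: single_C)

text \<open>
  In terms of the orthogonal projections \<open>P\<close> onto \<open>D(A)\<close> and \<open>Q\<close> onto \<open>R(A)\<close>, the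
  form \<open>b\<^sub>0(h, g)\<close> is \<open>(A P x\<^bsub>h,d\<^esub>, x\<^bsub>g,0\<^esub>) = (x\<^bsub>h,d\<^esub>, A\<^sup>-\<^sup>1 Q x\<^bsub>g,0\<^esub>)\<close>. The perturbation
  replaces the contraction \<open>A P\<close> by \<open>A P + c (\<sqdot>, u) v\<close> with \<open>u\<close> orthogonal to \<open>D(A)\<close> and \<open>v\<close>
  orthogonal to \<open>R(A)\<close>.
\<close>

lemma extension_exists:
  obtains b\<^sub>0 where "\<And>u v c. \<lbrakk>asymp_orthogonal u (dom_set d); asymp_orthogonal v (ran_set d);
      0 \<le> c; \<And>n. c * nrm (u n) * nrm (v n) \<le> 1\<rbrakk> \<Longrightarrow>
    positive_definite (s(Suc d := \<lambda>h g. b\<^sub>0 h g +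
      of_real c * lim (\<lambda>n. T (single d h) (u n)) * lim (\<lambda>n. T (v n) (single 0 g)))) (Suc d)"
proof -
  have "\<exists>p. (\<forall>n. p n \<in> dom_set d) \<and> p \<in> ip_Cauchy V \<and>
      asymp_orthogonal (\<lambda>n. dif (single d h) (p n)) (dom_set d)" for h
    by (rule projection_exists[OF subsp_dom single_C[OF order_refl]]) blast
  then obtain p where p: "\<And>h n. p h n \<in> dom_set d" "\<And>h. p h \<in> ip_Cauchy V"
    "\<And>h. asymp_orthogonal (\<lambda>n. dif (single d h) (p h n)) (dom_set d)" by metis
  have "\<exists>r. (\<forall>n. r n \<in> ran_set d) \<and> r \<in> ip_Cauchy V \<and>
      asymp_orthogonal (\<lambda>n. dif (single 0 g) (r n)) (ran_set d)" for g
    by (rule projection_exists[OF subsp_ran single_C[OF le0]]) blast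
  then obtain r where r: "\<And>g n. r g n \<in> ran_set d" "\<And>g. r g \<in> ip_Cauchy V"
    "\<And>g. asymp_orthogonal (\<lambda>n. dif (single 0 g) (r g n)) (ran_set d)" by metis
  note up = Cauchy_shift_up[OF p(2) p(1)] and dn = Cauchy_shift_down[OF r(2) r(1)]
  note sd = single_C[OF order_refl] and s0 = single_C[OF le0]
  note C_simps [simp] = Cauchy_closed[OF up] Cauchy_closed[OF dn] Cauchy_closed[OF p(2)]
    Cauchy_closed[OF r(2)] sd s0 diff_closed
  note [simp del] = toeplitz_space_simps(1)
  note ip = inner_simps[unfolded toeplitz_space_simps(5)]
  \<comment> \<open>The form of x_(h,d) against the inverse image of the projection of
    x_(g,0).\<close>
  define b where "b h g = lim (\<lambda>n. T (single d h) (shift_down (r g n)))" for h g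
  have b1: "(\<lambda>n. T (single d h) (shift_down (r g n))) \<longlonglongrightarrow> b h g" for h g
    unfolding b_def by (rule lim_T[OF Cauchy_const[OF sd] dn])
  have p_lim: "(\<lambda>n. T (p h n) (z n)) \<longlonglongrightarrow> l"
    if "(\<lambda>n. T (single d h) (z n)) \<longlonglongrightarrow> l" "\<And>n. z n \<in> dom_set d" "z \<in> ip_Cauchy V" for h z l
    using tendsto_diff[OF that(1) asymp_orthogonal_tendsto(1)[OF p(3) that(2,3)], of h] that(2)
    by (simp add: ip dom_C)
  \<comment> \<open>Moving the isometry across and dropping the orthogonal residuals on both sides
    identifies the two descriptions of \<open>b\<close>.\<close>
  have b2: "(\<lambda>n. T (shift_up (p h n)) (single 0 g)) \<longlonglongrightarrow> b h g" for h g
  proof -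
    have "(\<lambda>n. T (shift_up (p h n)) (r g n)) \<longlonglongrightarrow> b h g"
      unfolding T_shift_up[OF p(1) r(1)]
      by (rule p_lim[OF b1 shift_down_dom[OF r(1)] dn])
    from tendsto_add[OF this asymp_orthogonal_tendsto(2)[OF r(3)[of g] shift_up_ran[OF p(1)[of h]] up]]
    show ?thesis by (simp add: ip)
  qed
  \<comment> \<open>The sequences \<open>p h\<close> and \<open>r g\<close> are arbitrary choices
    and not linear in \<open>h\<close> and \<open>g\<close>. Each description of \<open>b\<close>
    contains one argument explicitly: \<open>b1\<close> gives linearity in \<open>h\<close>, and
    \<open>b2\<close> gives conjugate linearity in \<open>g\<close>.\<close>
  have sq_b: "sesquilinear b"
    unfolding sesquilinear_def
  proof (intro conjI allI)
    fix x y z c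
    show "b (x + y) z = b x z + b y z"
      using tendsto_add[OF b1[of x z] b1[of y z]] b1[of "x + y" z] LIMSEQ_unique
      by (simp add: T_single_left) blast
    show "b (c *\<^sub>C x) y = c * b x y"
      using tendsto_mult_left[OF b1[of x y], of c] b1[of "c *\<^sub>C x" y] LIMSEQ_unique
      by (simp add: T_single_left) blast
    show "b z (x + y) = b z x + b z y"
      using tendsto_add[OF b2[of z x] b2[of z y]] b2[of z "x + y"] LIMSEQ_unique
      by (simp add: T_single_right) blast
    show "b x (c *\<^sub>C y) = cnj c * b x y"
      using tendsto_mult_left[OF b2[of x y], of "cnj c"] b2[of x "c *\<^sub>C y"] LIMSEQ_unique
      by (simp add: T_single_right) blast
  qed
  show thesis
  proof (rule that[of b])
    fix u v and c :: real
    assume u: "asymp_orthogonal u (dom_set d)" and v: "asymp_orthogonal v (ran_set d)"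
      and c: "0 \<le> c" "\<And>n. c * nrm (u n) * nrm (v n) \<le> 1"
    have uC: "u \<in> ip_Cauchy V" and vC: "v \<in> ip_Cauchy V"
      using u v by (simp_all add: asymp_orthogonal_def)
    note [simp] = Cauchy_closed[OF uC] Cauchy_closed[OF vC]
    define \<alpha> where "\<alpha> h = lim (\<lambda>n. T (single d h) (u n))" for h
    define \<beta> where "\<beta> g = lim (\<lambda>n. T (v n) (single 0 g))" for g
    have \<alpha>: "(\<lambda>n. T (single d h) (u n)) \<longlonglongrightarrow> \<alpha> h" for h
      unfolding \<alpha>_def by (rule lim_T[OF Cauchy_const[OF sd] uC])
    have \<beta>: "(\<lambda>n. T (v n) (single 0 g)) \<longlonglongrightarrow> \<beta> g" for g
      unfolding \<beta>_def by (rule lim_T[OF vC Cauchy_const[OF s0]])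
    have "\<alpha> (x + y) = \<alpha> x + \<alpha> y" "\<alpha> (a *\<^sub>C x) = a * \<alpha> x" for x y a
      using tendsto_add[OF \<alpha>[of x] \<alpha>[of y]] \<alpha>[of "x + y"] tendsto_mult_left[OF \<alpha>[of x], of a]
        \<alpha>[of "a *\<^sub>C x"] LIMSEQ_unique
      by (simp_all add: T_single_left) blast+
    moreover have "\<beta> (x + y) = \<beta> x + \<beta> y" "\<beta> (a *\<^sub>C x) = cnj a * \<beta> x" for x y a
      using tendsto_add[OF \<beta>[of x] \<beta>[of y]] \<beta>[of "x + y"] tendsto_mult_left[OF \<beta>[of x], of "cnj a"]
        \<beta>[of "a *\<^sub>C x"] LIMSEQ_unique
      by (simp_all add: T_single_right) blast+
    ultimately have "sesquilinear (\<lambda>h g. of_real c * \<alpha> h * \<beta> g)"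
      by (simp add: sesquilinear_def algebra_simps)
    from sesquilinear_add[OF sq_b this]
    have sq: "sesquilinear (\<lambda>h g. b h g + of_real c * \<alpha> h * \<beta> g)" .
    define b' where "b' = (\<lambda>h g. b h g + of_real c * \<alpha> h * \<beta> g)"
    define s' where "s' = s(Suc d := b')"
    have "toeplitz_form s' (Suc d) f f \<in> \<real>\<^sub>\<ge>\<^sub>0" for f
    proof -
      \<comment> \<open>The form ignores entries beyond d+1; cutting them off puts \<open>y\<close>
        into the carrier.\<close>
      define h where "h j = (if j \<le> Suc d then f j else 0)" for j
      define X where "X = h (Suc d)"
      define x where "x = single d X"
      define y where "y = h(Suc d := 0)"
      \<comment> \<open>Without its entry at index 0, \<open>y\<close> lies in the range of the
        shift, where the isometry can be undone.\<close>
      define y' where "y' = y(0 := 0)"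
      define L where "L = b' X (h 0) + T x (shift_down y)"
      have x: "x \<in> C" unfolding x_def by (rule sd)
      have y: "y \<in> C" by (simp add: y_def h_def toeplitz_space_simps(1))
      have y': "y' \<in> ran_set d" by (simp add: y'_def y_def h_def ran_set_def)
      have dy: "shift_down y = shift_down y'" by (auto simp: shift_down_def y'_def)
      have yy: "y = (\<lambda>i. single 0 (h 0) i + y' i)" by (auto simp: y'_def y_def)
      have Ty: "T z y = T z (single 0 (h 0)) + T z y'" if "z \<in> C" for z
        using inner_add_right[of "single 0 (h 0)" y' z] ran_C[OF y'] that by (simp add: yy)
      define q where "q n = dif x (p X n)" for n
      \<comment> \<open>As \<open>u\<close> is orthogonal to the domain, pairing it with the
        residual \<open>q n\<close> has the same limit as pairing it with \<open>x\<close>. The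
        residual is preferred because its norm is exactly the room left in the contraction
        estimate.\<close>
      define \<gamma> where "\<gamma> n = of_real c * T (q n) (u n)" for n
      \<comment> \<open>Approximates the image of \<open>x\<close> under the perturbed
        contraction.\<close>
      define w where "w n = ip_add V (shift_up (p X n)) (ip_scale V (\<gamma> n) (v n))" for n
      have qC [simp]: "q n \<in> C" for n by (simp add: q_def x)
      have wC [simp]: "w n \<in> C" for n unfolding w_def by (intro closed) simp_all
      have q: "asymp_orthogonal q (dom_set d)"
        using p(3)[of X] by (simp add: q_def[abs_def] x_def)
      have "(\<lambda>n. T (single d X) (u n) - T (p X n) (u n)) \<longlonglongrightarrow> \<alpha> X - 0"
        by (intro tendsto_diff \<alpha> asymp_orthogonal_tendsto(2)[OF u p(1) p(2)])
      then have \<gamma>: "\<gamma> \<longlonglongrightarrow> of_real c * \<alpha> X"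
        unfolding \<gamma>_def[abs_def] by (intro tendsto_mult_left) (simp add: q_def x_def ip)
      have wy: "T (w n) y = T (shift_up (p X n)) (single 0 (h 0)) + \<gamma> n * T (v n) (single 0 (h 0))
          + (T (p X n) (shift_down y') + \<gamma> n * T (v n) y')" for n
        unfolding Ty[OF wC] unfolding w_def
        using ran_C[OF y'] by (simp add: inner_add_left[unfolded toeplitz_space_simps(5)]
          inner_scale_left[unfolded toeplitz_space_simps(5)] scale_closed T_shift_up[OF p(1) y']
          del: toeplitz_space_simps(3,4))
      have yd: "shift_down y' \<in> dom_set d" by (rule shift_down_dom[OF y'])
      have "(\<lambda>n. T (w n) y) \<longlonglongrightarrow> b X (h 0) + of_real c * \<alpha> X * \<beta> (h 0)
          + (T x (shift_down y') + of_real c * \<alpha> X * 0)"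
        unfolding wy
        by (intro tendsto_add tendsto_mult b2 \<gamma> \<beta> p_lim asymp_orthogonal_tendsto(1)[OF v] y'
            Cauchy_const ran_C dom_C yd) (simp add: x_def)
      then have wL: "(\<lambda>n. T (w n) y) \<longlonglongrightarrow> L"
        by (simp add: L_def b'_def dy)
      define \<delta> where "\<delta> n = cnj (\<gamma> n) * T (shift_up (p X n)) (v n)" for n
      have "\<delta> \<longlonglongrightarrow> cnj (of_real c * \<alpha> X) * 0"
        unfolding \<delta>_def[abs_def]
        by (intro tendsto_mult tendsto_cnj \<gamma> asymp_orthogonal_tendsto(2)[OF v] up shift_up_ran p(1))
      then have \<delta>: "\<delta> \<longlonglongrightarrow> 0" by simp
      have \<epsilon>: "(\<lambda>n. T (q n) (p X n)) \<longlonglongrightarrow> 0"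
        by (rule asymp_orthogonal_tendsto(1)[OF q p(1) p(2)])
      \<comment> \<open>Pythagoras up to two null sequences: the first part of \<open>w n\<close>
        has the norm of \<open>p X n\<close>, and the perturbation has at most the norm of the
        residual \<open>q n\<close>, by the choice of \<open>c\<close>.\<close>
      have w_le: "(nrm (w n))\<^sup>2 \<le> (nrm x)\<^sup>2 + (2 * Re (\<delta> n) - 2 * Re (T (q n) (p X n)))" for n
      proof -
        have "cmod (\<gamma> n) * nrm (v n) \<le> c * (nrm (q n) * nrm (u n)) * nrm (v n)"
          using Cauchy_Schwarz[of "q n" "u n"] c
          by (intro mult_right_mono norm_nonneg) (auto simp: \<gamma>_def norm_mult intro!: mult_left_mono)
        also have "\<dots> = nrm (q n) * (c * nrm (u n) * nrm (v n))" by simp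
        also have "\<dots> \<le> nrm (q n) * 1"
          by (intro mult_left_mono c norm_nonneg) simp
        finally have "(cmod (\<gamma> n) * nrm (v n))\<^sup>2 \<le> (nrm (q n))\<^sup>2"
          by (intro power_mono mult_nonneg_nonneg norm_nonneg) simp_all
        moreover have "(nrm (w n))\<^sup>2 = (nrm (p X n))\<^sup>2 + 2 * Re (\<delta> n) + (cmod (\<gamma> n) * nrm (v n))\<^sup>2"
          unfolding w_def using norm_add_sq[of "shift_up (p X n)" "ip_scale V (\<gamma> n) (v n)"]
          by (simp add: scale_closed norm_scale norm_shift_up[OF p(1)] \<delta>_def
            inner_scale_right[unfolded toeplitz_space_simps(5)] del: toeplitz_space_simps(3,4))
        moreover have "(nrm (q n))\<^sup>2 = (nrm x)\<^sup>2 - 2 * Re (T x (p X n)) + (nrm (p X n))\<^sup>2"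
          unfolding q_def using norm_diff_sq[OF x, of "p X n"] by simp
        moreover have "Re (T (q n) (p X n)) = Re (T x (p X n)) - (nrm (p X n))\<^sup>2"
          unfolding q_def using inner_self[of "p X n"] x by (simp add: ip)
        ultimately show ?thesis by simp
      qed
      \<comment> \<open>The square of the norm of \<open>w n\<close> + \<open>y\<close> is
        non-negative, and in the limit the norm of \<open>w n\<close> is at most that of
        \<open>x\<close>. The limit \<open>L\<close> of the mixed term is the one in
        \<open>toeplitz_form_Suc\<close>.\<close>
      have "0 \<le> (nrm x)\<^sup>2 + (2 * Re 0 - 2 * Re 0) + 2 * Re L + (nrm y)\<^sup>2"
      proof (rule LIMSEQ_le_const)
        show "(\<lambda>n. (nrm x)\<^sup>2 + (2 * Re (\<delta> n) - 2 * Re (T (q n) (p X n))) + 2 * Re (T (w n) y) + (nrm y)\<^sup>2)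
            \<longlonglongrightarrow> (nrm x)\<^sup>2 + (2 * Re 0 - 2 * Re 0) + 2 * Re L + (nrm y)\<^sup>2"
          by (intro tendsto_intros \<delta> \<epsilon> wL)
        have "0 \<le> (nrm x)\<^sup>2 + (2 * Re (\<delta> n) - 2 * Re (T (q n) (p X n))) + 2 * Re (T (w n) y) + (nrm y)\<^sup>2" for n
          using w_le[of n] norm_add_sq[of "w n" y] y zero_le_power2[of "nrm (ip_add V (w n) y)"] by simp
        then show "\<exists>N. \<forall>n\<ge>N. 0 \<le> (nrm x)\<^sup>2 + (2 * Re (\<delta> n) - 2 * Re (T (q n) (p X n))) +
            2 * Re (T (w n) y) + (nrm y)\<^sup>2" by blast
      qed
      then have main: "0 \<le> (nrm x)\<^sup>2 + 2 * Re L + (nrm y)\<^sup>2" by simp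
      have Th: "T h h = of_real ((nrm y)\<^sup>2)"
      proof -
        have "T h h = T y y" by (auto simp: toeplitz_form_def y_def intro!: sum.cong)
        then show ?thesis using inner_self[OF y] by simp
      qed
      have sX: "s 0 X X = of_real ((nrm x)\<^sup>2)"
        using toeplitz_form_single_single[OF pd order_refl order_refl, of X X] inner_self[OF x]
        by (simp add: x_def form_ext_def)
      have "toeplitz_form s' (Suc d) f f = toeplitz_form s' (Suc d) h h"
        unfolding toeplitz_form_def by (intro sum.cong refl) (simp add: h_def)
      also have "\<dots> = T h h + of_real (2 * Re L) + s 0 X X"
        using toeplitz_form_Suc[OF pd sq, of h] unfolding s'_def b'_def L_def x_def X_def y_def .
      finally show ?thesis
        using main unfolding Th sX by (simp add: complex_nonneg_Reals_iff)
    qed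
    moreover have "sesquilinear (s' n)" if "n \<le> Suc d" for n
      using sq pd that by (auto simp: s'_def b'_def positive_definite_def)
    ultimately have "positive_definite s' (Suc d)" by (simp add: positive_definite_def)
    then show "positive_definite (s(Suc d := \<lambda>h g. b h g +
        of_real c * lim (\<lambda>n. T (single d h) (u n)) * lim (\<lambda>n. T (v n) (single 0 g)))) (Suc d)"
      by (simp add: s'_def b'_def \<alpha>_def \<beta>_def)
  qed
qed

end

section \<open>Restriction and continuation of positive definite sequences\<close>

lemma toeplitz_form_restrict:
  assumes pd: "positive_definite s d" and "e \<le> d" and h: "\<And>j. j > e \<Longrightarrow> h j = 0"
  shows "toeplitz_form s d h h = toeplitz_form s e h h"
proof -
  have sq: "j \<le> d \<Longrightarrow> k \<le> d \<Longrightarrow> sesquilinear (form_ext s (int j - int k))" for j k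
    by (rule positive_definite_ext[OF pd]) simp
  have "toeplitz_form s d h h = (\<Sum>j\<le>d. \<Sum>k\<le>e. form_ext s (int j - int k) (h j) (h k))"
    unfolding toeplitz_form_def using \<open>e \<le> d\<close>
    by (intro sum.cong refl sum.mono_neutral_right) (auto simp: h sesquilinearD[OF sq])
  also have "\<dots> = toeplitz_form s e h h"
    unfolding toeplitz_form_def using \<open>e \<le> d\<close>
    by (intro sum.mono_neutral_right) (auto simp: h sesquilinearD[OF sq] intro!: sum.neutral)
  finally show ?thesis .
qed

lemma positive_definite_mono:
  assumes pd: "positive_definite s d" and "e \<le> d"
  shows "positive_definite s e"
  unfolding positive_definite_def
proof (intro conjI allI impI)
  fix h :: "nat \<Rightarrow> 'a"
  define h' where "h' j = (if j \<le> e then h j else 0)" for j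
  have "toeplitz_form s e h h = toeplitz_form s e h' h'"
    unfolding toeplitz_form_def by (intro sum.cong refl) (simp add: h'_def)
  also have "\<dots> = toeplitz_form s d h' h'"
    using toeplitz_form_restrict[OF assms, of h'] by (simp add: h'_def)
  finally show "toeplitz_form s e h h \<in> \<real>\<^sub>\<ge>\<^sub>0"
    using pd by (simp add: positive_definite_def)
qed (use assms in \<open>auto simp: positive_definite_def\<close>)

context pd_forms
begin

lemma asymp_orthogonal_zero: "asymp_orthogonal (\<lambda>n j. 0) M"
proof -
  have "form_ext s (int j - int k) 0 y = 0" if "j \<le> d" "k \<le> d" for j k y
    using that by (intro sesquilinearD(5) positive_definite_ext[OF pd]) simp
  then have "T (\<lambda>j. 0) z = 0" for z
    by (simp add: toeplitz_form_def)
  then show ?thesis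
    using Cauchy_const[OF zero_closed] unfolding asymp_orthogonal_def
    by (auto intro!: exI[of _ "\<lambda>n. 0"])
qed

text \<open>With zero sequences \<open>u\<close> and \<open>v\<close> the perturbation vanishes, and
  the isometry composed with the projection onto its domain remains.\<close>

lemma one_step_extension: "\<exists>b. positive_definite (s(Suc d := b)) (Suc d)"
proof (rule extension_exists)
  fix b\<^sub>0
  assume *: "\<And>u v c. \<lbrakk>asymp_orthogonal u (dom_set d); asymp_orthogonal v (ran_set d);
      0 \<le> c; \<And>n. c * nrm (u n) * nrm (v n) \<le> 1\<rbrakk> \<Longrightarrow>
    positive_definite (s(Suc d := \<lambda>h g. b\<^sub>0 h g +
      of_real c * lim (\<lambda>n. T (single d h) (u n)) * lim (\<lambda>n. T (v n) (single 0 g)))) (Suc d)"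
  show ?thesis using *[OF asymp_orthogonal_zero asymp_orthogonal_zero, of 0] by auto
qed

text \<open>For the residual \<open>u\<close> of \<open>x\<close> the limits of (x, u) and (u, u)
  agree, and the latter is at least the square of the distance \<open>e\<close>.\<close>

lemma asymp_orthogonal_far:
  assumes M: "subsp M" and x: "x \<in> C" and e: "e > 0" and far: "\<And>m. m \<in> M \<Longrightarrow> nrm (dif x m) \<ge> e"
  obtains u where "asymp_orthogonal u M" "lim (\<lambda>n. T x (u n)) \<noteq> 0" "lim (\<lambda>n. T (u n) x) \<noteq> 0"
proof -
  obtain p where p: "\<And>n. p n \<in> M" "p \<in> ip_Cauchy V" "asymp_orthogonal (\<lambda>n. dif x (p n)) M"
    using projection_exists[OF M x] by metis
  define u where "u n = dif x (p n)" for n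
  have u: "asymp_orthogonal u M" using p(3) by (simp add: u_def[abs_def])
  then have uC: "u \<in> ip_Cauchy V" by (simp add: asymp_orthogonal_def)
  have far': "e\<^sup>2 \<le> Re (T (u n) (u n))" for n
  proof -
    have "e\<^sup>2 \<le> (nrm (u n))\<^sup>2"
      using far[OF p(1)] e by (intro power_mono) (auto simp: u_def)
    then show ?thesis using norm_sq[OF Cauchy_closed[OF uC]] by simp
  qed
  have lim: "(\<lambda>n. T x (u n)) \<longlonglongrightarrow> lim (\<lambda>n. T x (u n))"
    by (rule lim_T[OF Cauchy_const[OF x] uC])
  have 1: "T (u n) (u n) = T x (u n) - T (p n) (u n)" for n
    using inner_diff_left[OF x Cauchy_closed[OF p(2)] Cauchy_closed[OF uC]] by (simp add: u_def)
  have "(\<lambda>n. T (u n) (u n)) \<longlonglongrightarrow> lim (\<lambda>n. T x (u n)) - 0"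
    unfolding 1 by (intro tendsto_diff lim asymp_orthogonal_tendsto(2)[OF u p(1) p(2)])
  then have "e\<^sup>2 \<le> Re (lim (\<lambda>n. T x (u n)) - 0)"
    by (intro LIMSEQ_le_const[OF tendsto_Re]) (use far' in auto)
  then have ne: "lim (\<lambda>n. T x (u n)) \<noteq> 0" using e by auto
  have "T (u n) x = cnj (T x (u n))" for n
    using inner_commute[OF Cauchy_closed[OF uC] x] by simp
  then have "(\<lambda>n. T (u n) x) \<longlonglongrightarrow> cnj (lim (\<lambda>n. T x (u n)))"
    using tendsto_cnj[OF lim] by simp
  then have "lim (\<lambda>n. T (u n) x) \<noteq> 0"
    using limI ne by fastforce
  with u ne that show ?thesis by blast
qed

text \<open>The forms belonging to \<open>c\<close> and to 0 differ by \<open>c\<close> times a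
  product of two limits, neither of which vanishes for suitable vectors when neither approximation
  property holds.\<close>

lemma two_extensions:
  assumes dom: "\<not> (\<forall>h. \<forall>e>0. \<exists>m\<in>dom_set d. nrm (dif (single d h) m) < e)"
    and ran: "\<not> (\<forall>h. \<forall>e>0. \<exists>m\<in>ran_set d. nrm (dif (single 0 h) m) < e)"
  shows "\<exists>b b'. positive_definite (s(Suc d := b)) (Suc d) \<and> positive_definite (s(Suc d := b')) (Suc d) \<and> b \<noteq> b'"
proof -
  obtain h e where e: "e > 0" "\<And>m. m \<in> dom_set d \<Longrightarrow> nrm (dif (single d h) m) \<ge> e"
    using dom by (force simp: not_less)
  obtain u where u: "asymp_orthogonal u (dom_set d)" "lim (\<lambda>n. T (single d h) (u n)) \<noteq> 0"
    using asymp_orthogonal_far[OF subsp_dom single_C[OF order_refl] e] by metis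
  obtain g e' where e': "e' > 0" "\<And>m. m \<in> ran_set d \<Longrightarrow> nrm (dif (single 0 g) m) \<ge> e'"
    using ran by (force simp: not_less)
  obtain v where v: "asymp_orthogonal v (ran_set d)" "lim (\<lambda>n. T (v n) (single 0 g)) \<noteq> 0"
    using asymp_orthogonal_far[OF subsp_ran single_C[OF le0] e'] by metis
  have uC: "u \<in> ip_Cauchy V" and vC: "v \<in> ip_Cauchy V"
    using u v by (simp_all add: asymp_orthogonal_def)
  obtain K where K: "K > 0" "\<And>n. nrm (u n) \<le> K" using Cauchy_bounded[OF uC] by blast
  obtain L where L: "L > 0" "\<And>n. nrm (v n) \<le> L" using Cauchy_bounded[OF vC] by blast
  \<comment> \<open>Small enough for the perturbed operator to remain a contraction.\<close>
  define c where "c = 1 / (K * L)"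
  have c: "c > 0" using K L by (simp add: c_def)
  have c1: "c * nrm (u n) * nrm (v n) \<le> 1" for n
  proof -
    have "nrm (u n) * nrm (v n) \<le> K * L"
      using K L by (intro mult_mono norm_nonneg Cauchy_closed[OF vC]) auto
    then show ?thesis using K L by (simp add: c_def)
  qed
  show ?thesis
  proof (rule extension_exists)
    fix b\<^sub>0
    assume b\<^sub>0: "\<And>u v c. \<lbrakk>asymp_orthogonal u (dom_set d); asymp_orthogonal v (ran_set d);
        0 \<le> c; \<And>n. c * nrm (u n) * nrm (v n) \<le> 1\<rbrakk> \<Longrightarrow>
      positive_definite (s(Suc d := \<lambda>h g. b\<^sub>0 h g +
        of_real c * lim (\<lambda>n. T (single d h) (u n)) * lim (\<lambda>n. T (v n) (single 0 g)))) (Suc d)"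
    define b where "b c h g = b\<^sub>0 h g +
        of_real c * lim (\<lambda>n. T (single d h) (u n)) * lim (\<lambda>n. T (v n) (single 0 g))" for c :: real and h g
    have "positive_definite (s(Suc d := b c)) (Suc d)" "positive_definite (s(Suc d := b 0)) (Suc d)"
      using b\<^sub>0[OF u(1) v(1), of c] b\<^sub>0[OF u(1) v(1), of 0] c c1 by (simp_all add: b_def[abs_def])
    moreover have "b c h g \<noteq> b 0 h g"
      using u(2) v(2) c by (simp add: b_def)
    ultimately show ?thesis by metis
  qed
qed

end

text \<open>Stage n of a dependent choice adds the moment of order d+n and leaves the earlier ones
  fixed, so the stages fit together.\<close>

lemma positive_definite_extension:
  assumes "positive_definite s d"
  shows "\<exists>t. (\<forall>k\<le>d. t k = s k) \<and> (\<forall>N. positive_definite t N)"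
proof -
  have "\<exists>f. \<forall>n. (positive_definite (f n) (d + n) \<and> (n = 0 \<longrightarrow> f n = s)) \<and>
      (\<forall>k\<le>d + n. f (Suc n) k = f n k)"
  proof (rule dependent_nat_choice)
    show "\<exists>x. positive_definite x (d + 0) \<and> (0 = 0 \<longrightarrow> x = s)" using assms by auto
    fix x n assume "positive_definite x (d + n) \<and> (n = 0 \<longrightarrow> x = s)"
    then interpret pd_forms x "d + n" by unfold_locales auto
    obtain b where "positive_definite (x(Suc (d + n) := b)) (Suc (d + n))"
      using one_step_extension by blast
    then show "\<exists>y. (positive_definite y (d + Suc n) \<and> (Suc n = 0 \<longrightarrow> y = s)) \<and> (\<forall>k\<le>d + n. y k = x k)"
      by (intro exI[of _ "x(Suc (d + n) := b)"]) auto
  qed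
  then obtain f where f: "\<And>n. positive_definite (f n) (d + n)" "f 0 = s"
    "\<And>n k. k \<le> d + n \<Longrightarrow> f (Suc n) k = f n k" by blast
  have mono: "f (n + m) k = f n k" if "k \<le> d + n" for n m k
    using that by (induction m) (simp_all add: f)
  \<comment> \<open>The moment of order k is settled by stage k - d, hence certainly at stage
    k.\<close>
  define t where "t k = f k k" for k
  have t: "t k = f n k" if "k \<le> d + n" for n k
    using mono[of k n "k - n"] mono[of k k "n - k"] that unfolding t_def
    by (cases "k \<le> n") (auto simp: )
  have "positive_definite t (d + n)" for n
    using f(1)[of n] positive_definite_cong[of "d + n" t "f n"] t by simp
  then have "positive_definite t N" for N
    using positive_definite_mono[of t "d + N" N] by simp
  moreover have "t k = s k" if "k \<le> d" for k
    using t[of k 0] f(2) that by simp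
  ultimately show ?thesis by blast
qed

section \<open>The defect numbers\<close>

locale moment_data =
  fixes S :: "nat \<Rightarrow> 'a::complex_hilbert \<Rightarrow> 'a" and d :: nat
  assumes bounded_S: "\<And>n. n \<le> d \<Longrightarrow> bounded_clinear (S n)"
    and positive_S: "\<And>h :: nat \<Rightarrow> 'a.
      (\<Sum>k\<le>d. \<Sum>l\<le>d. cinner (S_ext S (int l - int k) (h l)) (h k)) \<in> \<real>\<^sub>\<ge>\<^sub>0"
begin

definition s :: "nat \<Rightarrow> 'a \<Rightarrow> 'a \<Rightarrow> complex" where
  "s n x y = cinner (S n x) y"

lemma cinner_S_ext: "\<bar>k\<bar> \<le> int d \<Longrightarrow> cinner (S_ext S k x) y = form_ext s k x y"
  by (auto simp: S_ext_def form_ext_def s_def cinner_cadjoint bounded_S)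

lemma toeplitz_form_s:
  "toeplitz_form s d h g = (\<Sum>j\<le>d. \<Sum>k\<le>d. cinner (S_ext S (int j - int k) (h j)) (g k))"
  unfolding toeplitz_form_def by (intro sum.cong refl) (subst cinner_S_ext, auto)

sublocale pd_forms s d
proof
  have "sesquilinear (s n)" if "n \<le> d" for n
    unfolding s_def[abs_def] by (intro sesquilinear_cinner bounded_S that)
  moreover have "toeplitz_form s d h h \<in> \<real>\<^sub>\<ge>\<^sub>0" for h
    unfolding toeplitz_form_s by (subst sum.swap) (rule positive_S)
  ultimately show "positive_definite s d" by (simp add: positive_definite_def)
qed

sublocale W: semi_ip_space W
  by (rule semi_ip_completion)

lemma moment_H_eq: "moment_H S d = W"
  unfolding moment_H_def formal_space_def toeplitz_space_def
  by (simp add: toeplitz_form_s[abs_def])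

lemma moment_x_eq: "moment_x S d h j = ip_class V (single j h)"
  unfolding moment_x_def formal_space_def toeplitz_space_def
  by (simp add: toeplitz_form_s[abs_def])

text \<open>Stated for the partial sums, to permit induction; the operator itself uses n =
  d.\<close>

lemma ip_sum_moment_x:
  assumes "n \<le> d"
  shows "ip_sum W (\<lambda>j. moment_x S d (h j) j) n = ip_class V (\<lambda>i. if i < n then h i else 0)"
    and "ip_sum W (\<lambda>j. moment_x S d (h j) (Suc j)) n = ip_class V (shift_up (\<lambda>i. if i < n then h i else 0))"
  using assms
proof (induction n)
  case 0
  {
    case 1 show ?case by (simp add: completion_zero ip_class_eq)
  next
    case 2 show ?case
      by (simp add: completion_zero ip_class_eq shift_up_def[abs_def] if_distrib cong: if_cong)
  }
next
  case (Suc n)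
  {
    case 1
    have "ip_add V (\<lambda>i. if i < n then h i else 0) (single n (h n)) = (\<lambda>i. if i < Suc n then h i else 0)"
      by auto
    then show ?case
      using Suc.IH(1) 1 class_add[of "\<lambda>i. if i < n then h i else 0" "single n (h n)"]
      by (simp add: moment_x_eq)
  next
    case 2
    have "ip_add V (shift_up (\<lambda>i. if i < n then h i else 0)) (single (Suc n) (h n)) =
        shift_up (\<lambda>i. if i < Suc n then h i else 0)"
    proof
      fix i
      show "ip_add V (shift_up (\<lambda>i. if i < n then h i else 0)) (single (Suc n) (h n)) i =
          shift_up (\<lambda>i. if i < Suc n then h i else 0) i"
        by (cases i) (simp_all add: shift_up_def less_Suc_eq)
    qed
    moreover have "shift_up (\<lambda>i. if i < n then h i else 0) \<in> C" "single (Suc n) (h n) \<in> C"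
      using 2 by (auto simp: shift_up_def)
    ultimately show ?case
      using Suc.IH(2) 2 class_add[of "shift_up (\<lambda>i. if i < n then h i else 0)" "single (Suc n) (h n)"]
      by (simp add: moment_x_eq del: toeplitz_space_simps)
  }
qed

lemma Domain_moment_A0: "Domain (moment_A0 S d) = ip_class V ` dom_set d"
proof -
  have "dom_set d \<subseteq> range (\<lambda>h i. if i < d then h i else (0 :: 'a))"
  proof
    fix z :: "nat \<Rightarrow> 'a" assume "z \<in> dom_set d"
    then have "z = (\<lambda>i. if i < d then z i else 0)" by (auto simp: dom_set_def)
    then show "z \<in> range (\<lambda>h i. if i < d then h i else (0 :: 'a))"
      by (rule image_eqI[where x = z]) simp
  qed
  moreover have "range (\<lambda>h i. if i < d then h i else (0 :: 'a)) \<subseteq> dom_set d"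
    by (auto simp: dom_set_def)
  ultimately have "dom_set d = range (\<lambda>h i. if i < d then h i else (0 :: 'a))" by blast
  then show ?thesis
    unfolding moment_A0_def moment_H_eq ip_sum_moment_x[OF order_refl] by (auto simp only: image_image)
qed

lemma Range_moment_A0: "Range (moment_A0 S d) = ip_class V ` ran_set d"
proof -
  have "ran_set d \<subseteq> range (\<lambda>h. shift_up (\<lambda>i. if i < d then h i else (0 :: 'a)))"
  proof
    fix z :: "nat \<Rightarrow> 'a" assume z: "z \<in> ran_set d"
    have "z = shift_up (\<lambda>i. if i < d then shift_down z i else 0)"
    proof
      fix i show "z i = shift_up (\<lambda>i. if i < d then shift_down z i else 0) i"
        using z by (cases i) (auto simp: ran_set_def shift_up_def shift_down_def)
    qed
    then show "z \<in> range (\<lambda>h. shift_up (\<lambda>i. if i < d then h i else (0 :: 'a)))"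
      by (rule image_eqI[where x = "shift_down z"]) simp
  qed
  moreover have "range (\<lambda>h. shift_up (\<lambda>i. if i < d then h i else (0 :: 'a))) \<subseteq> ran_set d"
    by (auto simp: ran_set_def shift_up_def)
  ultimately have "ran_set d = range (\<lambda>h. shift_up (\<lambda>i. if i < d then h i else (0 :: 'a)))" by blast
  then show ?thesis
    unfolding moment_A0_def moment_H_eq ip_sum_moment_x[OF order_refl] by (auto simp only: image_image)
qed

lemma moment_A0_closed: "moment_A0 S d \<subseteq> ip_carrier W \<times> ip_carrier W"
proof -
  have "Domain (moment_A0 S d) \<subseteq> ip_carrier W" "Range (moment_A0 S d) \<subseteq> ip_carrier W"
    unfolding Domain_moment_A0 Range_moment_A0 using dom_C ran_C class_closed by blast+
  then show ?thesis by (auto dest: DomainI RangeI)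
qed

lemma tendsto_const_W: "X \<in> ip_carrier W \<Longrightarrow> ip_tendsto W (\<lambda>n. X) X"
  by (simp add: ip_tendsto_def W.norm_diff_self)

lemma moment_A0_subset: "moment_A0 S d \<subseteq> moment_A S d"
proof
  fix z assume z: "z \<in> moment_A0 S d"
  obtain X Y where XY: "z = (X, Y)" by (cases z)
  have "X \<in> ip_carrier W" "Y \<in> ip_carrier W" using z XY moment_A0_closed by auto
  moreover have "\<exists>p q. (\<forall>n. (p n, q n) \<in> moment_A0 S d) \<and> ip_tendsto W p X \<and> ip_tendsto W q Y"
    using z XY tendsto_const_W calculation by (intro exI[of _ "\<lambda>n. X"] exI[of _ "\<lambda>n. Y"]) auto
  ultimately show "z \<in> moment_A S d"
    unfolding moment_A_def graph_closure_def moment_H_eq XY by simp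
qed

lemma moment_A_limits:
  assumes "(X, Y) \<in> moment_A S d"
  shows "X \<in> ip_carrier W" "Y \<in> ip_carrier W"
    "\<exists>p. (\<forall>n. p n \<in> Domain (moment_A0 S d)) \<and> ip_tendsto W p X"
    "\<exists>q. (\<forall>n. q n \<in> Range (moment_A0 S d)) \<and> ip_tendsto W q Y"
  using assms unfolding moment_A_def graph_closure_def moment_H_eq by blast+

lemma hilbert_dim_ominus_iff:
  assumes D: "D \<subseteq> ip_carrier W"
  shows "hilbert_dim W (ip_ominus W D) = BNF_Cardinal_Arithmetic.czero \<longleftrightarrow> ip_ominus W D \<subseteq> {ip_zero W}"
proof (rule W.hilbert_dim_eq_czero_iff)
  show "ip_ominus W D \<subseteq> ip_carrier W" by (auto simp: ip_ominus_def)
  show "ip_scale W c X \<in> ip_ominus W D" if "X \<in> ip_ominus W D" for c X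
    using that D W.closed(3) W.inner_scale_left unfolding ip_ominus_def by auto
qed (rule completion_definite)

text \<open>Every formal sum is an element of \<open>dom_set d\<close> plus a term of index
  \<open>d\<close>, so the defect space is trivial once these last terms are limits of domain
  vectors.\<close>

lemma defect_domain_eq_czero_iff:
  "defect_domain (moment_H S d) (moment_A S d) = BNF_Cardinal_Arithmetic.czero \<longleftrightarrow>
    (\<forall>h. \<forall>e>0. \<exists>m\<in>dom_set d. nrm (dif (single d h) m) < e)"
proof -
  have D: "Domain (moment_A S d) \<subseteq> ip_carrier W" using moment_A_limits(1) by auto
  have "ip_ominus W (Domain (moment_A S d)) \<subseteq> {ip_zero W} \<longleftrightarrow>
      (\<forall>x\<in>range (single d). \<forall>e>0. \<exists>m\<in>dom_set d. nrm (dif x m) < e)"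
  proof (rule ominus_completion_trivial_iff[OF subsp_dom])
    show "range (single d) \<subseteq> C" using single_C[OF order_refl] by blast
    show "\<exists>m\<in>dom_set d. \<exists>x\<in>range (single d). \<forall>z\<in>C. inn z y = inn z m + inn z x" if "y \<in> C" for y
    proof (intro bexI ballI)
      show "y(d := 0) \<in> dom_set d" using that by (auto simp: dom_set_def)
      fix z assume "z \<in> C"
      moreover have "y = ip_add V (y(d := 0)) (single d (y d))" by auto
      moreover have "y(d := 0) \<in> C" using that by auto
      ultimately show "inn z y = inn z (y(d := 0)) + inn z (single d (y d))"
        using inner_add_right[of "y(d := 0)" "single d (y d)" z] single_C[OF order_refl] by metis
    qed blast
    show "ip_class V ` dom_set d \<subseteq> Domain (moment_A S d)"
      using moment_A0_subset unfolding Domain_moment_A0[symmetric] by blast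
    show "\<exists>p. (\<forall>n. p n \<in> ip_class V ` dom_set d) \<and> ip_tendsto W p X" if "X \<in> Domain (moment_A S d)" for X
      using that moment_A_limits(3) unfolding Domain_moment_A0[symmetric] by blast
  qed (rule D)
  then show ?thesis
    unfolding defect_domain_def moment_H_eq hilbert_dim_ominus_iff[OF D] by blast
qed

text \<open>As for the domain, but with the term of index 0 split off.\<close>

lemma defect_range_eq_czero_iff:
  "defect_range (moment_H S d) (moment_A S d) = BNF_Cardinal_Arithmetic.czero \<longleftrightarrow>
    (\<forall>h. \<forall>e>0. \<exists>m\<in>ran_set d. nrm (dif (single 0 h) m) < e)"
proof -
  have D: "Range (moment_A S d) \<subseteq> ip_carrier W" using moment_A_limits(2) by auto
  have "ip_ominus W (Range (moment_A S d)) \<subseteq> {ip_zero W} \<longleftrightarrow>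
      (\<forall>x\<in>range (single 0). \<forall>e>0. \<exists>m\<in>ran_set d. nrm (dif x m) < e)"
  proof (rule ominus_completion_trivial_iff[OF subsp_ran])
    show "range (single 0) \<subseteq> C" using single_C[OF le0] by blast
    show "\<exists>m\<in>ran_set d. \<exists>x\<in>range (single 0). \<forall>z\<in>C. inn z y = inn z m + inn z x" if "y \<in> C" for y
    proof (intro bexI ballI)
      show "y(0 := 0) \<in> ran_set d" using that by (auto simp: ran_set_def)
      fix z assume "z \<in> C"
      moreover have "y = ip_add V (y(0 := 0)) (single 0 (y 0))" by auto
      moreover have "y(0 := 0) \<in> C" using that by auto
      ultimately show "inn z y = inn z (y(0 := 0)) + inn z (single 0 (y 0))"
        using inner_add_right[of "y(0 := 0)" "single 0 (y 0)" z] single_C[OF le0] by metis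
    qed blast
    show "ip_class V ` ran_set d \<subseteq> Range (moment_A S d)"
      using moment_A0_subset unfolding Range_moment_A0[symmetric] by blast
    show "\<exists>p. (\<forall>n. p n \<in> ip_class V ` ran_set d) \<and> ip_tendsto W p X" if "X \<in> Range (moment_A S d)" for X
      using that moment_A_limits(4) unfolding Range_moment_A0[symmetric] by blast
  qed (rule D)
  then show ?thesis
    unfolding defect_range_def moment_H_eq hilbert_dim_ominus_iff[OF D] by blast
qed

end

section \<open>Discrete approximate solutions\<close>

lemma norm_cis_diff_le: "cmod (cis a - cis b) \<le> \<bar>a - b\<bar>"
proof -
  have "cis a - cis b = cis b * (exp (\<i> * of_real (a - b)) - 1)"
    by (simp add: algebra_simps cis_conv_exp flip: exp_add)
  then have "cmod (cis a - cis b) = 2 * \<bar>sin ((a - b) / 2)\<bar>"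
    using dist_exp_i_1[of "a - b"] by (simp add: norm_mult)
  also have "\<dots> \<le> 2 * \<bar>(a - b) / 2\<bar>"
    by (intro mult_left_mono abs_sin_x_le_abs_x) simp
  finally show ?thesis by simp
qed

lemma sum_cis_roots_of_unity:
  fixes n :: int
  assumes "L > 0" "\<bar>n\<bar> < int L"
  shows "(\<Sum>k<L. cis (of_int n * (2 * pi * real k / real L))) = (if n = 0 then of_nat L else 0)"
proof (cases "n = 0")
  case False
  define z where "z = cis (2 * pi * of_int n / real L)"
  have zk: "cis (of_int n * (2 * pi * real k / real L)) = z ^ k" for k
  proof -
    have "z ^ k = cis (real k * (2 * pi * of_int n / real L))"
      by (simp only: z_def Complex.DeMoivre)
    also have "real k * (2 * pi * of_int n / real L) = of_int n * (2 * pi * real k / real L)"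
      by simp
    finally show ?thesis by simp
  qed
  have "z \<noteq> 1"
  proof
    assume "z = 1"
    then have "exp (\<i> * complex_of_real (2 * pi * of_int n / real L)) = 1"
      by (simp add: z_def cis_conv_exp)
    then obtain m :: int where "2 * pi * of_int n / real L = of_int (2 * m) * pi"
      unfolding exp_eq_1 by auto
    then have "of_int n = (of_int (m * int L) :: real)"
      using assms(1) by (simp add: field_simps)
    then have "n = m * int L" by linarith
    moreover from this False have "m \<noteq> 0" by auto
    then have "\<bar>m\<bar> * int L \<ge> 1 * int L" by (intro mult_right_mono) auto
    ultimately show False using assms(2) by (simp add: abs_mult)
  qed
  have "z ^ L = cis (2 * pi * of_int n)"
    unfolding z_def Complex.DeMoivre using assms(1) by simp
  then have "z ^ L = 1" by simp
  then have "(\<Sum>k<L. z ^ k) = 0"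
    using geometric_sum[OF \<open>z \<noteq> 1\<close>, of L] by simp
  then show ?thesis using False unfolding zk by simp
qed simp

text \<open>The Fejer mean, evaluated at the \<open>k\<close>-th of \<open>2N\<close> equidistant points. Having twice as many points as
  frequencies makes the discrete orthogonality relations exact for the moments up to order \<open>N\<close>.\<close>

definition fejer_weight :: "(nat \<Rightarrow> 'a::complex_hilbert \<Rightarrow> 'a \<Rightarrow> complex) \<Rightarrow> nat \<Rightarrow> nat \<Rightarrow> 'a \<Rightarrow> 'a \<Rightarrow> complex" where
  "fejer_weight s N k x y = (\<Sum>j<N. \<Sum>l<N. cis (- ((real j - real l) * (pi * real k / real N))) *
     form_ext s (int j - int l) x y) / of_nat (2 * N * N)"

text \<open>Up to a positive factor, the diagonal value is the Toeplitz form at the vector whose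
  entry at j is \<open>x\<close> multiplied by e^(-ij \<theta>).\<close>

lemma positive_form_fejer_weight:
  assumes pd: "positive_definite s (N - 1)"
  shows "positive_form (fejer_weight s N k)"
proof (cases N)
  case 0
  then show ?thesis by (simp add: fejer_weight_def positive_form_def sesquilinear_def)
next
  case (Suc n)
  have sq: "j < N \<Longrightarrow> l < N \<Longrightarrow> sesquilinear (form_ext s (int j - int l))" for j l
    using Suc by (intro positive_definite_ext[OF pd]) auto
  define \<theta> where "\<theta> = pi * real k / real N"
  have eq: "fejer_weight s N k = (\<lambda>x y. (1 / of_nat (2 * N * N)) *
     (\<Sum>j<N. \<Sum>l<N. cis (- ((real j - real l) * \<theta>)) * form_ext s (int j - int l) x y))"
    by (intro ext) (simp add: fejer_weight_def \<theta>_def)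
  have "sesquilinear (fejer_weight s N k)"
    unfolding eq by (intro sesquilinear_mult sesquilinear_sum sq) auto
  moreover have "fejer_weight s N k x x \<in> \<real>\<^sub>\<ge>\<^sub>0" for x
  proof -
    define h where "h j = cis (- (real j * \<theta>)) *\<^sub>C x" for j
    have "(\<Sum>j<N. \<Sum>l<N. cis (- ((real j - real l) * \<theta>)) * form_ext s (int j - int l) x x) =
        (\<Sum>j<N. \<Sum>l<N. form_ext s (int j - int l) (h j) (h l))"
    proof (intro sum.cong refl)
      fix j l assume "j \<in> {..<N}" "l \<in> {..<N}"
      then have "form_ext s (int j - int l) (h j) (h l) =
          cis (- (real j * \<theta>)) * cnj (cis (- (real l * \<theta>))) * form_ext s (int j - int l) x x"
        unfolding h_def by (simp add: sesquilinearD[OF sq])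
      also have "cis (- (real j * \<theta>)) * cnj (cis (- (real l * \<theta>))) = cis (- ((real j - real l) * \<theta>))"
        by (simp add: cis_cnj cis_mult algebra_simps)
      finally show "cis (- ((real j - real l) * \<theta>)) * form_ext s (int j - int l) x x =
          form_ext s (int j - int l) (h j) (h l)" by simp
    qed
    also have "\<dots> = toeplitz_form s (N - 1) h h"
      unfolding toeplitz_form_def using Suc by (simp add: lessThan_Suc_atMost)
    finally have *: "fejer_weight s N k x x = of_real (1 / real (2 * N * N)) * toeplitz_form s (N - 1) h h"
      by (simp add: eq)
    show ?thesis
      unfolding * using pd by (intro nonneg_Reals_mult_I) (auto simp: positive_definite_def)
  qed
  ultimately show ?thesis by (simp add: positive_form_def)
qed

text \<open>Exactly N - m of the index pairs have difference m, whence the factor. The frequencies m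
  - (j - l) stay below 2N in absolute value, so there is no aliasing on the 2N points.\<close>

lemma fejer_moment:
  assumes "m \<le> N" "N > 0"
  shows "(\<Sum>k<2*N. cis (real m * (pi * real k / real N)) * fejer_weight s N k x y) =
    of_nat (N - m) / of_nat N * s m x y"
proof -
  define \<theta> where "\<theta> k = pi * real k / real N" for k
  have \<theta>: "\<theta> k = 2 * pi * real k / real (2 * N)" for k by (simp add: \<theta>_def)
  have "(\<Sum>k<2*N. cis (real m * \<theta> k) * fejer_weight s N k x y) =
    (\<Sum>k<2*N. \<Sum>j<N. \<Sum>l<N. cis (of_int (int m - (int j - int l)) * \<theta> k) *
       (form_ext s (int j - int l) x y / of_nat (2 * N * N)))"
  proof (intro sum.cong refl)
    fix k
    have "cis (real m * \<theta> k) * fejer_weight s N k x y =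
      (\<Sum>j<N. \<Sum>l<N. cis (real m * \<theta> k) * (cis (- ((real j - real l) * \<theta> k)) *
        form_ext s (int j - int l) x y) / of_nat (2 * N * N))"
      by (simp add: fejer_weight_def \<theta>_def sum_distrib_left sum_divide_distrib)
    also have "\<dots> = (\<Sum>j<N. \<Sum>l<N. cis (of_int (int m - (int j - int l)) * \<theta> k) *
       (form_ext s (int j - int l) x y / of_nat (2 * N * N)))"
    proof (intro sum.cong refl)
      fix j l
      have "cis (real m * \<theta> k) * cis (- ((real j - real l) * \<theta> k)) = cis (of_int (int m - (int j - int l)) * \<theta> k)"
        by (simp add: cis_mult algebra_simps)
      then show "cis (real m * \<theta> k) * (cis (- ((real j - real l) * \<theta> k)) *
          form_ext s (int j - int l) x y) / of_nat (2 * N * N) =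
        cis (of_int (int m - (int j - int l)) * \<theta> k) * (form_ext s (int j - int l) x y / of_nat (2 * N * N))"
        by (metis (no_types, lifting) mult.assoc times_divide_eq_right)
    qed
    finally show "cis (real m * \<theta> k) * fejer_weight s N k x y = \<dots>" .
  qed
  also have "\<dots> = (\<Sum>j<N. \<Sum>l<N. (\<Sum>k<2*N. cis (of_int (int m - (int j - int l)) * \<theta> k)) *
       (form_ext s (int j - int l) x y / of_nat (2 * N * N)))"
    unfolding sum_distrib_right
    by (rule trans[OF sum.swap], rule sum.cong[OF refl], rule sum.swap)
  also have "\<dots> = (\<Sum>j<N. \<Sum>l<N. if j = m + l then s m x y / of_nat N else 0)"
  proof (intro sum.cong refl)
    fix j l assume jl: "j \<in> {..<N}" "l \<in> {..<N}"
    have "(\<Sum>k<2*N. cis (of_int (int m - (int j - int l)) * \<theta> k)) =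
        (if int m - (int j - int l) = 0 then of_nat (2 * N) else 0)"
      unfolding \<theta> using assms jl by (intro sum_cis_roots_of_unity) auto
    then show "(\<Sum>k<2*N. cis (of_int (int m - (int j - int l)) * \<theta> k)) *
        (form_ext s (int j - int l) x y / of_nat (2 * N * N)) = (if j = m + l then s m x y / of_nat N else 0)"
      using assms(2) by (auto simp: form_ext_def)
  qed
  also have "\<dots> = (\<Sum>l<N. if m + l < N then s m x y / of_nat N else 0)"
    by (subst sum.swap) (simp add: sum.delta)
  also have "\<dots> = (\<Sum>l\<in>{..<N - m}. s m x y / of_nat N)"
    by (intro sum.mono_neutral_cong_right) auto
  also have "\<dots> = of_nat (N - m) / of_nat N * s m x y" by simp
  finally show ?thesis by (simp add: \<theta>_def)
qed

text \<open>The right-hand side of Cauchy-Schwarz for \<open>b\<close>. Errors are measured by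
  \<open>form_bound (s 0)\<close>, which is independent of the number of points.\<close>

definition form_bound :: "('a::complex_hilbert \<Rightarrow> 'a \<Rightarrow> complex) \<Rightarrow> 'a \<Rightarrow> 'a \<Rightarrow> real" where
  "form_bound b x y = sqrt (Re (b x x)) * sqrt (Re (b y y))"

text \<open>Absorbing the weights into the first argument reduces this to Cauchy-Schwarz in the
  direct sum. It replaces the bound of an integral by the supremum of the integrand times the total
  mass.\<close>

lemma positive_form_weighted_sum_bound:
  assumes b: "\<And>i. i \<in> I \<Longrightarrow> positive_form (b i)" and a: "\<And>i. i \<in> I \<Longrightarrow> cmod (a i) \<le> \<omega>"
    and "0 \<le> \<omega>" and le: "\<And>z. (\<Sum>i\<in>I. Re (b i z z)) \<le> Re (c z z)"
  shows "cmod (\<Sum>i\<in>I. a i * b i x y) \<le> \<omega> * form_bound c x y"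
proof -
  have sq: "i \<in> I \<Longrightarrow> sesquilinear (b i)" for i using b by (simp add: positive_form_def)
  have "(\<Sum>i\<in>I. a i * b i x y) = (\<Sum>i\<in>I. b i (a i *\<^sub>C x) y)"
    by (intro sum.cong refl) (simp add: sesquilinearD[OF sq])
  also have "cmod \<dots> \<le> sqrt (\<Sum>i\<in>I. Re (b i (a i *\<^sub>C x) (a i *\<^sub>C x))) * sqrt (\<Sum>i\<in>I. Re (b i y y))"
    by (rule positive_form_sum_Cauchy_Schwarz[OF b])
  also have "\<dots> \<le> sqrt (\<omega>\<^sup>2 * Re (c x x)) * sqrt (Re (c y y))"
  proof (intro mult_mono real_sqrt_le_mono)
    have "Re (b i (a i *\<^sub>C x) (a i *\<^sub>C x)) \<le> \<omega>\<^sup>2 * Re (b i x x)" if i: "i \<in> I" for i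
    proof -
      have "b i (a i *\<^sub>C x) (a i *\<^sub>C x) = a i * cnj (a i) * b i x x"
        by (simp add: sesquilinearD[OF sq[OF i]])
      also have "\<dots> = of_real ((cmod (a i))\<^sup>2) * b i x x" by (simp only: complex_norm_square)
      finally have "Re (b i (a i *\<^sub>C x) (a i *\<^sub>C x)) = (cmod (a i))\<^sup>2 * Re (b i x x)" by simp
      also have "\<dots> \<le> \<omega>\<^sup>2 * Re (b i x x)"
        by (intro mult_right_mono power_mono a i positive_form_Re b) simp
      finally show ?thesis .
    qed
    then have "(\<Sum>i\<in>I. Re (b i (a i *\<^sub>C x) (a i *\<^sub>C x))) \<le> (\<Sum>i\<in>I. \<omega>\<^sup>2 * Re (b i x x))"
      by (intro sum_mono)
    also have "\<dots> \<le> \<omega>\<^sup>2 * Re (c x x)"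
      unfolding sum_distrib_left[symmetric] by (intro mult_left_mono le) simp
    finally show "(\<Sum>i\<in>I. Re (b i (a i *\<^sub>C x) (a i *\<^sub>C x))) \<le> \<omega>\<^sup>2 * Re (c x x)" .
    have "0 \<le> (\<Sum>i\<in>I. Re (b i x x))" by (intro sum_nonneg positive_form_Re b)
    then show "0 \<le> sqrt (\<omega>\<^sup>2 * Re (c x x))" using le[of x] by simp
    show "0 \<le> sqrt (\<Sum>i\<in>I. Re (b i y y))"
      by (intro real_sqrt_ge_zero sum_nonneg positive_form_Re b)
  qed (rule le)
  also have "\<dots> = \<omega> * form_bound c x y"
    using \<open>0 \<le> \<omega>\<close> by (simp add: form_bound_def real_sqrt_mult)
  finally show ?thesis .
qed

text \<open>The strict inequality gives the value 0 at t = 0 although a node sits there; the last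
  node lies below 2 pi, so the whole mass has been collected at 2 pi.\<close>

definition fejer_cdf :: "(nat \<Rightarrow> 'a::complex_hilbert \<Rightarrow> 'a \<Rightarrow> complex) \<Rightarrow> nat \<Rightarrow> real \<Rightarrow> 'a \<Rightarrow> 'a \<Rightarrow> complex" where
  "fejer_cdf s N t x y = (\<Sum>k\<in>{k. k < 2 * N \<and> pi * real k / real N < t}. fejer_weight s N k x y)"

lemma fejer_cdf_diff:
  assumes "t \<le> t'"
  shows "fejer_cdf s N t' x y - fejer_cdf s N t x y =
    (\<Sum>k\<in>{k. k < 2 * N \<and> t \<le> pi * real k / real N \<and> pi * real k / real N < t'}. fejer_weight s N k x y)"
proof -
  let ?A = "{k. k < 2 * N \<and> pi * real k / real N < t}"
  let ?B = "{k. k < 2 * N \<and> t \<le> pi * real k / real N \<and> pi * real k / real N < t'}"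
  have "{k. k < 2 * N \<and> pi * real k / real N < t'} = ?A \<union> ?B" using assms by auto
  then have "fejer_cdf s N t' x y = sum (\<lambda>k. fejer_weight s N k x y) (?A \<union> ?B)"
    by (simp add: fejer_cdf_def)
  also have "\<dots> = fejer_cdf s N t x y + sum (\<lambda>k. fejer_weight s N k x y) ?B"
    unfolding fejer_cdf_def by (rule sum.union_disjoint) auto
  finally show ?thesis by simp
qed

lemma positive_form_sum:
  "(\<And>i. i \<in> I \<Longrightarrow> positive_form (b i)) \<Longrightarrow> positive_form (\<lambda>x y. \<Sum>i\<in>I. b i x y)"
  unfolding positive_form_def by (auto intro!: sesquilinear_sum simp: complex_nonneg_Reals_iff sum_nonneg)

lemma fejer_cdf_mono:
  assumes "positive_definite s (N - 1)" "t \<le> t'"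
  shows "positive_form (\<lambda>x y. fejer_cdf s N t' x y - fejer_cdf s N t x y)"
  unfolding fejer_cdf_diff[OF assms(2)] by (intro positive_form_sum positive_form_fejer_weight assms)

lemma fejer_cdf_0: "t \<le> 0 \<Longrightarrow> fejer_cdf s N t x y = 0"
proof -
  assume "t \<le> 0"
  have "0 \<le> pi * real k / real N" for k by simp
  then have "{k. k < 2 * N \<and> pi * real k / real N < t} = {}"
    using \<open>t \<le> 0\<close> by (auto simp: not_less intro: order_trans)
  then show ?thesis unfolding fejer_cdf_def by (simp only: sum.empty)
qed

lemma fejer_cdf_2pi:
  assumes "2 * pi \<le> t" "N > 0"
  shows "fejer_cdf s N t x y = s 0 x y"
proof -
  have "pi * real k / real N < t" if "k < 2 * N" for k
  proof -
    have "pi * real k < pi * (2 * real N)" using that by simp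
    then have "pi * real k / real N < 2 * pi" using assms(2) by (simp add: field_simps)
    then show ?thesis using assms by linarith
  qed
  then have "{k. k < 2 * N \<and> pi * real k / real N < t} = {..<2 * N}" by auto
  then have "fejer_cdf s N t x y = (\<Sum>k<2*N. cis (real 0 * (pi * real k / real N)) * fejer_weight s N k x y)"
    unfolding fejer_cdf_def by simp
  then show ?thesis
    using fejer_moment[of 0 N s x y] assms(2) by simp
qed

lemma fejer_cdf_bound:
  assumes pd: "positive_definite s (N - 1)" and "N > 0"
  shows "cmod (fejer_cdf s N t x y) \<le> form_bound (s 0) x y"
proof -
  have "cmod (\<Sum>k\<in>{k. k < 2 * N \<and> pi * real k / real N < t}. 1 * fejer_weight s N k x y) \<le> 1 * form_bound (s 0) x y"
  proof (rule positive_form_weighted_sum_bound)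
    fix z
    have "(\<Sum>k\<in>{k. k < 2 * N \<and> pi * real k / real N < t}. Re (fejer_weight s N k z z)) \<le>
        (\<Sum>k<2*N. Re (fejer_weight s N k z z))"
      by (intro sum_mono2) (auto intro: positive_form_Re positive_form_fejer_weight[OF pd])
    also have "\<dots> = Re (s 0 z z)"
      using fejer_moment[of 0 N s z z] assms(2) by (simp flip: Re_sum)
    finally show "(\<Sum>k\<in>{k. k < 2 * N \<and> pi * real k / real N < t}. Re (fejer_weight s N k z z)) \<le> Re (s 0 z z)" .
  qed (auto intro: positive_form_fejer_weight[OF pd])
  then show ?thesis by (simp add: fejer_cdf_def)
qed

text \<open>A Riemann sum of the discrete distribution is a weighted sum over its nodes, with
  weights within \<open>\<omega>\<close> of the exact values of the integrand. The bound does not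
  involve \<open>N\<close> and therefore survives the limit.\<close>

lemma fejer_cdf_RS_bound:
  fixes \<tau> :: "nat \<Rightarrow> real"
  assumes pd: "positive_definite s (N - 1)" and N: "N > 0" "m \<le> N"
    and \<tau>: "\<tau> 0 = 0" "\<And>k. k < M \<Longrightarrow> \<tau> k \<le> \<tau> (Suc k)" "\<tau> M = 2 * pi"
    and a: "\<And>k t. k < M \<Longrightarrow> \<tau> k \<le> t \<Longrightarrow> t \<le> \<tau> (Suc k) \<Longrightarrow> cmod (a k - cis (real m * t)) \<le> \<omega>"
    and "0 \<le> \<omega>"
  shows "cmod ((\<Sum>k<M. a k * (fejer_cdf s N (\<tau> (Suc k)) x y - fejer_cdf s N (\<tau> k) x y))
      - of_nat (N - m) / of_nat N * s m x y) \<le> \<omega> * form_bound (s 0) x y"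
proof -
  define \<theta> where "\<theta> k = pi * real k / real N" for k
  \<comment> \<open>The weight \<open>c i\<close> is the value \<open>a k\<close> of the cell
    containing node i. It must not depend on \<open>x\<close> and \<open>y\<close>, since the
    weighted bound rests on Cauchy-Schwarz.\<close>
  have "\<exists>c. (\<forall>i. \<theta> i < \<tau> K \<longrightarrow> cmod (c i - cis (real m * \<theta> i)) \<le> \<omega>) \<and>
      (\<forall>x y. (\<Sum>k<K. a k * (fejer_cdf s N (\<tau> (Suc k)) x y - fejer_cdf s N (\<tau> k) x y)) =
       (\<Sum>i\<in>{i. i < 2 * N \<and> \<theta> i < \<tau> K}. c i * fejer_weight s N i x y))"
    if "K \<le> M" for K
    using that
  proof (induction K)
    case 0
    have "\<not> \<theta> i < \<tau> 0" for i by (simp add: \<theta>_def \<tau>(1) not_less)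
    then show ?case by simp
  next
    case (Suc K)
    then obtain c where c: "\<And>i. \<theta> i < \<tau> K \<Longrightarrow> cmod (c i - cis (real m * \<theta> i)) \<le> \<omega>"
      "\<And>x y. (\<Sum>k<K. a k * (fejer_cdf s N (\<tau> (Suc k)) x y - fejer_cdf s N (\<tau> k) x y)) =
       (\<Sum>i\<in>{i. i < 2 * N \<and> \<theta> i < \<tau> K}. c i * fejer_weight s N i x y)" by fastforce
    have K: "K < M" using Suc by simp
    let ?A = "{i. i < 2 * N \<and> \<theta> i < \<tau> K}" and ?B = "{i. i < 2 * N \<and> \<tau> K \<le> \<theta> i \<and> \<theta> i < \<tau> (Suc K)}"
    define c' where "c' i = (if \<theta> i < \<tau> K then c i else a K)" for i
    have "(\<Sum>k<Suc K. a k * (fejer_cdf s N (\<tau> (Suc k)) x y - fejer_cdf s N (\<tau> k) x y)) =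
        (\<Sum>i\<in>{i. i < 2 * N \<and> \<theta> i < \<tau> (Suc K)}. c' i * fejer_weight s N i x y)" for x y
    proof -
      have "(\<Sum>k<Suc K. a k * (fejer_cdf s N (\<tau> (Suc k)) x y - fejer_cdf s N (\<tau> k) x y)) =
          (\<Sum>i\<in>?A. c i * fejer_weight s N i x y) + (\<Sum>i\<in>?B. a K * fejer_weight s N i x y)"
        using c(2) fejer_cdf_diff[OF \<tau>(2)[OF K], of s N x y] by (simp add: \<theta>_def sum_distrib_left)
      also have "\<dots> = (\<Sum>i\<in>?A. c' i * fejer_weight s N i x y) + (\<Sum>i\<in>?B. c' i * fejer_weight s N i x y)"
        by (intro arg_cong2[where f = "(+)"] sum.cong) (auto simp: c'_def)
      also have "\<dots> = (\<Sum>i\<in>?A \<union> ?B. c' i * fejer_weight s N i x y)"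
        by (rule sum.union_disjoint[symmetric]) auto
      also have "?A \<union> ?B = {i. i < 2 * N \<and> \<theta> i < \<tau> (Suc K)}"
        using \<tau>(2)[OF K] by auto
      finally show ?thesis .
    qed
    moreover have "cmod (c' i - cis (real m * \<theta> i)) \<le> \<omega>" if "\<theta> i < \<tau> (Suc K)" for i
      using c(1)[of i] a[OF K, of "\<theta> i"] that by (auto simp: c'_def)
    ultimately show ?case by (intro exI[of _ c'] conjI) auto
  qed
  from this[OF order_refl] obtain c where
    c: "\<And>i. \<theta> i < \<tau> M \<Longrightarrow> cmod (c i - cis (real m * \<theta> i)) \<le> \<omega>"
      "\<And>x y. (\<Sum>k<M. a k * (fejer_cdf s N (\<tau> (Suc k)) x y - fejer_cdf s N (\<tau> k) x y)) =
       (\<Sum>i\<in>{i. i < 2 * N \<and> \<theta> i < \<tau> M}. c i * fejer_weight s N i x y)" by fastforce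
  have lt: "\<theta> i < \<tau> M" if "i < 2 * N" for i
  proof -
    have "pi * real i < pi * (2 * real N)" using that by simp
    then show ?thesis using N by (simp add: \<theta>_def \<tau>(3) field_simps)
  qed
  then have all: "{i. i < 2 * N \<and> \<theta> i < \<tau> M} = {..<2 * N}" by auto
  have "(\<Sum>k<M. a k * (fejer_cdf s N (\<tau> (Suc k)) x y - fejer_cdf s N (\<tau> k) x y))
      - of_nat (N - m) / of_nat N * s m x y =
    (\<Sum>i<2*N. (c i - cis (real m * \<theta> i)) * fejer_weight s N i x y)"
    unfolding c(2) all fejer_moment[OF N(2,1), symmetric]
    by (simp add: \<theta>_def algebra_simps sum_subtractf)
  also have "cmod \<dots> \<le> \<omega> * form_bound (s 0) x y"
  proof (rule positive_form_weighted_sum_bound)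
    show "(\<Sum>i<2*N. Re (fejer_weight s N i z z)) \<le> Re (s 0 z z)" for z
      using fejer_moment[of 0 N s z z] N by (simp flip: Re_sum)
  qed (use c(1) lt \<open>0 \<le> \<omega>\<close> in \<open>auto intro: positive_form_fejer_weight[OF pd]\<close>)
  finally show ?thesis .
qed

section \<open>Existence of solutions\<close>

text \<open>A product of closed discs is compact by Tychonoff. The index set may be uncountable, so
  a subsequence converging everywhere cannot be expected; a filter finer than
  \<open>sequentially\<close> takes its place.\<close>

lemma pointwise_cluster_filter:
  fixes f :: "nat \<Rightarrow> 'i \<Rightarrow> complex"
  assumes bound: "\<And>n i. cmod (f n i) \<le> R i"
  shows "\<exists>F g. F \<noteq> bot \<and> F \<le> sequentially \<and> (\<forall>i. ((\<lambda>n. f n i) \<longlongrightarrow> g i) F)"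
proof -
  define K where "K = (\<Pi>\<^sub>E i\<in>UNIV. cball (0::complex) (R i))"
  have "compactin (product_topology (\<lambda>i. euclidean) UNIV) K"
    unfolding K_def by (subst compactin_PiE) simp
  then have "compact K"
    by (simp add: euclidean_product_topology)
  moreover have "\<forall>\<^sub>F x in filtermap f sequentially. x \<in> K"
    unfolding eventually_filtermap using bound by (simp add: K_def PiE_def Pi_def)
  moreover have "filtermap f sequentially \<noteq> bot"
    by (simp add: filtermap_bot_iff)
  ultimately obtain g where g: "inf (nhds g) (filtermap f sequentially) \<noteq> bot"
    unfolding compact_filter by blast
  \<comment> \<open>The neighbourhoods of the cluster point, pulled back to the index n; the cluster
    property makes them compatible with large n.\<close>
  define F where "F = inf (filtercomap f (nhds g)) sequentially"
  have "F \<noteq> bot"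
  proof
    assume "F = bot"
    then have "eventually (\<lambda>_. False) F" by simp
    then obtain P Q where P: "eventually P (filtercomap f (nhds g))" and Q: "eventually Q sequentially"
      and PQ: "\<And>n. P n \<and> Q n \<Longrightarrow> False"
      unfolding F_def eventually_inf by blast
    from P obtain P' where P': "eventually P' (nhds g)" "\<And>n. P' (f n) \<Longrightarrow> P n"
      unfolding eventually_filtercomap by blast
    have "eventually (\<lambda>h. \<not> P' h) (filtermap f sequentially)"
      unfolding eventually_filtermap using Q by (rule eventually_mono) (use PQ P'(2) in blast)
    with P'(1) have "eventually (\<lambda>_. False) (inf (nhds g) (filtermap f sequentially))"
      unfolding eventually_inf by blast
    with g show False by (simp add: trivial_limit_def)
  qed
  moreover have "F \<le> sequentially" by (simp add: F_def)
  moreover have "((\<lambda>n. f n i) \<longlongrightarrow> g i) F" for i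
  proof -
    have "filterlim f (nhds g) F"
      unfolding F_def by (rule filterlim_mono[OF filterlim_filtercomap]) auto
    moreover have "filterlim (\<lambda>h :: 'i \<Rightarrow> complex. h i) (nhds (g i)) (nhds g)"
    proof (rule topological_tendstoI)
      fix U :: "complex set" assume U: "open U" "g i \<in> U"
      have "open ((\<lambda>h :: 'i \<Rightarrow> complex. h i) -` U)"
        by (rule open_vimage[OF U(1)]) (rule continuous_on_product_coordinates)
      then show "\<forall>\<^sub>F h in nhds g. h i \<in> U"
        unfolding eventually_nhds using U(2) by blast
    qed
    ultimately show ?thesis by (rule filterlim_compose[rotated])
  qed
  ultimately show ?thesis by blast
qed

lemma positive_form_limit:
  assumes "F \<noteq> bot" "\<forall>\<^sub>F i in F. positive_form (b i)" "\<And>x y. ((\<lambda>i. b i x y) \<longlongrightarrow> b' x y) F"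
  shows "positive_form b'"
proof -
  have "\<forall>\<^sub>F i in F. sesquilinear (b i)"
    by (rule eventually_mono[OF assms(2)]) (simp add: positive_form_def)
  from sesquilinear_limit[OF assms(1) this assms(3)] have "sesquilinear b'" .
  moreover have "b' x x \<in> \<real>\<^sub>\<ge>\<^sub>0" for x
    by (rule Lim_in_closed_set[OF closed_nonneg_Reals_complex _ assms(1) assms(3)])
      (rule eventually_mono[OF assms(2)], simp add: positive_form_def)
  ultimately show ?thesis by (simp add: positive_form_def)
qed

text \<open>Each property is a closed condition on the values at finitely many points, so it passes
  to the cluster point. Weak inequalities between partition points and arbitrary cell values
  \<open>a\<close> leave room for the shifted partitions used in the normalization.\<close>

lemma weak_solution_exists:
  assumes pd: "\<And>N. positive_definite s N"
  obtains b :: "real \<Rightarrow> 'a::complex_hilbert \<Rightarrow> 'a \<Rightarrow> complex"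
    where "\<And>t t'. t \<le> t' \<Longrightarrow> positive_form (\<lambda>x y. b t' x y - b t x y)"
      "\<And>t. t \<le> 0 \<Longrightarrow> b t = (\<lambda>x y. 0)" "\<And>t. 2 * pi \<le> t \<Longrightarrow> b t = s 0"
      "\<And>(M::nat) \<tau> a \<omega> m x y. \<lbrakk>\<tau> 0 = 0; \<And>k. k < M \<Longrightarrow> \<tau> k \<le> \<tau> (Suc k); \<tau> M = 2 * pi;
         \<And>k t. \<lbrakk>k < M; \<tau> k \<le> t; t \<le> \<tau> (Suc k)\<rbrakk> \<Longrightarrow> cmod (a k - cis (real m * t)) \<le> \<omega>; 0 \<le> \<omega>\<rbrakk> \<Longrightarrow>
         cmod ((\<Sum>k<M. a k * (b (\<tau> (Suc k)) x y - b (\<tau> k) x y)) - s m x y) \<le> \<omega> * form_bound (s 0) x y"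
proof -
  have "cmod (case i of (t, x, y) \<Rightarrow> fejer_cdf s (Suc n) t x y) \<le> (case i of (t, x, y) \<Rightarrow> form_bound (s 0) x y)"
    for n and i :: "real \<times> 'a \<times> 'a"
    by (cases i) (simp add: fejer_cdf_bound pd)
  from pointwise_cluster_filter[where f = "\<lambda>n i. case i of (t, x, y) \<Rightarrow> fejer_cdf s (Suc n) t x y", OF this]
  obtain F g where F: "F \<noteq> bot" "F \<le> sequentially"
    and g: "\<And>i. ((\<lambda>n. case i of (t, x, y) \<Rightarrow> fejer_cdf s (Suc n) t x y) \<longlongrightarrow> g i) F"
    by blast
  define b where "b t x y = g (t, x, y)" for t x y
  have lim: "((\<lambda>n. fejer_cdf s (Suc n) t x y) \<longlongrightarrow> b t x y) F" for t x y
    using g[of "(t, x, y)"] by (simp add: b_def)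
  have mono: "positive_form (\<lambda>x y. b t' x y - b t x y)" if "t \<le> t'" for t t'
  proof (rule positive_form_limit[OF F(1)])
    show "\<forall>\<^sub>F n in F. positive_form (\<lambda>x y. fejer_cdf s (Suc n) t' x y - fejer_cdf s (Suc n) t x y)"
      by (intro always_eventually allI fejer_cdf_mono pd that)
  qed (intro tendsto_diff lim)
  have b0: "b t = (\<lambda>x y. 0)" if "t \<le> 0" for t
  proof (intro ext)
    fix x y show "b t x y = 0"
      using lim[of t x y] F(1) by (simp add: fejer_cdf_0[OF that] tendsto_const_iff)
  qed
  have b2: "b t = s 0" if "2 * pi \<le> t" for t
  proof (intro ext)
    fix x y show "b t x y = s 0 x y"
      using lim[of t x y] F(1) by (simp add: fejer_cdf_2pi[OF that] tendsto_const_iff)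
  qed
  have RS: "cmod ((\<Sum>k<M. a k * (b (\<tau> (Suc k)) x y - b (\<tau> k) x y)) - s m x y) \<le> \<omega> * form_bound (s 0) x y"
    if \<tau>: "\<tau> 0 = 0" "\<And>k. k < M \<Longrightarrow> \<tau> k \<le> \<tau> (Suc k)" "\<tau> M = 2 * pi"
      and a: "\<And>k t. \<lbrakk>k < M; \<tau> k \<le> t; t \<le> \<tau> (Suc k)\<rbrakk> \<Longrightarrow> cmod (a k - cis (real m * t)) \<le> \<omega>"
      and \<omega>: "0 \<le> \<omega>" for M \<tau> a \<omega> m x y
  proof (rule tendsto_upperbound[OF _ _ F(1)])
    \<comment> \<open>The Fejer damping factor disappears in the limit.\<close>
    have "(\<lambda>n. of_real (real (Suc n - m) / real (Suc n))) \<longlonglongrightarrow> (of_real 1 :: complex)"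
    proof (rule tendsto_of_real, rule Lim_transform_eventually)
      show "(\<lambda>n. 1 - real m * (1 / real (Suc n))) \<longlonglongrightarrow> 1"
        using tendsto_diff[OF tendsto_const[of 1] tendsto_mult_right_zero[OF lim_inverse_n'[THEN LIMSEQ_Suc], of "real m"]]
        by simp
      show "\<forall>\<^sub>F n in sequentially. 1 - real m * (1 / real (Suc n)) = real (Suc n - m) / real (Suc n)"
        using eventually_ge_at_top[of m] by eventually_elim (simp add: of_nat_diff field_simps)
    qed
    then have "((\<lambda>n. of_nat (Suc n - m) / of_nat (Suc n)) \<longlongrightarrow> (1::complex)) F"
      using F(2) by (intro tendsto_mono[OF F(2)]) simp
    then have "((\<lambda>n. of_nat (Suc n - m) / of_nat (Suc n) * s m x y) \<longlongrightarrow> 1 * s m x y) F"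
      by (intro tendsto_mult tendsto_const)
    then show "((\<lambda>n. cmod ((\<Sum>k<M. a k * (fejer_cdf s (Suc n) (\<tau> (Suc k)) x y - fejer_cdf s (Suc n) (\<tau> k) x y))
        - of_nat (Suc n - m) / of_nat (Suc n) * s m x y)) \<longlongrightarrow>
        cmod ((\<Sum>k<M. a k * (b (\<tau> (Suc k)) x y - b (\<tau> k) x y)) - s m x y)) F"
      by (intro tendsto_norm tendsto_diff tendsto_sum tendsto_mult tendsto_const lim) simp
    have "\<forall>\<^sub>F n in sequentially. m \<le> Suc n"
      using eventually_ge_at_top[of m] by eventually_elim simp
    then have "\<forall>\<^sub>F n in F. m \<le> Suc n" using F(2) by (simp add: le_filter_def)
    then show "\<forall>\<^sub>F n in F. cmod ((\<Sum>k<M. a k * (fejer_cdf s (Suc n) (\<tau> (Suc k)) x y - fejer_cdf s (Suc n) (\<tau> k) x y))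
        - of_nat (Suc n - m) / of_nat (Suc n) * s m x y) \<le> \<omega> * form_bound (s 0) x y"
      by eventually_elim (rule fejer_cdf_RS_bound[OF pd]; (rule \<tau> a \<omega>)?; simp)
  qed
  show thesis using that[OF mono b0 b2 RS] .
qed

section \<open>Left limits and normalization\<close>

lemma mono_has_left_limit:
  fixes f :: "real \<Rightarrow> real"
  assumes "mono f"
  shows "\<exists>l. (f \<longlongrightarrow> l) (at_left t)"
proof -
  have bdd: "bdd_above (f ` {..<t})"
    by (rule bdd_aboveI[of _ "f t"]) (use assms in \<open>auto simp: mono_def\<close>)
  have "(f \<longlongrightarrow> Sup (f ` {..<t})) (at_left t)"
  proof (rule increasing_tendsto)
    show "\<forall>\<^sub>F s in at_left t. f s \<le> Sup (f ` {..<t})"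
      unfolding eventually_at_left_field by (intro exI[of _ "t - 1"]) (auto intro!: cSup_upper bdd)
    fix x assume "x < Sup (f ` {..<t})"
    then obtain s where s: "s < t" "x < f s"
      using less_cSup_iff[OF _ bdd, of x] by auto
    then show "\<forall>\<^sub>F s in at_left t. x < f s"
      unfolding eventually_at_left_field using assms by (intro exI[of _ s]) (auto simp: mono_def intro: less_le_trans)
  qed
  then show ?thesis by blast
qed

text \<open>Diagonal values are real and monotone, hence have left limits; polarization transfers
  this to all values.\<close>

lemma monotone_forms_left_limit:
  fixes b :: "real \<Rightarrow> 'a::complex_hilbert \<Rightarrow> 'a \<Rightarrow> complex"
  assumes mono: "\<And>t t'. t \<le> t' \<Longrightarrow> positive_form (\<lambda>x y. b t' x y - b t x y)"
    and b0: "b 0 = (\<lambda>x y. 0)"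
  shows "\<exists>l. ((\<lambda>s. b s x y) \<longlongrightarrow> l) (at_left t)"
proof -
  have sq: "sesquilinear (b t)" for t
  proof (cases "t \<ge> 0")
    case True
    then show ?thesis using mono[OF True] by (simp add: b0 positive_form_def)
  next
    case False
    then have "sesquilinear (\<lambda>x y. 0 - b t x y)"
      using mono[of t 0] by (simp add: b0 positive_form_def)
    from sesquilinear_mult[OF this, of "- 1"] show ?thesis by simp
  qed
  have real: "Im (b t z z) = 0" for t z
  proof (cases "t \<ge> 0")
    case True
    then show ?thesis using mono[OF True] by (simp add: b0 positive_form_def complex_nonneg_Reals_iff)
  next
    case False
    then show ?thesis using mono[of t 0] by (simp add: b0 positive_form_def complex_nonneg_Reals_iff)
  qed
  have diag: "\<exists>l. ((\<lambda>s. b s z z) \<longlongrightarrow> l) (at_left t)" for z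
  proof -
    have "mono (\<lambda>s. Re (b s z z))"
    proof (rule monoI)
      fix s s' :: real assume "s \<le> s'"
      from positive_form_Re[OF mono[OF this], of z] show "Re (b s z z) \<le> Re (b s' z z)" by simp
    qed
    then obtain l where "((\<lambda>s. Re (b s z z)) \<longlongrightarrow> l) (at_left t)"
      using mono_has_left_limit by blast
    then have "((\<lambda>s. complex_of_real (Re (b s z z))) \<longlongrightarrow> of_real l) (at_left t)"
      by (rule tendsto_of_real)
    moreover have "complex_of_real (Re (b s z z)) = b s z z" for s
      by (simp add: complex_eq_iff real)
    ultimately show ?thesis by auto
  qed
  obtain l where l: "\<And>z. ((\<lambda>s. b s z z) \<longlongrightarrow> l z) (at_left t)" using diag by metis
  have eq: "b s x y = (b s (x + y) (x + y) - b s (x + (- 1) *\<^sub>C y) (x + (- 1) *\<^sub>C y)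
    + \<i> * b s (x + \<i> *\<^sub>C y) (x + \<i> *\<^sub>C y) - \<i> * b s (x + (- \<i>) *\<^sub>C y) (x + (- \<i>) *\<^sub>C y)) / 4" for s
    unfolding sesquilinear_polarization[OF sq[of s], of x y, symmetric] by simp
  have "((\<lambda>s. (b s (x + y) (x + y) - b s (x + (- 1) *\<^sub>C y) (x + (- 1) *\<^sub>C y)
    + \<i> * b s (x + \<i> *\<^sub>C y) (x + \<i> *\<^sub>C y) - \<i> * b s (x + (- \<i>) *\<^sub>C y) (x + (- \<i>) *\<^sub>C y)) / 4) \<longlongrightarrow>
    (l (x + y) - l (x + (- 1) *\<^sub>C y) + \<i> * l (x + \<i> *\<^sub>C y) - \<i> * l (x + (- \<i>) *\<^sub>C y)) / 4) (at_left t)"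
    by (intro tendsto_divide tendsto_diff tendsto_add tendsto_mult tendsto_const l) simp
  then show ?thesis unfolding eq[symmetric] by blast
qed

lemma tagged_partition_mono:
  assumes "tagged_partition a b N t \<xi>" "i \<le> j" "j \<le> N"
  shows "t i \<le> t j"
  using assms(2,3)
proof (induction j)
  case (Suc j)
  then have "t j < t (Suc j)" using assms(1) by (simp add: tagged_partition_def)
  with Suc show ?case by (cases "i = Suc j") auto
qed simp

lemma positive_form_Cauchy_Schwarz:
  assumes "positive_form b"
  shows "cmod (b x y) \<le> form_bound b x y"
  using positive_form_sum_Cauchy_Schwarz[of "{()}" "\<lambda>_. b" "\<lambda>_. x" "\<lambda>_. y"] assms
  by (simp add: form_bound_def)

lemma positive_form_add:
  "\<lbrakk>positive_form b; positive_form c\<rbrakk> \<Longrightarrow> positive_form (\<lambda>x y. b x y + c x y)"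
  by (simp add: positive_form_def sesquilinear_add complex_nonneg_Reals_iff)

locale bounded_pd_sequence =
  fixes s :: "nat \<Rightarrow> 'a::complex_hilbert \<Rightarrow> 'a \<Rightarrow> complex" and K :: real
  assumes pd: "\<And>N. positive_definite s N"
    and K: "0 \<le> K" "\<And>x. Re (s 0 x x) \<le> K * (norm x)\<^sup>2"
begin

lemma form_bound_le:
  assumes "\<And>z. 0 \<le> Re (b z z)" "\<And>z. Re (b z z) \<le> Re (s 0 z z)"
  shows "form_bound b x y \<le> K * norm x * norm y"
proof -
  have le: "sqrt (Re (b z z)) \<le> sqrt K * norm z" for z
    using real_sqrt_le_mono[OF order_trans[OF assms(2) K(2)[of z]]] by (simp add: real_sqrt_mult)
  have "form_bound b x y \<le> (sqrt K * norm x) * (sqrt K * norm y)"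
    unfolding form_bound_def using le assms(1) K(1) by (intro mult_mono) auto
  also have "\<dots> = K * norm x * norm y" using K(1) by simp
  finally show ?thesis .
qed

lemma s0_nonneg: "0 \<le> Re (s 0 x x)"
  by (rule positive_form_Re[OF positive_definite_0[OF pd]])

text \<open>Cauchy-Schwarz in the Toeplitz space for the vectors at indices m and 0, whose squared
  norms are values of \<open>s 0\<close>. Boundedness of the zeroth moment thus carries over to all
  moments.\<close>

lemma s_bound: "cmod (s m x y) \<le> K * norm x * norm y"
proof -
  interpret pd_forms s m by unfold_locales (rule pd)
  have T: "T (single m x) (single 0 y) = s m x y" "T (single m x) (single m x) = s 0 x x"
    "T (single 0 y) (single 0 y) = s 0 y y"
    by (simp_all add: toeplitz_form_single_single[OF pd] form_ext_def)
  have "cmod (s m x y) \<le> form_bound (s 0) x y"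
    using Cauchy_Schwarz[of "single m x" "single 0 y"] unfolding form_bound_def ip_norm_def
    by (simp add: T)
  also have "\<dots> \<le> K * norm x * norm y" by (rule form_bound_le) (simp_all add: s0_nonneg)
  finally show ?thesis .
qed

lemma moment_operator: "\<exists>T. bounded_clinear T \<and> (\<forall>x y. cinner (T x) y = s m x y)"
  using pd[of m] s_bound by (intro bounded_sesquilinear_operator) (auto simp: positive_definite_def)

lemma filterlim_left_shift: "filterlim (\<lambda>\<sigma>. t - \<sigma>) (at_left t) (at_right (0::real))"
  unfolding filterlim_at
proof
  show "\<forall>\<^sub>F \<sigma> in at_right 0. t - \<sigma> \<in> {..<t} \<and> t - \<sigma> \<noteq> t"
    using eventually_at_right_less[of "0::real"] by eventually_elim auto
  have "((\<lambda>\<sigma>. t - \<sigma>) \<longlongrightarrow> t - 0) (at_right 0)" by (intro tendsto_intros)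
  then show "((\<lambda>\<sigma>. t - \<sigma>) \<longlongrightarrow> t) (at_right 0)" by simp
qed

text \<open>
  Solutions must be left-continuous and have no mass at \<open>2\<pi>\<close>, whereas the limit \<open>b\<close> of the
  discrete measures may be any of the one-sided versions and may have an atom at \<open>2\<pi>\<close>. The
  latter is moved to the point \<open>0\<close>.
\<close>

lemma normalized_solution_exists:
  obtains g :: "real \<Rightarrow> 'a \<Rightarrow> 'a \<Rightarrow> complex"
    where "\<And>t t'. \<lbrakk>0 \<le> t; t \<le> t'\<rbrakk> \<Longrightarrow> positive_form (\<lambda>x y. g t' x y - g t x y)"
      "g 0 = (\<lambda>x y. 0)" "g (2 * pi) = s 0"
      "\<And>t x. 0 < t \<Longrightarrow> ((\<lambda>s. Re (g s x x)) \<longlongrightarrow> Re (g t x x)) (at_left t)"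
      "\<And>N t \<xi> \<delta> m x y. \<lbrakk>tagged_partition 0 (2 * pi) N t \<xi>; \<And>k. k < N \<Longrightarrow> t (Suc k) - t k < \<delta>; 0 < \<delta>\<rbrakk> \<Longrightarrow>
         cmod ((\<Sum>k<N. cis (real m * \<xi> k) * (g (t (Suc k)) x y - g (t k) x y)) - s m x y) \<le>
           2 * real m * \<delta> * form_bound (s 0) x y"
proof -
  obtain b :: "real \<Rightarrow> 'a \<Rightarrow> 'a \<Rightarrow> complex"
    where mono: "\<And>t t'. t \<le> t' \<Longrightarrow> positive_form (\<lambda>x y. b t' x y - b t x y)"
      and b0: "\<And>t. t \<le> 0 \<Longrightarrow> b t = (\<lambda>x y. 0)" and b2: "\<And>t. 2 * pi \<le> t \<Longrightarrow> b t = s 0"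
      and RS: "\<And>(M::nat) \<tau> a \<omega> m x y. \<lbrakk>\<tau> 0 = 0; \<And>k. k < M \<Longrightarrow> \<tau> k \<le> \<tau> (Suc k); \<tau> M = 2 * pi;
         \<And>k t. \<lbrakk>k < M; \<tau> k \<le> t; t \<le> \<tau> (Suc k)\<rbrakk> \<Longrightarrow> cmod (a k - cis (real m * t)) \<le> \<omega>; 0 \<le> \<omega>\<rbrakk> \<Longrightarrow>
         cmod ((\<Sum>k<M. a k * (b (\<tau> (Suc k)) x y - b (\<tau> k) x y)) - s m x y) \<le> \<omega> * form_bound (s 0) x y"
    by (rule weak_solution_exists[OF pd]) blast
  define c where "c t x y = Lim (at_left t) (\<lambda>s. b s x y)" for t x y
  have c: "((\<lambda>s. b s x y) \<longlongrightarrow> c t x y) (at_left t)" for t x y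
  proof -
    obtain l where l: "((\<lambda>s. b s x y) \<longlongrightarrow> l) (at_left t)"
      using monotone_forms_left_limit[of b, OF mono b0[OF order_refl]] by blast
    then have "c t x y = l" unfolding c_def by (intro tendsto_Lim) simp_all
    with l show ?thesis by simp
  qed
  have c_shift: "((\<lambda>\<sigma>. b (t - \<sigma>) x y) \<longlongrightarrow> c t x y) (at_right 0)" for t x y
    by (rule filterlim_compose[OF c filterlim_left_shift])
  \<comment> \<open>The atom of \<open>b\<close> at 2 pi, which left limits do not see;
    \<open>g\<close> places it at 0.\<close>
  define J where "J x y = s 0 x y - c (2 * pi) x y" for x y
  define g where "g t x y = (if t \<le> 0 then 0 else c t x y + J x y)" for t x y
  have c_mono: "positive_form (\<lambda>x y. c t' x y - c t x y)" if "t \<le> t'" for t t'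
  proof (rule positive_form_limit[of "at_right 0"])
    show "\<forall>\<^sub>F \<sigma> in at_right 0. positive_form (\<lambda>x y. b (t' - \<sigma>) x y - b (t - \<sigma>) x y)"
      using that by (intro always_eventually allI mono) simp
  qed (simp, intro tendsto_diff c_shift)
  have J: "positive_form J"
  proof (rule positive_form_limit[of "at_right 0"])
    show "\<forall>\<^sub>F \<sigma> in at_right 0. positive_form (\<lambda>x y. b (2 * pi) x y - b (2 * pi - \<sigma>) x y)"
      using eventually_at_right_less[of "0::real"] by eventually_elim (rule mono, simp)
    show "((\<lambda>\<sigma>. b (2 * pi) x y - b (2 * pi - \<sigma>) x y) \<longlongrightarrow> J x y) (at_right 0)" for x y
      unfolding J_def b2[OF order_refl] by (intro tendsto_diff tendsto_const c_shift)
  qed simp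
  have c_pos: "positive_form (c t)" if "0 < t" for t
  proof (rule positive_form_limit[of "at_right 0"])
    show "\<forall>\<^sub>F \<sigma> in at_right 0. positive_form (\<lambda>x y. b (t - \<sigma>) x y - b 0 x y)"
      using eventually_at_right_less[of "0::real"] eventually_at_right_real[OF that]
      by eventually_elim (rule mono, simp)
    show "((\<lambda>\<sigma>. b (t - \<sigma>) x y - b 0 x y) \<longlongrightarrow> c t x y) (at_right 0)" for x y
      using c_shift[of t x y] by (simp add: b0)
  qed simp
  have g_mono: "positive_form (\<lambda>x y. g t' x y - g t x y)" if t: "0 \<le> t" "t \<le> t'" for t t'
  proof -
    consider "t' = 0" "t = 0" | "t = 0" "0 < t'" | "0 < t" using t by linarith
    then show ?thesis
    proof cases
      case 1
      then show ?thesis by (simp add: positive_form_def sesquilinear_def)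
    next
      case 2
      then show ?thesis using positive_form_add[OF c_pos[of t'] J] by (simp add: g_def)
    next
      case 3
      then show ?thesis using t c_mono[of t t'] by (simp add: g_def)
    qed
  qed
  have g0: "g 0 = (\<lambda>x y. 0)" by (simp add: g_def fun_eq_iff)
  have g2: "g (2 * pi) = s 0"
  proof (intro ext)
    have "\<not> 2 * pi \<le> 0" using pi_gt_zero by linarith
    then show "g (2 * pi) x y = s 0 x y" for x y unfolding g_def J_def by simp
  qed
  \<comment> \<open>Values of \<open>b\<close> strictly further left are dominated by the left
    limits. Those that nearly exhaust \<open>c\<close> at \<open>t\<close> therefore also bound
    \<open>c\<close> from below just before \<open>t\<close>, which is left-continuity.\<close>
  have b_le_c: "Re (b r x x) \<le> Re (c t x x)" if "r < t" for r t x
  proof (rule tendsto_lowerbound[OF tendsto_Re[OF c]])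
    show "\<forall>\<^sub>F q in at_left t. Re (b r x x) \<le> Re (b q x x)"
      using eventually_at_left_real[OF that]
    proof eventually_elim
      case (elim q)
      then show ?case using positive_form_Re[OF mono[of r q], of x] by simp
    qed
  qed simp
  have g_left: "((\<lambda>q. Re (g q x x)) \<longlongrightarrow> Re (g t x x)) (at_left t)" if t: "0 < t" for t x
  proof (rule increasing_tendsto)
    show "\<forall>\<^sub>F q in at_left t. Re (g q x x) \<le> Re (g t x x)"
      using eventually_at_left_real[OF t]
    proof eventually_elim
      case (elim q)
      then show ?case using positive_form_Re[OF g_mono[of q t], of x] by simp
    qed
    fix z assume z: "z < Re (g t x x)"
    then have "z - Re (J x x) < Re (c t x x)" using t by (simp add: g_def)
    then have "\<forall>\<^sub>F q in at_left t. z - Re (J x x) < Re (b q x x)"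
      by (rule order_tendstoD(1)[OF tendsto_Re[OF c]])
    then have "\<forall>\<^sub>F q in at_left t. z - Re (J x x) < Re (b q x x) \<and> q < t"
      by (rule eventually_conj) (auto simp: eventually_at_left_field intro!: exI[of _ "t - 1"])
    then obtain r where r: "z - Re (J x x) < Re (b r x x)" "r < t"
      using eventually_happens'[of "at_left t"] by auto
    have "max r 0 < t" using r t by simp
    from eventually_at_left_real[OF this]
    show "\<forall>\<^sub>F q in at_left t. z < Re (g q x x)"
    proof eventually_elim
      case (elim q)
      then show ?case using b_le_c[of r q x] r(1) by (simp add: g_def)
    qed
  qed
  have g_RS: "cmod ((\<Sum>k<N. cis (real m * \<xi> k) * (g (t (Suc k)) x y - g (t k) x y)) - s m x y) \<le>
      2 * real m * \<delta> * form_bound (s 0) x y"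
    if part: "tagged_partition 0 (2 * pi) N t \<xi>" and mesh: "\<And>k. k < N \<Longrightarrow> t (Suc k) - t k < \<delta>" and \<delta>: "0 < \<delta>"
    for N t \<xi> \<delta> m x y
  proof -
    have t: "t 0 = 0" "t N = 2 * pi" "\<And>k. k < N \<Longrightarrow> t k < t (Suc k)"
      "\<And>k. k < N \<Longrightarrow> t k \<le> \<xi> k \<and> \<xi> k \<le> t (Suc k)"
      using part by (auto simp: tagged_partition_def)
    have "N \<noteq> 0" using t(1,2) by (intro notI) simp
    then obtain M where M: "N = Suc M" by (cases N) auto
    have tpos: "0 < t (Suc k)" if "k < N" for k
      using tagged_partition_mono[OF part, of 0 k] t(1) t(3)[OF that] that by simp
    \<comment> \<open>A sum for \<open>b\<close> over the partition moved left by
      \<open>\<sigma>\<close>, with an additional last cell from 2 pi - \<sigma> to 2 pi. As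
      \<open>\<sigma>\<close> tends to 0, it becomes the Riemann sum of \<open>g\<close>.\<close>
    define E where "E \<sigma> = cis (real m * \<xi> 0) * b (t (Suc 0) - \<sigma>) x y +
      (\<Sum>k<M. cis (real m * \<xi> (Suc k)) * (b (t (Suc (Suc k)) - \<sigma>) x y - b (t (Suc k) - \<sigma>) x y)) +
      cis (real m * \<xi> 0) * (s 0 x y - b (2 * pi - \<sigma>) x y)" for \<sigma>
    have "(E \<longlongrightarrow> cis (real m * \<xi> 0) * c (t (Suc 0)) x y +
      (\<Sum>k<M. cis (real m * \<xi> (Suc k)) * (c (t (Suc (Suc k))) x y - c (t (Suc k)) x y)) +
      cis (real m * \<xi> 0) * (s 0 x y - c (2 * pi) x y)) (at_right 0)"
      unfolding E_def[abs_def] by (intro tendsto_intros c_shift)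
    also have "cis (real m * \<xi> 0) * c (t (Suc 0)) x y +
      (\<Sum>k<M. cis (real m * \<xi> (Suc k)) * (c (t (Suc (Suc k))) x y - c (t (Suc k)) x y)) +
      cis (real m * \<xi> 0) * (s 0 x y - c (2 * pi) x y) =
      (\<Sum>k<N. cis (real m * \<xi> k) * (g (t (Suc k)) x y - g (t k) x y))"
    proof -
      have S1: "(\<Sum>k<M. cis (real m * \<xi> (Suc k)) * (c (t (Suc (Suc k))) x y - c (t (Suc k)) x y)) =
          (\<Sum>k<M. cis (real m * \<xi> (Suc k)) * (g (t (Suc (Suc k))) x y - g (t (Suc k)) x y))"
      proof (intro sum.cong refl)
        fix k assume "k \<in> {..<M}"
        then have "0 < t (Suc (Suc k))" "0 < t (Suc k)" using tpos M by auto
        then show "cis (real m * \<xi> (Suc k)) * (c (t (Suc (Suc k))) x y - c (t (Suc k)) x y) =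
          cis (real m * \<xi> (Suc k)) * (g (t (Suc (Suc k))) x y - g (t (Suc k)) x y)"
          by (simp add: g_def)
      qed
      have "g (t (Suc 0)) x y = c (t (Suc 0)) x y + J x y"
        using tpos[of 0] M by (simp add: g_def)
      then show ?thesis
        unfolding M sum.lessThan_Suc_shift S1 by (simp add: t(1) g0 J_def) (simp add: algebra_simps)
    qed
    finally have E: "(E \<longlongrightarrow> (\<Sum>k<N. cis (real m * \<xi> k) * (g (t (Suc k)) x y - g (t k) x y))) (at_right 0)" .
    show ?thesis
    proof (rule tendsto_upperbound[of _ _ "at_right 0"])
      show "((\<lambda>\<sigma>. cmod (E \<sigma> - s m x y)) \<longlongrightarrow>
          cmod ((\<Sum>k<N. cis (real m * \<xi> k) * (g (t (Suc k)) x y - g (t k) x y)) - s m x y)) (at_right 0)"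
        by (intro tendsto_intros E)
      have "0 < min (t (Suc 0)) \<delta>" using tpos[of 0] M \<delta> by simp
      from eventually_at_right_real[OF this]
      show "\<forall>\<^sub>F \<sigma> in at_right 0. cmod (E \<sigma> - s m x y) \<le> 2 * real m * \<delta> * form_bound (s 0) x y"
      proof eventually_elim
        case (elim \<sigma>)
        then have \<sigma>: "0 < \<sigma>" "\<sigma> < t (Suc 0)" "\<sigma> < \<delta>" by auto
        \<comment> \<open>The endpoint 0 stays fixed, and N+1 cells result, the last of which
          captures the atom at 2 pi.\<close>
        define \<tau> where "\<tau> k = (if k = 0 then 0 else if k \<le> N then t k - \<sigma> else 2 * pi)" for k
        \<comment> \<open>The atom now counts at 0, so the last cell carries the tag of the first
          cell.\<close>
        define a where "a k = (if k < N then cis (real m * \<xi> k) else cis (real m * \<xi> 0))" for k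
        have "E \<sigma> = (\<Sum>k<Suc N. a k * (b (\<tau> (Suc k)) x y - b (\<tau> k) x y))"
        proof -
          have "(\<Sum>k<Suc N. a k * (b (\<tau> (Suc k)) x y - b (\<tau> k) x y)) =
            a 0 * (b (\<tau> (Suc 0)) x y - b (\<tau> 0) x y) +
            (\<Sum>k<M. a (Suc k) * (b (\<tau> (Suc (Suc k))) x y - b (\<tau> (Suc k)) x y)) +
            a N * (b (\<tau> (Suc N)) x y - b (\<tau> N) x y)"
            by (subst sum.lessThan_Suc, subst M, subst sum.lessThan_Suc_shift) simp
          also have "(\<Sum>k<M. a (Suc k) * (b (\<tau> (Suc (Suc k))) x y - b (\<tau> (Suc k)) x y)) =
            (\<Sum>k<M. cis (real m * \<xi> (Suc k)) * (b (t (Suc (Suc k)) - \<sigma>) x y - b (t (Suc k) - \<sigma>) x y))"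
            by (intro sum.cong refl) (auto simp: a_def \<tau>_def M)
          finally show ?thesis
            using M t(2) by (simp add: E_def a_def \<tau>_def b0 b2)
        qed
        also have "cmod (\<dots> - s m x y) \<le> 2 * real m * \<delta> * form_bound (s 0) x y"
        proof (rule RS)
          show "\<tau> 0 = 0" "\<tau> (Suc N) = 2 * pi" "0 \<le> 2 * real m * \<delta>"
            using \<delta> by (simp_all add: \<tau>_def)
          show "\<tau> k \<le> \<tau> (Suc k)" if "k < Suc N" for k
          proof -
            consider "k = 0" | "0 < k" "k < N" | "k = N" "0 < k" using \<open>k < Suc N\<close> by linarith
            then show ?thesis
              using \<sigma> M t(2) t(3)[of k] by cases (auto simp: \<tau>_def)
          qed
          fix k u assume k: "k < Suc N" and u: "\<tau> k \<le> u" "u \<le> \<tau> (Suc k)"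
          have cis: "cmod (cis (real m * v) - cis (real m * w)) \<le> real m * \<bar>v - w\<bar>" for v w
            using norm_cis_diff_le[of "real m * v" "real m * w"]
            by (simp add: abs_mult flip: right_diff_distrib)
          show "cmod (a k - cis (real m * u)) \<le> 2 * real m * \<delta>"
          proof (cases "k < N")
            case True
            \<comment> \<open>One \<open>\<delta>\<close> accounts for the mesh and one for the
              shift by \<open>\<sigma>\<close>; this is the origin of the constant 2.\<close>
            have "\<bar>\<xi> k - u\<bar> \<le> 2 * \<delta>"
              using t(4)[OF True] mesh[OF True] u \<sigma> True t(1)
              by (auto simp: \<tau>_def split: if_splits)
            then have "real m * \<bar>\<xi> k - u\<bar> \<le> real m * (2 * \<delta>)" by (intro mult_left_mono) auto
            then show ?thesis using cis[of "\<xi> k" u] True by (simp add: a_def)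
          next
            case False
            then have "k = N" using k by simp
            then have u: "2 * pi - \<sigma> \<le> u" "u \<le> 2 * pi" using u M t(2) by (auto simp: \<tau>_def)
            \<comment> \<open>Periodicity makes the relocation harmless: the tag
              \<open>\<xi> 0\<close> is close to 0 and \<open>u\<close> is close to 2 pi.\<close>
            have "cis (real m * (2 * pi)) = 1"
              using cis_multiple_2pi[of "real m"] by (simp add: mult.commute)
            then have "cmod (a k - cis (real m * u)) =
              cmod ((cis (real m * \<xi> 0) - cis (real m * 0)) + (cis (real m * (2 * pi)) - cis (real m * u)))"
              using \<open>k = N\<close> by (simp add: a_def)
            also have "\<dots> \<le> cmod (cis (real m * \<xi> 0) - cis (real m * 0)) + cmod (cis (real m * (2 * pi)) - cis (real m * u))"
              by (rule norm_triangle_ineq)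
            also have "\<dots> \<le> real m * \<bar>\<xi> 0 - 0\<bar> + real m * \<bar>2 * pi - u\<bar>"
              by (intro add_mono cis)
            also have "\<dots> \<le> real m * \<delta> + real m * \<delta>"
              using t(4)[of 0] mesh[of 0] t(1) M u \<sigma> by (intro add_mono mult_left_mono) auto
            finally show ?thesis by (simp add: ac_simps)
          qed
        qed
        finally show ?case .
      qed
    qed simp
  qed
  show thesis using that[OF g_mono g0 g2 g_left g_RS] .
qed

text \<open>The forms are represented by operators. Convergence of diagonal values suffices for
  strong left-continuity, because Cauchy-Schwarz for the increment bounds the norm of F t x - F r x
  by the root of its diagonal value at \<open>x\<close>. One \<open>F\<close> serves every
  truncation and also has all later moments, from which different solutions will be told
  apart.\<close>

lemma solution_exists:
  obtains F where
    "\<And>S d. (\<And>n x y. n \<le> d \<Longrightarrow> cinner (S n x) y = s n x y) \<Longrightarrow> moment_solution S d F"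
    "\<And>m. \<exists>T. has_strong_RS_integral (\<lambda>t. exp (\<i> * of_nat m * of_real t)) F 0 (2 * pi) T \<and>
       (\<forall>x y. cinner (T x) y = s m x y)"
proof -
  obtain g :: "real \<Rightarrow> 'a \<Rightarrow> 'a \<Rightarrow> complex"
    where mono: "\<And>t t'. \<lbrakk>0 \<le> t; t \<le> t'\<rbrakk> \<Longrightarrow> positive_form (\<lambda>x y. g t' x y - g t x y)"
      and g0: "g 0 = (\<lambda>x y. 0)" and g2: "g (2 * pi) = s 0"
      and left: "\<And>t x. 0 < t \<Longrightarrow> ((\<lambda>s. Re (g s x x)) \<longlongrightarrow> Re (g t x x)) (at_left t)"
      and RS: "\<And>N t \<xi> \<delta> m x y. \<lbrakk>tagged_partition 0 (2 * pi) N t \<xi>; \<And>k. k < N \<Longrightarrow> t (Suc k) - t k < \<delta>; 0 < \<delta>\<rbrakk> \<Longrightarrow>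
         cmod ((\<Sum>k<N. cis (real m * \<xi> k) * (g (t (Suc k)) x y - g (t k) x y)) - s m x y) \<le>
           2 * real m * \<delta> * form_bound (s 0) x y"
    by (rule normalized_solution_exists) blast
  have pos: "positive_form (g t)" if "0 \<le> t" for t
    using mono[OF order_refl that] by (simp add: g0)
  have le: "Re (g t x x) \<le> Re (g t' x x)" if "0 \<le> t" "t \<le> t'" for t t' x
    using positive_form_Re[OF mono[OF that], of x] by simp
  have bound: "cmod (g t x y) \<le> K * norm x * norm y" if "0 \<le> t" "t \<le> 2 * pi" for t x y
  proof -
    have "cmod (g t x y) \<le> form_bound (g t) x y"
      by (rule positive_form_Cauchy_Schwarz[OF pos[OF that(1)]])
    also have "\<dots> \<le> K * norm x * norm y"
      using le[OF that] by (intro form_bound_le positive_form_Re pos that) (simp add: g2)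
    finally show ?thesis .
  qed
  have "\<exists>T. bounded_clinear T \<and> (\<forall>x y. cinner (T x) y = g t x y)" if "0 \<le> t" "t \<le> 2 * pi" for t
    using pos[OF that(1)] bound[OF that] by (intro bounded_sesquilinear_operator) (auto simp: positive_form_def)
  then obtain F where F: "\<And>t. \<lbrakk>0 \<le> t; t \<le> 2 * pi\<rbrakk> \<Longrightarrow> bounded_clinear (F t)"
    "\<And>t x y. \<lbrakk>0 \<le> t; t \<le> 2 * pi\<rbrakk> \<Longrightarrow> cinner (F t x) y = g t x y" by metis
  have F0: "F 0 = (\<lambda>x. 0)"
    by (rule ext, rule cinner_eqI) (simp add: F(2) g0)
  have F_mono: "positive_op (\<lambda>x. F t x - F r x)" if "0 \<le> r" "r \<le> t" "t \<le> 2 * pi" for r t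
    using mono[of r t] that by (simp add: positive_op_def cinner_diff_left F positive_form_def)
  have F_left: "((\<lambda>r. F r x) \<longlongrightarrow> F t x) (at_left t)" if t: "0 < t" "t \<le> 2 * pi" for t x
  proof -
    have "((\<lambda>r. F r x - F t x) \<longlongrightarrow> 0) (at_left t)"
    proof (rule Lim_null_comparison)
      show "\<forall>\<^sub>F r in at_left t. norm (F r x - F t x) \<le> sqrt (Re (g t x x) - Re (g r x x)) * sqrt K"
        using eventually_at_left_real[OF t(1)]
      proof eventually_elim
        case (elim r)
        then have r: "0 \<le> r" "r \<le> t" "r \<le> 2 * pi" using t by auto
        define D where "D = (\<lambda>x y. g t x y - g r x y)"
        have D: "positive_form D" unfolding D_def by (rule mono[OF r(1,2)])
        have DK: "sqrt (Re (D y y)) \<le> sqrt K * norm y" for y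
        proof -
          have "Re (D y y) \<le> Re (s 0 y y)"
            using le[of t "2 * pi" y] t positive_form_Re[OF pos[OF r(1)], of y] by (simp add: D_def g2)
          then have "Re (D y y) \<le> K * (norm y)\<^sup>2" using K(2)[of y] by linarith
          from real_sqrt_le_mono[OF this] show ?thesis by (simp add: real_sqrt_mult)
        qed
        have "norm (F t x - F r x) \<le> sqrt (Re (D x x)) * sqrt K"
        proof (rule norm_leI_cinner)
          fix y
          have "cmod (cinner (F t x - F r x) y) = cmod (D x y)"
            using r t by (simp add: cinner_diff_left F D_def)
          also have "\<dots> \<le> sqrt (Re (D x x)) * sqrt (Re (D y y))"
            using positive_form_Cauchy_Schwarz[OF D, of x y] by (simp add: form_bound_def)
          also have "\<dots> \<le> sqrt (Re (D x x)) * (sqrt K * norm y)"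
            by (intro mult_left_mono DK real_sqrt_ge_zero positive_form_Re D)
          finally show "cmod (cinner (F t x - F r x) y) \<le> sqrt (Re (D x x)) * sqrt K * norm y"
            by (simp add: ac_simps)
        qed (use positive_form_Re[OF D] K(1) in simp)
        then show ?case by (simp add: D_def norm_minus_commute)
      qed
      have "((\<lambda>r. sqrt (Re (g t x x) - Re (g r x x)) * sqrt K) \<longlongrightarrow>
          sqrt (Re (g t x x) - Re (g t x x)) * sqrt K) (at_left t)"
        by (intro tendsto_intros left t)
      then show "((\<lambda>r. sqrt (Re (g t x x) - Re (g r x x)) * sqrt K) \<longlongrightarrow> 0) (at_left t)" by simp
    qed
    then show ?thesis by (simp add: LIM_zero_iff)
  qed
  have F_RS: "has_strong_RS_integral (\<lambda>t. exp (\<i> * of_nat m * of_real t)) F 0 (2 * pi) T"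
    if T: "\<And>x y. cinner (T x) y = s m x y" for m T
    unfolding has_strong_RS_integral_def
  proof (intro allI impI)
    fix x :: 'a and e :: real assume e: "0 < e"
    \<comment> \<open>The added ones keep the denominator positive for m = 0 or x = 0 and make the
      final estimate strict.\<close>
    define \<delta> where "\<delta> = e / (2 * (real m + 1) * (K * norm x + 1))"
    have Kx: "0 \<le> K * norm x" using K(1) by simp
    have \<delta>: "0 < \<delta>" unfolding \<delta>_def using e Kx by (intro divide_pos_pos mult_pos_pos) auto
    show "\<exists>\<delta>>0. \<forall>N t \<xi>. tagged_partition 0 (2 * pi) N t \<xi> \<and> (\<forall>k<N. t (Suc k) - t k < \<delta>) \<longrightarrow>
        norm (RS_sum (\<lambda>t. exp (\<i> * of_nat m * of_real t)) F N t \<xi> x - T x) < e"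
    proof (intro exI[of _ \<delta>] conjI \<delta> allI impI)
      fix N t \<xi> assume H: "tagged_partition 0 (2 * pi) N t \<xi> \<and> (\<forall>k<N. t (Suc k) - t k < \<delta>)"
      then have t: "t 0 = 0" "t N = 2 * pi" by (auto simp: tagged_partition_def)
      have t_bound: "0 \<le> t k" "t k \<le> 2 * pi" if "k \<le> N" for k
        using tagged_partition_mono[OF conjunct1[OF H], of 0 k] tagged_partition_mono[OF conjunct1[OF H], of k N]
          that t by auto
      have "norm (RS_sum (\<lambda>t. exp (\<i> * of_nat m * of_real t)) F N t \<xi> x - T x) \<le> 2 * real m * \<delta> * (K * norm x)"
      proof (rule norm_leI_cinner)
        fix y
        have "cinner (RS_sum (\<lambda>t. exp (\<i> * of_nat m * of_real t)) F N t \<xi> x) y =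
            (\<Sum>k<N. cis (real m * \<xi> k) * (g (t (Suc k)) x y - g (t k) x y))"
          unfolding RS_sum_def cinner_sum_left
          by (intro sum.cong refl)
            (simp add: cinner_scaleC_left cinner_diff_left F t_bound cis_conv_exp mult.assoc)
        then have "cmod (cinner (RS_sum (\<lambda>t. exp (\<i> * of_nat m * of_real t)) F N t \<xi> x - T x) y) \<le>
            2 * real m * \<delta> * form_bound (s 0) x y"
          using RS[OF conjunct1[OF H] _ \<delta>, of m x y] H by (simp add: cinner_diff_left T)
        also have "\<dots> \<le> 2 * real m * \<delta> * (K * norm x * norm y)"
          using \<delta> by (intro mult_left_mono form_bound_le s0_nonneg) auto
        finally show "cmod (cinner (RS_sum (\<lambda>t. exp (\<i> * of_nat m * of_real t)) F N t \<xi> x - T x) y) \<le>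
            2 * real m * \<delta> * (K * norm x) * norm y" by (simp add: ac_simps)
      qed (use Kx \<delta> in simp)
      also have "\<dots> \<le> 2 * (real m + 1) * \<delta> * (K * norm x)"
        using Kx \<delta> by (intro mult_right_mono) auto
      also have "\<dots> < 2 * (real m + 1) * \<delta> * (K * norm x + 1)"
        using \<delta> by (intro mult_strict_left_mono) auto
      also have "\<dots> = e"
      proof -
        have "0 < 2 * (real m + 1) * (K * norm x + 1)"
          using Kx by (intro mult_pos_pos) auto
        then have "2 * (real m + 1) * (K * norm x + 1) * \<delta> = e"
          unfolding \<delta>_def by (metis less_irrefl nonzero_mult_div_cancel_left times_divide_eq_right)
        then show ?thesis by (simp only: ac_simps)
      qed
      finally show "norm (RS_sum (\<lambda>t. exp (\<i> * of_nat m * of_real t)) F N t \<xi> x - T x) < e" .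
    qed
  qed
  show thesis
  proof (rule that[of F])
    fix S :: "nat \<Rightarrow> 'a \<Rightarrow> 'a" and d
    assume "\<And>n x y. n \<le> d \<Longrightarrow> cinner (S n x) y = s n x y"
    then show "moment_solution S d F"
      unfolding moment_solution_def using F(1) F_mono F0 F_left F_RS by auto
  next
    fix m
    show "\<exists>T. has_strong_RS_integral (\<lambda>t. exp (\<i> * of_nat m * of_real t)) F 0 (2 * pi) T \<and>
       (\<forall>x y. cinner (T x) y = s m x y)"
      using moment_operator[of m] F_RS by blast
  qed
qed

end

section \<open>Trigonometric moments determine monotone functions\<close>

text \<open>Built up term by term, so that convergence of moments extends to trigonometric
  polynomials by induction.\<close>

inductive trig_polynomial :: "(real \<Rightarrow> complex) \<Rightarrow> bool" where
  zero: "trig_polynomial (\<lambda>t. 0)"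
| step: "trig_polynomial f \<Longrightarrow> trig_polynomial (\<lambda>t. f t + c * cis (of_int n * t))"

lemma trig_polynomial_monom: "trig_polynomial (\<lambda>t. c * cis (of_int n * t))"
  using trig_polynomial.step[OF trig_polynomial.zero, of c n] by simp

lemma trig_polynomial_add:
  assumes "trig_polynomial f" "trig_polynomial g"
  shows "trig_polynomial (\<lambda>t. f t + g t)"
  using assms(2)
proof induction
  case (step g c n)
  then show ?case
    using trig_polynomial.step[of "\<lambda>t. f t + g t" c n] by (simp add: add.assoc)
qed (use assms(1) in simp)

lemma trig_polynomial_mult_monom:
  "trig_polynomial f \<Longrightarrow> trig_polynomial (\<lambda>t. f t * (c * cis (of_int n * t)))"
proof (induction rule: trig_polynomial.induct)
  case (step f a m)
  have "(\<lambda>t. (f t + a * cis (of_int m * t)) * (c * cis (of_int n * t))) =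
      (\<lambda>t. f t * (c * cis (of_int n * t)) + (a * c) * cis (of_int (m + n) * t))"
    by (simp add: fun_eq_iff algebra_simps flip: cis_mult)
  with trig_polynomial.step[OF step.IH, of "a * c" "m + n"] show ?case by simp
qed (simp add: trig_polynomial.zero)

lemma trig_polynomial_mult:
  assumes "trig_polynomial f" "trig_polynomial g"
  shows "trig_polynomial (\<lambda>t. f t * g t)"
  using assms(2)
proof induction
  case (step g c n)
  then show ?case
    using trig_polynomial_add[OF step.IH trig_polynomial_mult_monom[OF assms(1), of c n]]
    by (simp add: distrib_left)
qed (simp add: trig_polynomial.zero)

text \<open>On the unit circle, a real linear functional is a combination of cosine and sine, to
  which Euler's formula applies. This connects Stone-Weierstrass in the plane with the
  moments.\<close>

lemma trig_polynomial_of_polynomial: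
  "real_polynomial_function p \<Longrightarrow> trig_polynomial (\<lambda>t. of_real (p (cis t)))"
proof (induction rule: real_polynomial_function.induct)
  case (linear h)
  have "h (cis t) = cos t * h 1 + sin t * h \<i>" for t
  proof -
    have "cis t = cos t *\<^sub>R 1 + sin t *\<^sub>R \<i>" by (simp add: complex_eq_iff)
    then have "h (cis t) = h (cos t *\<^sub>R 1 + sin t *\<^sub>R \<i>)" by simp
    then show ?thesis using linear by (simp add: linear_simps)
  qed
  then have "of_real (h (cis t)) = ((of_real (h 1) - \<i> * of_real (h \<i>)) / 2) * cis (of_int 1 * t) +
      ((of_real (h 1) + \<i> * of_real (h \<i>)) / 2) * cis (of_int (- 1) * t)" for t
    by (simp add: complex_eq_iff field_simps)
  then show ?case
    by (simp only: trig_polynomial_add trig_polynomial_monom)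
next
  case (const c)
  then show ?case using trig_polynomial_monom[of "of_real c" 0] by simp
next
  case (add f g)
  then show ?case using trig_polynomial_add by simp
next
  case (mult f g)
  then show ?case using trig_polynomial_mult by simp
qed

lemma cis_eq_imp_eq:
  assumes "cis u = cis v" "0 \<le> u" "u < 2 * pi" "0 \<le> v" "v < 2 * pi"
  shows "u = v"
proof -
  have "exp (\<i> * of_real (u - v)) = 1"
    using assms(1) by (simp add: cis_conv_exp right_diff_distrib exp_diff)
  then obtain n :: int where n: "u - v = of_int (2 * n) * pi"
    unfolding exp_eq_1 by auto
  have "\<bar>u - v\<bar> < 2 * pi" using assms by auto
  then have "2 * \<bar>of_int n\<bar> * pi < 2 * pi" unfolding n by (simp add: abs_mult)
  then have "\<bar>of_int n :: real\<bar> < 1" by simp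
  then have "n = 0" by linarith
  then show ?thesis using n by simp
qed

text \<open>Urysohn's lemma for two disjoint arcs of the circle, followed by Stone-Weierstrass. The
  function is 1 at the point 0, which is also the point 2 pi, so the zero arc has to stop short of 2
  pi.\<close>

lemma trig_indicator_approximation:
  assumes "0 < \<kappa>" "0 \<le> r" "0 < \<eta>" "r + \<eta> < 2 * pi"
  obtains f p where "trig_polynomial p" "\<And>t. cmod (of_real (f t) - p t) < \<kappa>" "\<And>t. 0 \<le> f t \<and> f t \<le> (1::real)"
    "\<And>t. \<lbrakk>0 \<le> t; t \<le> r\<rbrakk> \<Longrightarrow> f t = 1" "\<And>t. \<lbrakk>r + \<eta> \<le> t; t \<le> 2 * pi - \<eta>\<rbrakk> \<Longrightarrow> f t = 0"
proof -
  define A where "A = cis ` {0..r}"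
  define B where "B = cis ` {r + \<eta>..2 * pi - \<eta>}"
  have "continuous_on X cis" for X
    unfolding cis_conv_exp by (intro continuous_intros)
  then have "closed A" "closed B"
    unfolding A_def B_def by (auto intro!: compact_imp_closed compact_continuous_image)
  moreover have "A \<inter> B = {}"
    using cis_eq_imp_eq assms by (fastforce simp: A_def B_def)
  ultimately obtain F :: "complex \<Rightarrow> real" where F: "continuous_on UNIV F"
    "\<And>x. F x \<in> closed_segment 1 0" "\<And>x. x \<in> A \<Longrightarrow> F x = 1" "\<And>x. x \<in> B \<Longrightarrow> F x = 0"
    using Urysohn[of A B 1 0] by metis
  obtain P where P: "real_polynomial_function P" "\<And>x. x \<in> sphere 0 1 \<Longrightarrow> \<bar>F x - P x\<bar> < \<kappa>"
    using Stone_Weierstrass_real_polynomial_function[of "sphere (0::complex) 1" F \<kappa>]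
      continuous_on_subset[OF F(1) subset_UNIV] assms(1) by auto
  show thesis
  proof (rule that)
    show "trig_polynomial (\<lambda>t. of_real (P (cis t)))" by (rule trig_polynomial_of_polynomial[OF P(1)])
    show "cmod (of_real (F (cis t)) - of_real (P (cis t))) < \<kappa>" for t
      using P(2)[of "cis t"] by (simp flip: of_real_diff)
    show "0 \<le> F (cis t) \<and> F (cis t) \<le> 1" for t
      using F(2)[of "cis t"] by (simp add: closed_segment_eq_real_ivl)
  qed (auto intro!: F(3,4) simp: A_def B_def)
qed

section \<open>Comparison of monotone functions through sums over uniform partitions\<close>

definition uniform_pt :: "nat \<Rightarrow> nat \<Rightarrow> real" where
  "uniform_pt N k = 2 * pi * real k / real N"

lemma uniform_pt_bounds: "k \<le> N \<Longrightarrow> 0 \<le> uniform_pt N k \<and> uniform_pt N k \<le> 2 * pi"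
  by (cases "N = 0") (auto simp: uniform_pt_def field_simps)

lemma uniform_pt_Suc: "uniform_pt N (Suc k) = uniform_pt N k + 2 * pi / real N"
  by (simp add: uniform_pt_def field_simps add_divide_distrib)

lemma uniform_pt_ends: "uniform_pt N 0 = 0" "N > 0 \<Longrightarrow> uniform_pt N N = 2 * pi"
  by (simp_all add: uniform_pt_def)

lemma uniform_mesh_tendsto: "(\<lambda>N. 2 * pi / real N) \<longlonglongrightarrow> 0"
  by (rule lim_const_over_n)

text \<open>A continuous periodic function near the indicator of [0, t] is integrated against both
  increments, with asymptotically equal results. It majorizes the indicator for \<open>D\<close> and
  is majorized for \<open>E\<close>, up to mass of \<open>E\<close> near 2 pi; left-continuity
  removes this mass and the gap below \<open>t\<close>. The reverse inequality follows by exchanging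
  the roles.\<close>

lemma monotone_moments_le:
  fixes D E :: "real \<Rightarrow> real"
  assumes mono: "\<And>s t. \<lbrakk>0 \<le> s; s \<le> t; t \<le> 2 * pi\<rbrakk> \<Longrightarrow> D s \<le> D t"
      "\<And>s t. \<lbrakk>0 \<le> s; s \<le> t; t \<le> 2 * pi\<rbrakk> \<Longrightarrow> E s \<le> E t"
    and zero: "D 0 = 0" "E 0 = 0"
    and left: "\<And>t. \<lbrakk>0 < t; t \<le> 2 * pi\<rbrakk> \<Longrightarrow> (D \<longlongrightarrow> D t) (at_left t)"
      "\<And>t. \<lbrakk>0 < t; t \<le> 2 * pi\<rbrakk> \<Longrightarrow> (E \<longlongrightarrow> E t) (at_left t)"
    and moments: "\<And>n::int. (\<lambda>N. \<Sum>k<N. cis (of_int n * uniform_pt N k) *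
        of_real ((D (uniform_pt N (Suc k)) - D (uniform_pt N k)) -
                 (E (uniform_pt N (Suc k)) - E (uniform_pt N k)))) \<longlonglongrightarrow> 0"
    and t: "0 < t" "t < 2 * pi"
  shows "D t \<le> E t"
proof -
  define \<Delta>D where "\<Delta>D N k = D (uniform_pt N (Suc k)) - D (uniform_pt N k)" for N k
  define \<Delta>E where "\<Delta>E N k = E (uniform_pt N (Suc k)) - E (uniform_pt N k)" for N k
  have ub: "0 \<le> uniform_pt N k" "uniform_pt N k \<le> uniform_pt N (Suc k)" "uniform_pt N (Suc k) \<le> 2 * pi"
    if "k < N" for N k
    using uniform_pt_bounds[of k N] uniform_pt_bounds[of "Suc k" N] uniform_pt_Suc[of N k] that by auto
  have \<Delta>_nonneg: "0 \<le> \<Delta>D N k" "0 \<le> \<Delta>E N k" if "k < N" for N k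
    using mono ub[OF that] by (auto simp: \<Delta>D_def \<Delta>E_def)
  have sum_le: "(\<Sum>k<N. \<Delta>D N k) = D (2 * pi)" "(\<Sum>k<N. \<Delta>E N k) = E (2 * pi)" if "N > 0" for N
    unfolding \<Delta>D_def \<Delta>E_def
    by (simp_all add: sum_lessThan_telescope[of "\<lambda>k. D (uniform_pt N k)"]
        sum_lessThan_telescope[of "\<lambda>k. E (uniform_pt N k)"] uniform_pt_ends that zero)
  have trig: "(\<lambda>N. \<Sum>k<N. p (uniform_pt N k) * of_real (\<Delta>D N k - \<Delta>E N k)) \<longlonglongrightarrow> 0"
    if "trig_polynomial p" for p
    using that
  proof induction
    case (step p c n)
    have "(\<lambda>N. (\<Sum>k<N. p (uniform_pt N k) * of_real (\<Delta>D N k - \<Delta>E N k)) +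
        c * (\<Sum>k<N. cis (of_int n * uniform_pt N k) * of_real (\<Delta>D N k - \<Delta>E N k))) \<longlonglongrightarrow> 0 + c * 0"
      using moments[of n] unfolding \<Delta>D_def[symmetric] \<Delta>E_def[symmetric]
      by (intro tendsto_add tendsto_mult tendsto_const step.IH)
    then show ?case
      by (simp add: distrib_right sum.distrib sum_distrib_left mult.assoc)
  qed simp
  have key: "D (t - 2 * \<eta>) \<le> E t + (E (2 * pi) - E (2 * pi - \<eta>))"
    if \<eta>: "0 < \<eta>" "2 * \<eta> < t" "t + \<eta> < 2 * pi" for \<eta>
  proof (rule field_le_epsilon)
    fix e :: real assume e: "0 < e"
    \<comment> \<open>Bounds the total mass of both functions, so that replacing \<open>f\<close> by
      \<open>p\<close> costs at most e/2; the other half is spent on the moments.\<close>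
    define Q where "Q = D (2 * pi) + E (2 * pi) + 1"
    have Q: "0 < Q" using mono[of 0 "2 * pi"] zero by (auto simp: Q_def)
    define \<kappa> where "\<kappa> = e / (2 * Q)"
    have \<kappa>: "0 < \<kappa>" using e Q by (simp add: \<kappa>_def)
    obtain f p where fp: "trig_polynomial p" "\<And>t. cmod (of_real (f t) - p t) < \<kappa>"
      "\<And>t. 0 \<le> f t \<and> f t \<le> (1::real)" "\<And>u. \<lbrakk>0 \<le> u; u \<le> t - 2 * \<eta>\<rbrakk> \<Longrightarrow> f u = 1"
      "\<And>u. \<lbrakk>t - \<eta> \<le> u; u \<le> 2 * pi - \<eta>\<rbrakk> \<Longrightarrow> f u = 0"
      by (rule trig_indicator_approximation[OF \<kappa>, of "t - 2 * \<eta>" \<eta>]) (use \<eta> in auto)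
    have "\<forall>\<^sub>F N in sequentially. cmod (\<Sum>k<N. p (uniform_pt N k) * of_real (\<Delta>D N k - \<Delta>E N k)) < e / 2"
      using tendsto_norm_zero[OF trig[OF fp(1)]] e by (intro order_tendstoD(2)) auto
    moreover have "\<forall>\<^sub>F N in sequentially. 2 * pi / real N < \<eta>"
      using uniform_mesh_tendsto \<eta>(1) by (rule order_tendstoD(2))
    ultimately have "\<forall>\<^sub>F N in sequentially. cmod (\<Sum>k<N. p (uniform_pt N k) * of_real (\<Delta>D N k - \<Delta>E N k)) < e / 2
        \<and> 2 * pi / real N < \<eta> \<and> N > 0"
      using eventually_gt_at_top[of 0] by eventually_elim simp
    then obtain N where N: "cmod (\<Sum>k<N. p (uniform_pt N k) * of_real (\<Delta>D N k - \<Delta>E N k)) < e / 2"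
      "2 * pi / real N < \<eta>" "N > 0"
      using eventually_happens' sequentially_bot by blast
    define u where "u = uniform_pt N"
    \<comment> \<open>Truncating the nodes with \<open>min\<close> gives a telescoping sum that can
      be compared cell by cell even if t - 2 \<eta> is not a node.\<close>
    have "D (t - 2 * \<eta>) = (\<Sum>k<N. D (min (u (Suc k)) (t - 2 * \<eta>)) - D (min (u k) (t - 2 * \<eta>)))"
      unfolding sum_lessThan_telescope[of "\<lambda>k. D (min (u k) (t - 2 * \<eta>))"]
      using \<eta> t zero N(3) by (simp add: u_def uniform_pt_ends min_def)
    also have "\<dots> \<le> (\<Sum>k<N. f (u k) * \<Delta>D N k)"
    proof (rule sum_mono)
      fix k assume "k \<in> {..<N}"
      then have k: "k < N" by simp
      show "D (min (u (Suc k)) (t - 2 * \<eta>)) - D (min (u k) (t - 2 * \<eta>)) \<le> f (u k) * \<Delta>D N k"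
      proof (cases "u k \<le> t - 2 * \<eta>")
        case True
        then have "f (u k) = 1" using fp(4) ub(1)[OF k] by (simp add: u_def)
        moreover have "D (min (u (Suc k)) (t - 2 * \<eta>)) \<le> D (u (Suc k))"
          using ub[OF k] \<eta> t by (intro mono) (auto simp: u_def min_def)
        ultimately show ?thesis using True by (simp add: \<Delta>D_def u_def)
      next
        case False
        then have "min (u (Suc k)) (t - 2 * \<eta>) = t - 2 * \<eta>" "min (u k) (t - 2 * \<eta>) = t - 2 * \<eta>"
          using ub(2)[OF k] by (auto simp: u_def)
        then show ?thesis using fp(3)[of "u k"] \<Delta>_nonneg(1)[OF k] by simp
      qed
    qed
    finally have lower: "D (t - 2 * \<eta>) \<le> (\<Sum>k<N. f (u k) * \<Delta>D N k)" .
    \<comment> \<open>The majorant telescopes over [0, t] and over [2 pi - \<eta>, 2 pi]. As the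
      mesh is below \<open>\<eta>\<close>, a cell starting before t - \<eta> ends before
      \<open>t\<close>, and cells starting between t - \<eta> and 2 pi - \<eta> contribute
      nothing.\<close>
    have "(\<Sum>k<N. f (u k) * \<Delta>E N k) \<le>
      (\<Sum>k<N. (E (min (u (Suc k)) t) - E (min (u k) t)) + (E (max (u (Suc k)) (2 * pi - \<eta>)) - E (max (u k) (2 * pi - \<eta>))))"
    proof (rule sum_mono)
      fix k assume "k \<in> {..<N}"
      then have k: "k < N" by simp
      have u: "0 \<le> u k" "u k \<le> u (Suc k)" "u (Suc k) \<le> 2 * pi" "u (Suc k) < u k + \<eta>"
        using ub[OF k] N(2) uniform_pt_Suc[of N k] by (auto simp: u_def)
      have 1: "E (min (u k) t) \<le> E (min (u (Suc k)) t)" using u t by (intro mono) auto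
      have 2: "E (max (u k) (2 * pi - \<eta>)) \<le> E (max (u (Suc k)) (2 * pi - \<eta>))"
        using u \<eta> t by (intro mono) auto
      have 3: "f (u k) * \<Delta>E N k \<le> \<Delta>E N k"
        using fp(3)[of "u k"] \<Delta>_nonneg(2)[OF k] by (simp add: mult_left_le_one_le)
      consider "u k < t - \<eta>" | "t - \<eta> \<le> u k" "u k \<le> 2 * pi - \<eta>" | "2 * pi - \<eta> < u k" by linarith
      then show "f (u k) * \<Delta>E N k \<le> (E (min (u (Suc k)) t) - E (min (u k) t)) +
          (E (max (u (Suc k)) (2 * pi - \<eta>)) - E (max (u k) (2 * pi - \<eta>)))"
      proof cases
        case 1
        then have "min (u (Suc k)) t = u (Suc k)" "min (u k) t = u k" using u by auto
        then show ?thesis using 2 3 by (simp add: \<Delta>E_def u_def)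
      next
        case 2
        then show ?thesis using fp(5)[of "u k"] 1 \<open>E (max (u k) (2 * pi - \<eta>)) \<le> _\<close> by simp
      next
        case 3
        then have "max (u (Suc k)) (2 * pi - \<eta>) = u (Suc k)" "max (u k) (2 * pi - \<eta>) = u k"
          using u by auto
        then show ?thesis using 1 \<open>f (u k) * \<Delta>E N k \<le> \<Delta>E N k\<close> by (simp add: \<Delta>E_def u_def)
      qed
    qed
    also have "\<dots> = E t + (E (2 * pi) - E (2 * pi - \<eta>))"
      unfolding sum.distrib sum_lessThan_telescope[of "\<lambda>k. E (min (u k) t)"]
        sum_lessThan_telescope[of "\<lambda>k. E (max (u k) (2 * pi - \<eta>))"]
      using \<eta> t zero N(3) by (simp add: u_def uniform_pt_ends)
    finally have upper: "(\<Sum>k<N. f (u k) * \<Delta>E N k) \<le> E t + (E (2 * pi) - E (2 * pi - \<eta>))" .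
    have "(\<Sum>k<N. f (u k) * \<Delta>D N k) - (\<Sum>k<N. f (u k) * \<Delta>E N k) = (\<Sum>k<N. f (u k) * (\<Delta>D N k - \<Delta>E N k))"
      by (simp add: sum_subtractf right_diff_distrib)
    also have "\<dots> \<le> cmod (of_real (\<Sum>k<N. f (u k) * (\<Delta>D N k - \<Delta>E N k)))"
      unfolding norm_of_real by (rule abs_ge_self)
    also have "of_real (\<Sum>k<N. f (u k) * (\<Delta>D N k - \<Delta>E N k)) =
        (\<Sum>k<N. p (u k) * of_real (\<Delta>D N k - \<Delta>E N k)) +
        (\<Sum>k<N. (of_real (f (u k)) - p (u k)) * of_real (\<Delta>D N k - \<Delta>E N k))"
      unfolding sum.distrib[symmetric] of_real_sum by (intro sum.cong refl) (simp add: algebra_simps)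
    also have "cmod \<dots> \<le> cmod (\<Sum>k<N. p (u k) * of_real (\<Delta>D N k - \<Delta>E N k)) +
        cmod (\<Sum>k<N. (of_real (f (u k)) - p (u k)) * of_real (\<Delta>D N k - \<Delta>E N k))"
      by (rule norm_triangle_ineq)
    also have "cmod (\<Sum>k<N. (of_real (f (u k)) - p (u k)) * of_real (\<Delta>D N k - \<Delta>E N k)) \<le>
        (\<Sum>k<N. \<kappa> * (\<Delta>D N k + \<Delta>E N k))"
    proof (rule sum_norm_le)
      fix k assume "k \<in> {..<N}"
      then have "\<bar>\<Delta>D N k - \<Delta>E N k\<bar> \<le> \<Delta>D N k + \<Delta>E N k"
        using \<Delta>_nonneg[of k N] by auto
      then show "cmod ((of_real (f (u k)) - p (u k)) * of_real (\<Delta>D N k - \<Delta>E N k)) \<le> \<kappa> * (\<Delta>D N k + \<Delta>E N k)"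
        unfolding norm_mult norm_of_real using fp(2)[of "u k"] \<kappa> by (intro mult_mono) auto
    qed
    also have "\<dots> = \<kappa> * (D (2 * pi) + E (2 * pi))"
      using sum_le[OF N(3)] by (simp add: sum.distrib flip: sum_distrib_left)
    also have "\<dots> \<le> \<kappa> * Q" using \<kappa> by (intro mult_left_mono) (auto simp: Q_def)
    also have "\<kappa> * Q = e / 2" using Q by (simp add: \<kappa>_def)
    finally have "(\<Sum>k<N. f (u k) * \<Delta>D N k) - (\<Sum>k<N. f (u k) * \<Delta>E N k) \<le> e"
      using N(1) by (simp add: u_def)
    with lower upper show "D (t - 2 * \<eta>) \<le> E t + (E (2 * pi) - E (2 * pi - \<eta>)) + e" by linarith
  qed
  have at_left: "filterlim (\<lambda>\<eta>. r - c * \<eta>) (at_left r) (at_right 0)" if "0 < c" for r c :: real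
    unfolding filterlim_at
  proof
    show "\<forall>\<^sub>F \<eta> in at_right 0. r - c * \<eta> \<in> {..<r} \<and> r - c * \<eta> \<noteq> r"
      using eventually_at_right_less[of "0::real"] by eventually_elim (use that in auto)
    have "((\<lambda>\<eta>. r - c * \<eta>) \<longlongrightarrow> r - c * 0) (at_right 0)" by (intro tendsto_intros)
    then show "((\<lambda>\<eta>. r - c * \<eta>) \<longlongrightarrow> r) (at_right 0)" by simp
  qed
  have "D t \<le> E t + (E (2 * pi) - E (2 * pi))"
  proof (rule tendsto_le[of "at_right 0"])
    show "((\<lambda>\<eta>. D (t - 2 * \<eta>)) \<longlongrightarrow> D t) (at_right 0)"
      using t by (intro filterlim_compose[OF left(1) at_left]) auto
    have "((\<lambda>\<eta>. E (2 * pi - 1 * \<eta>)) \<longlongrightarrow> E (2 * pi)) (at_right 0)"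
      by (intro filterlim_compose[OF left(2) at_left]) auto
    then show "((\<lambda>\<eta>. E t + (E (2 * pi) - E (2 * pi - \<eta>))) \<longlongrightarrow> E t + (E (2 * pi) - E (2 * pi))) (at_right 0)"
      by (intro tendsto_intros) simp
    have "0 < min (t / 2) (2 * pi - t)" using t by simp
    from eventually_at_right_real[OF this]
    show "\<forall>\<^sub>F \<eta> in at_right 0. D (t - 2 * \<eta>) \<le> E t + (E (2 * pi) - E (2 * pi - \<eta>))"
      by eventually_elim (rule key, auto)
  qed simp
  then show ?thesis by simp
qed

section \<open>Uniqueness of solutions\<close>

lemma has_strong_RS_integralE:
  assumes "has_strong_RS_integral f F a b T" "0 < e"
  obtains \<delta> where "0 < \<delta>" "\<And>N t \<xi>. \<lbrakk>tagged_partition a b N t \<xi>; \<forall>k<N. t (Suc k) - t k < \<delta>\<rbrakk> \<Longrightarrow>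
    norm (RS_sum f F N t \<xi> x - T x) < e"
proof -
  from assms(1)[unfolded has_strong_RS_integral_def, THEN spec[of _ x], THEN spec[of _ e], THEN mp, OF assms(2)]
  obtain \<delta> where "0 < \<delta>" and \<delta>: "\<forall>N t \<xi>. tagged_partition a b N t \<xi> \<and> (\<forall>k<N. t (Suc k) - t k < \<delta>) \<longrightarrow>
      norm (RS_sum f F N t \<xi> x - T x) < e" by (elim exE conjE)
  show thesis by (rule that[OF \<open>0 < \<delta>\<close>]) (rule \<delta>[rule_format], rule conjI)
qed

lemma tagged_partition_uniform:
  "N > 0 \<Longrightarrow> tagged_partition 0 (2 * pi) N (uniform_pt N) (uniform_pt N)"
  by (auto simp: tagged_partition_def uniform_pt_ends uniform_pt_Suc)

locale moment_solution_data = moment_data +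
  fixes F :: "real \<Rightarrow> 'a \<Rightarrow> 'a"
  assumes sol: "moment_solution S d F"
begin

definition mass :: "nat \<Rightarrow> nat \<Rightarrow> 'a \<Rightarrow> 'a \<Rightarrow> complex" where
  "mass N k x y = cinner (F (uniform_pt N (Suc k)) x - F (uniform_pt N k) x) y"

text \<open>Left-endpoint Riemann sums for every integer order. For orders beyond \<open>d\<close>
  no convergence is claimed, so uniqueness compares these sums directly.\<close>

definition approx_moment :: "nat \<Rightarrow> int \<Rightarrow> 'a \<Rightarrow> 'a \<Rightarrow> complex" where
  "approx_moment N n x y = (\<Sum>k<N. cis (of_int n * uniform_pt N k) * mass N k x y)"

lemma bounded_F: "\<lbrakk>0 \<le> t; t \<le> 2 * pi\<rbrakk> \<Longrightarrow> bounded_clinear (F t)"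
  using sol by (auto simp: moment_solution_def)

lemma positive_F: "\<lbrakk>0 \<le> r; r \<le> t; t \<le> 2 * pi\<rbrakk> \<Longrightarrow> positive_op (\<lambda>x. F t x - F r x)"
  using sol by (auto simp: moment_solution_def)

lemma F_0: "F 0 x = 0"
  using sol by (simp add: moment_solution_def)

lemma F_left: "\<lbrakk>0 < t; t \<le> 2 * pi\<rbrakk> \<Longrightarrow> ((\<lambda>s. F s x) \<longlongrightarrow> F t x) (at_left t)"
  using sol by (auto simp: moment_solution_def)

lemma F_moment: "n \<le> d \<Longrightarrow> has_strong_RS_integral (\<lambda>t. exp (\<i> * of_nat n * of_real t)) F 0 (2 * pi) (S n)"
  using sol by (auto simp: moment_solution_def)

lemma positive_form_F_diff:
  assumes "0 \<le> r" "r \<le> t" "t \<le> 2 * pi"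
  shows "positive_form (\<lambda>x y. cinner (F t x - F r x) y)"
  using positive_F[OF assms] sesquilinear_diff[OF sesquilinear_cinner[OF bounded_F[of t]] sesquilinear_cinner[OF bounded_F[of r]]]
    assms by (simp add: positive_form_def positive_op_def cinner_diff_left)

lemma positive_form_F: "\<lbrakk>0 \<le> t; t \<le> 2 * pi\<rbrakk> \<Longrightarrow> positive_form (\<lambda>x y. cinner (F t x) y)"
  using positive_form_F_diff[of 0 t] by (simp add: F_0)

lemma positive_form_mass: "k < N \<Longrightarrow> positive_form (mass N k)"
  unfolding mass_def[abs_def]
  using uniform_pt_bounds[of k N] uniform_pt_bounds[of "Suc k" N] uniform_pt_Suc[of N k]
  by (intro positive_form_F_diff) auto

lemma cinner_RS_sum_uniform:
  "cinner (RS_sum (\<lambda>t. exp (\<i> * of_nat n * of_real t)) F N (uniform_pt N) (uniform_pt N) x) y =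
    approx_moment N (int n) x y"
proof -
  have "exp (\<i> * of_nat n * of_real t) = cis (of_int (int n) * t)" for t
    by (simp add: cis_conv_exp mult.assoc)
  then show ?thesis
    unfolding RS_sum_def cinner_sum_left approx_moment_def
    by (simp only: cinner_scaleC_left mass_def)
qed

lemma approx_moment_tendsto:
  assumes "n \<le> d"
  shows "(\<lambda>N. approx_moment N (int n) x y) \<longlonglongrightarrow> s n x y"
proof -
  let ?R = "\<lambda>N. RS_sum (\<lambda>t. exp (\<i> * of_nat n * of_real t)) F N (uniform_pt N) (uniform_pt N) x"
  have "?R \<longlonglongrightarrow> S n x"
  proof (rule tendstoI)
    fix e :: real assume "0 < e"
    show "\<forall>\<^sub>F N in sequentially. dist (?R N) (S n x) < e"
    proof (rule has_strong_RS_integralE[OF F_moment[OF assms] \<open>0 < e\<close>, of x])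
      fix \<delta> :: real
      assume \<delta>: "0 < \<delta>" "\<And>N t \<xi>. \<lbrakk>tagged_partition 0 (2 * pi) N t \<xi>; \<forall>k<N. t (Suc k) - t k < \<delta>\<rbrakk> \<Longrightarrow>
          norm (RS_sum (\<lambda>t. exp (\<i> * of_nat n * of_real t)) F N t \<xi> x - S n x) < e"
      have "\<forall>\<^sub>F N in sequentially. 2 * pi / real N < \<delta>"
        using uniform_mesh_tendsto \<delta>(1) by (rule order_tendstoD(2))
      then show ?thesis
        using eventually_gt_at_top[of 0]
      proof eventually_elim
        case (elim N)
        then show ?case
          unfolding dist_norm by (intro \<delta>(2) tagged_partition_uniform) (simp_all add: uniform_pt_Suc)
      qed
    qed
  qed
  from tendsto_cinner_left[OF this, of y] show ?thesis
    by (simp add: cinner_RS_sum_uniform s_def)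
qed

lemma approx_moment_0:
  assumes "N > 0"
  shows "approx_moment N 0 x y = cinner (F (2 * pi) x) y"
proof -
  have "approx_moment N 0 x y = cinner (\<Sum>k<N. F (uniform_pt N (Suc k)) x - F (uniform_pt N k) x) y"
    by (simp add: approx_moment_def mass_def cinner_sum_left)
  then show ?thesis
    using assms by (simp add: sum_lessThan_telescope[of "\<lambda>k. F (uniform_pt N k) x"] uniform_pt_ends F_0)
qed

lemma F_2pi: "cinner (F (2 * pi) x) y = s 0 x y"
proof (rule LIMSEQ_unique)
  show "(\<lambda>N. approx_moment N 0 x y) \<longlonglongrightarrow> s 0 x y"
    using approx_moment_tendsto[of 0 x y] by simp
  have "\<forall>\<^sub>F N in sequentially. cinner (F (2 * pi) x) y = approx_moment N 0 x y"
    using eventually_gt_at_top[of 0] by eventually_elim (simp add: approx_moment_0)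
  then show "(\<lambda>N. approx_moment N 0 x y) \<longlonglongrightarrow> cinner (F (2 * pi) x) y"
    by (rule Lim_transform_eventually[OF tendsto_const])
qed

lemma approx_moment_minus: "approx_moment N (- n) x y = cnj (approx_moment N n y x)"
  unfolding approx_moment_def cnj_sum complex_cnj_mult
  by (intro sum.cong refl arg_cong2[where f = "(*)"] positive_form_hermitian[OF positive_form_mass])
    (simp_all add: cis_cnj)

lemma approx_moment_tendsto_ext:
  assumes "\<bar>n\<bar> \<le> int d"
  shows "(\<lambda>N. approx_moment N n x y) \<longlonglongrightarrow> form_ext s n x y"
proof (cases "n \<ge> 0")
  case True
  then show ?thesis using approx_moment_tendsto[of "nat n" x y] assms by (simp add: form_ext_def)
next
  case False
  have "(\<lambda>N. cnj (approx_moment N (- n) y x)) \<longlonglongrightarrow> cnj (s (nat (- n)) y x)"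
    using approx_moment_tendsto[of "nat (- n)" y x] assms False by (intro tendsto_cnj) auto
  then show ?thesis
    using False approx_moment_minus[of _ "- n" x y] by (simp add: form_ext_def)
qed

text \<open>In the finite model given by the masses, the left side pairs the function with values
  \<open>X k\<close>, the image of the formal sum \<open>h\<close>, with a unimodular multiple of
  \<open>y\<close>. The translation \<open>\<sigma>\<close> goes into this factor, so the bound does
  not depend on it.\<close>

lemma approx_moment_linear_bound:
  assumes "N > 0"
  shows "cmod (\<Sum>j\<le>d. approx_moment N (int j + \<sigma>) (h j) y) \<le>
    sqrt (Re (\<Sum>j\<le>d. \<Sum>l\<le>d. approx_moment N (int j - int l) (h j) (h l))) * sqrt (Re (s 0 y y))"
proof -
  define \<theta> where "\<theta> = uniform_pt N"
  define X where "X k = (\<Sum>j\<le>d. cis (real j * \<theta> k) *\<^sub>C h j)" for k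
  \<comment> \<open>The minus sign is turned by the conjugation in the second argument into the
    factor for \<open>\<sigma>\<close>.\<close>
  define Y where "Y k = cis (- (of_int \<sigma> * \<theta> k)) *\<^sub>C y" for k
  have sq: "sesquilinear (mass N k)" if "k < N" for k
    using positive_form_mass[OF that] by (simp add: positive_form_def)
  have sum_left: "b (\<Sum>j\<in>A. f j) z = (\<Sum>j\<in>A. b (f j) z)" and sum_right: "b z (\<Sum>j\<in>A. f j) = (\<Sum>j\<in>A. b z (f j))"
    if "sesquilinear b" for b :: "'a \<Rightarrow> 'a \<Rightarrow> complex" and f :: "nat \<Rightarrow> 'a" and A z
    by (induction A rule: infinite_finite_induct) (simp_all add: sesquilinearD[OF that])
  have XY: "(\<Sum>j\<le>d. approx_moment N (int j + \<sigma>) (h j) y) = (\<Sum>k<N. mass N k (X k) (Y k))"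
  proof -
    have "mass N k (X k) (Y k) = (\<Sum>j\<le>d. cis (of_int (int j + \<sigma>) * \<theta> k) * mass N k (h j) y)"
      if "k < N" for k
      unfolding X_def Y_def sum_left[OF sq[OF that]]
      by (intro sum.cong refl)
        (simp add: sesquilinearD[OF sq[OF that]] cis_cnj distrib_right flip: cis_mult)
    then have "(\<Sum>k<N. mass N k (X k) (Y k)) = (\<Sum>k<N. \<Sum>j\<le>d. cis (of_int (int j + \<sigma>) * \<theta> k) * mass N k (h j) y)"
      by (intro sum.cong refl) simp
    also have "\<dots> = (\<Sum>j\<le>d. approx_moment N (int j + \<sigma>) (h j) y)"
      unfolding approx_moment_def \<theta>_def by (rule sum.swap)
    finally show ?thesis by simp
  qed
  have XX: "(\<Sum>j\<le>d. \<Sum>l\<le>d. approx_moment N (int j - int l) (h j) (h l)) = (\<Sum>k<N. mass N k (X k) (X k))"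
  proof -
    have "mass N k (X k) (X k) = (\<Sum>j\<le>d. \<Sum>l\<le>d. cis (of_int (int j - int l) * \<theta> k) * mass N k (h j) (h l))"
      if "k < N" for k
      unfolding X_def sum_left[OF sq[OF that]] unfolding sum_right[OF sq[OF that]]
    proof (rule sum.cong[OF refl], rule sum.cong[OF refl])
      fix j l
      have "cis (of_int (int j - int l) * \<theta> k) = cis (real j * \<theta> k) * cnj (cis (real l * \<theta> k))"
        by (simp add: cis_cnj cis_mult algebra_simps)
      moreover have "mass N k (cis (real j * \<theta> k) *\<^sub>C h j) (cis (real l * \<theta> k) *\<^sub>C h l) =
          cis (real j * \<theta> k) * (cnj (cis (real l * \<theta> k)) * mass N k (h j) (h l))"
        by (simp only: sesquilinearD(3,4)[OF sq[OF that]] ac_simps)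
      ultimately show "mass N k (cis (real j * \<theta> k) *\<^sub>C h j) (cis (real l * \<theta> k) *\<^sub>C h l) =
          cis (of_int (int j - int l) * \<theta> k) * mass N k (h j) (h l)"
        by (simp only: mult.assoc)
    qed
    then have "(\<Sum>k<N. mass N k (X k) (X k)) =
        (\<Sum>k<N. \<Sum>j\<le>d. \<Sum>l\<le>d. cis (of_int (int j - int l) * \<theta> k) * mass N k (h j) (h l))"
      by (intro sum.cong refl) simp
    also have "\<dots> = (\<Sum>j\<le>d. \<Sum>k<N. \<Sum>l\<le>d. cis (of_int (int j - int l) * \<theta> k) * mass N k (h j) (h l))"
      by (rule sum.swap)
    also have "\<dots> = (\<Sum>j\<le>d. \<Sum>l\<le>d. approx_moment N (int j - int l) (h j) (h l))"
      unfolding approx_moment_def \<theta>_def by (rule sum.cong[OF refl], rule sum.swap)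
    finally show ?thesis by simp
  qed
  have YY: "(\<Sum>k<N. Re (mass N k (Y k) (Y k))) = Re (s 0 y y)"
  proof -
    have "mass N k (Y k) (Y k) = mass N k y y" if "k < N" for k
      unfolding Y_def sesquilinearD(3,4)[OF sq[OF that]]
      by (simp add: cis_cnj cis_mult flip: mult.assoc)
    then have "(\<Sum>k<N. Re (mass N k (Y k) (Y k))) = Re (\<Sum>k<N. mass N k y y)"
      by simp
    also have "\<dots> = Re (approx_moment N 0 y y)" by (simp add: approx_moment_def)
    finally show ?thesis using approx_moment_0[OF assms] F_2pi by simp
  qed
  show ?thesis
    using positive_form_sum_Cauchy_Schwarz[of "{..<N}" "mass N" X Y, OF positive_form_mass]
    unfolding XY XX Re_sum YY by simp
qed

text \<open>The first factor of the linear bound involves only orders up to \<open>d\<close> and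
  converges to the norm of \<open>h\<close>.\<close>

lemma approx_moment_small:
  assumes "nrm h < e" "0 < e"
  shows "\<forall>\<^sub>F N in sequentially. cmod (\<Sum>j\<le>d. approx_moment N (int j + \<sigma>) (h j) y) \<le> e * sqrt (Re (s 0 y y))"
proof -
  have "(\<lambda>N. \<Sum>j\<le>d. \<Sum>l\<le>d. approx_moment N (int j - int l) (h j) (h l)) \<longlonglongrightarrow> T h h"
    unfolding toeplitz_form_def by (intro tendsto_sum approx_moment_tendsto_ext) auto
  then have "(\<lambda>N. sqrt (Re (\<Sum>j\<le>d. \<Sum>l\<le>d. approx_moment N (int j - int l) (h j) (h l)))) \<longlonglongrightarrow> nrm h"
    unfolding ip_norm_def by (intro tendsto_real_sqrt tendsto_Re) simp
  from order_tendstoD(2)[OF this assms(1)] show ?thesis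
    using eventually_gt_at_top[of 0]
  proof eventually_elim
    case (elim N)
    have "cmod (\<Sum>j\<le>d. approx_moment N (int j + \<sigma>) (h j) y) \<le>
        sqrt (Re (\<Sum>j\<le>d. \<Sum>l\<le>d. approx_moment N (int j - int l) (h j) (h l))) * sqrt (Re (s 0 y y))"
      by (rule approx_moment_linear_bound[OF elim(2)])
    also have "\<dots> \<le> e * sqrt (Re (s 0 y y))"
      using elim(1) by (intro mult_right_mono real_sqrt_ge_zero positive_form_Re positive_definite_0[OF pd]) simp
    finally show ?case .
  qed
qed

lemma approx_moment_sesquilinear: "sesquilinear (approx_moment N n)"
  unfolding approx_moment_def[abs_def]
  using positive_form_mass by (intro sesquilinear_sum sesquilinear_mult) (auto simp: positive_form_def)

lemma approx_moment_split:
  assumes "a \<le> d"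
  shows "approx_moment N (int a + \<sigma>) x y =
    (\<Sum>j\<le>d. approx_moment N (int j + \<sigma>) (dif (single a x) m j) y) + (\<Sum>j\<le>d. approx_moment N (int j + \<sigma>) (m j) y)"
proof -
  have "(\<Sum>j\<le>d. approx_moment N (int j + \<sigma>) (dif (single a x) m j) y) + (\<Sum>j\<le>d. approx_moment N (int j + \<sigma>) (m j) y)
      = (\<Sum>j\<le>d. if j = a then approx_moment N (int a + \<sigma>) x y else 0)"
    unfolding sum.distrib[symmetric]
  proof (intro sum.cong refl)
    fix j
    have "approx_moment N (int j + \<sigma>) (dif (single a x) m j) y + approx_moment N (int j + \<sigma>) (m j) y =
        approx_moment N (int j + \<sigma>) (dif (single a x) m j + m j) y"
      by (simp only: sesquilinearD(1)[OF approx_moment_sesquilinear])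
    also have "dif (single a x) m j + m j = single a x j"
      by (simp add: ip_diff_def scaleC_minus_one)
    finally show "approx_moment N (int j + \<sigma>) (dif (single a x) m j) y + approx_moment N (int j + \<sigma>) (m j) y =
        (if j = a then approx_moment N (int a + \<sigma>) x y else 0)"
      by (simp add: sesquilinearD(5)[OF approx_moment_sesquilinear])
  qed
  then show ?thesis using assms by simp
qed

end

locale two_moment_solutions = F: moment_solution_data S d F + G: moment_solution_data S d G
  for S :: "nat \<Rightarrow> 'a::complex_hilbert \<Rightarrow> 'a" and d F G
begin

abbreviation moment_gap :: "int \<Rightarrow> 'a \<Rightarrow> 'a \<Rightarrow> nat \<Rightarrow> complex" where
  "moment_gap n x y N \<equiv> F.approx_moment N n x y - G.approx_moment N n x y"

text \<open>If \<open>x\<^bsub>x,a\<^esub>\<close> is approximated by sums over the indices \<open>j \<in> J\<close>, then its translates by \<open>\<sigma>\<close> are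
  approximated by the translates of those sums, in any space in which the shift is isometric.\<close>

lemma moment_gap_shift:
  assumes a: "a \<le> d"
    and approx: "\<And>e. 0 < e \<Longrightarrow> \<exists>m. (\<forall>j\<le>d. j \<notin> J \<longrightarrow> m j = 0) \<and> F.nrm (F.dif (single a x) m) < e"
    and gap: "\<And>j x y. \<lbrakk>j \<le> d; j \<in> J\<rbrakk> \<Longrightarrow> moment_gap (int j + \<sigma>) x y \<longlonglongrightarrow> 0"
  shows "moment_gap (int a + \<sigma>) x y \<longlonglongrightarrow> 0"
proof (rule tendstoI)
  fix e :: real assume e: "0 < e"
  define Q where "Q = sqrt (Re (F.s 0 y y)) + 1"
  have Q: "0 < Q" "sqrt (Re (F.s 0 y y)) \<le> Q"
    using positive_form_Re[OF positive_definite_0[OF F.pd], of y] by (simp_all add: Q_def add_nonneg_pos)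
  \<comment> \<open>Three contributions of e/3: the residual in each of the two solutions, and the
    approximating sum itself.\<close>
  define \<epsilon> where "\<epsilon> = e / (3 * Q)"
  have \<epsilon>: "0 < \<epsilon>" using e Q by (simp add: \<epsilon>_def)
  obtain m where m: "\<And>j. \<lbrakk>j \<le> d; j \<notin> J\<rbrakk> \<Longrightarrow> m j = 0" "F.nrm (F.dif (single a x) m) < \<epsilon>"
    using approx[OF \<epsilon>] by blast
  define h where "h = F.dif (single a x) m"
  have "(\<lambda>N. \<Sum>j\<le>d. moment_gap (int j + \<sigma>) (m j) y N) \<longlonglongrightarrow> (\<Sum>j\<le>d. 0)"
  proof (rule tendsto_sum)
    fix j assume "j \<in> {..d}"
    then show "moment_gap (int j + \<sigma>) (m j) y \<longlonglongrightarrow> 0"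
      using gap[of j] m(1)[of j]
      by (cases "j \<in> J")
        (auto simp: sesquilinearD(5)[OF F.approx_moment_sesquilinear] sesquilinearD(5)[OF G.approx_moment_sesquilinear])
  qed
  then have "\<forall>\<^sub>F N in sequentially. cmod (\<Sum>j\<le>d. moment_gap (int j + \<sigma>) (m j) y N) < e / 3"
    using e by (intro order_tendstoD(2)[OF tendsto_norm_zero]) auto
  moreover have "\<forall>\<^sub>F N in sequentially. cmod (\<Sum>j\<le>d. F.approx_moment N (int j + \<sigma>) (h j) y) \<le> \<epsilon> * sqrt (Re (F.s 0 y y))"
    using m(2) \<epsilon> unfolding h_def[symmetric] by (rule F.approx_moment_small)
  moreover have "\<forall>\<^sub>F N in sequentially. cmod (\<Sum>j\<le>d. G.approx_moment N (int j + \<sigma>) (h j) y) \<le> \<epsilon> * sqrt (Re (F.s 0 y y))"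
    using m(2) \<epsilon> unfolding h_def[symmetric] by (rule G.approx_moment_small)
  ultimately show "\<forall>\<^sub>F N in sequentially. dist (moment_gap (int a + \<sigma>) x y N) 0 < e"
  proof eventually_elim
    case (elim N)
    let ?f = "\<Sum>j\<le>d. F.approx_moment N (int j + \<sigma>) (h j) y"
    let ?g = "\<Sum>j\<le>d. G.approx_moment N (int j + \<sigma>) (h j) y"
    let ?m = "\<Sum>j\<le>d. moment_gap (int j + \<sigma>) (m j) y N"
    have "moment_gap (int a + \<sigma>) x y N = ?f - ?g + ?m"
      unfolding F.approx_moment_split[OF a, of N \<sigma> x y m] G.approx_moment_split[OF a, of N \<sigma> x y m] h_def[symmetric]
      by (simp add: sum_subtractf)
    then have "cmod (moment_gap (int a + \<sigma>) x y N) \<le> cmod ?f + cmod ?g + cmod ?m"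
      using norm_triangle_ineq[of "?f - ?g" ?m] norm_triangle_ineq4[of ?f ?g] by simp
    moreover have "\<epsilon> * sqrt (Re (F.s 0 y y)) \<le> \<epsilon> * Q"
      using \<epsilon> Q(2) by (intro mult_left_mono) auto
    moreover have "3 * (\<epsilon> * Q) = e" using Q by (simp add: \<epsilon>_def)
    ultimately show ?case using elim unfolding dist_norm diff_0_right by linarith
  qed
qed

lemma moment_gap_minus: "moment_gap (- n) x y \<longlonglongrightarrow> 0" if "moment_gap n y x \<longlonglongrightarrow> 0"
  using tendsto_cnj[OF that] by (simp add: F.approx_moment_minus G.approx_moment_minus)

text \<open>Strong induction on the order n > d. In the first case, translating the approximation of
  x_(h,d) by n - d involves only the orders j + n - d < n. In the second, x_(h,0) is translated by
  -n, which involves the orders j - n with j from 1 to \<open>d\<close>; conjugation reduces these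
  to n - j < n.\<close>

lemma moment_gap_tendsto:
  assumes "(\<forall>h. \<forall>e>0. \<exists>m\<in>dom_set d. F.nrm (F.dif (single d h) m) < e) \<or>
    (\<forall>h. \<forall>e>0. \<exists>m\<in>ran_set d. F.nrm (F.dif (single 0 h) m) < e)"
  shows "moment_gap n x y \<longlonglongrightarrow> 0"
proof -
  have nat: "moment_gap (int n) x y \<longlonglongrightarrow> 0" for n x y
  proof (induction n arbitrary: x y rule: less_induct)
    case (less n)
    show ?case
    proof (cases "n \<le> d")
      case True
      then show ?thesis
        using tendsto_diff[OF F.approx_moment_tendsto[OF True, of x y] G.approx_moment_tendsto[OF True, of x y]]
        by simp
    next
      case False
      from assms show ?thesis
      proof
        assume dom: "\<forall>h. \<forall>e>0. \<exists>m\<in>dom_set d. F.nrm (F.dif (single d h) m) < e"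
        have "moment_gap (int d + (int n - int d)) x y \<longlonglongrightarrow> 0"
        proof (rule moment_gap_shift[where J = "{..<d}"])
          show "\<exists>m. (\<forall>j\<le>d. j \<notin> {..<d} \<longrightarrow> m j = 0) \<and> F.nrm (F.dif (single d x) m) < e" if "0 < e" for e
            using dom that by (fastforce simp: dom_set_def)
          fix j x y assume "j \<le> d" "j \<in> {..<d}"
          then show "moment_gap (int j + (int n - int d)) x y \<longlonglongrightarrow> 0"
            using less.IH[of "j + n - d" x y] False by (simp add: of_nat_diff algebra_simps)
        qed simp
        then show ?thesis by simp
      next
        assume ran: "\<forall>h. \<forall>e>0. \<exists>m\<in>ran_set d. F.nrm (F.dif (single 0 h) m) < e"
        \<comment> \<open>The arguments are swapped in advance, since the final passage from -n to n
          swaps them back.\<close>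
        have "moment_gap (int 0 + - int n) y x \<longlonglongrightarrow> 0"
        proof (rule moment_gap_shift[where J = "{1..d}"])
          show "\<exists>m. (\<forall>j\<le>d. j \<notin> {1..d} \<longrightarrow> m j = 0) \<and> F.nrm (F.dif (single 0 y) m) < e" if e: "0 < e" for e
          proof -
            obtain m where "m \<in> ran_set d" "F.nrm (F.dif (single 0 y) m) < e" using ran e by blast
            then show ?thesis by (intro exI[of _ m]) (auto simp: ran_set_def not_le)
          qed
          fix j x y assume j: "j \<le> d" "j \<in> {1..d}"
          have "moment_gap (- int (n - j)) x y \<longlonglongrightarrow> 0"
            using less.IH[of "n - j" y x] j False by (intro moment_gap_minus) simp
          then show "moment_gap (int j + - int n) x y \<longlonglongrightarrow> 0"
            using j False by (simp add: of_nat_diff)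
        qed simp
        then show ?thesis using moment_gap_minus[of "- int n" y x] by simp
      qed
    qed
  qed
  show ?thesis
  proof (cases "n \<ge> 0")
    case True
    then show ?thesis using nat[of "nat n" x y] by simp
  next
    case False
    then show ?thesis using moment_gap_minus[OF nat[of "nat (- n)" y x]] by simp
  qed
qed

lemma solutions_le:
  assumes gap: "\<And>n x y. moment_gap n x y \<longlonglongrightarrow> 0" and t: "0 < t" "t < 2 * pi"
  shows "Re (cinner (F t x) x) \<le> Re (cinner (G t x) x)"
proof (rule monotone_moments_le[OF _ _ _ _ _ _ _ t])
  show "Re (cinner (F r x) x) \<le> Re (cinner (F t x) x)" if "0 \<le> r" "r \<le> t" "t \<le> 2 * pi" for r t
    using positive_form_Re[OF F.positive_form_F_diff[OF that], of x] by (simp add: cinner_diff_left)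
  show "Re (cinner (G r x) x) \<le> Re (cinner (G t x) x)" if "0 \<le> r" "r \<le> t" "t \<le> 2 * pi" for r t
    using positive_form_Re[OF G.positive_form_F_diff[OF that], of x] by (simp add: cinner_diff_left)
  show "((\<lambda>t. Re (cinner (F t x) x)) \<longlongrightarrow> Re (cinner (F t x) x)) (at_left t)" if "0 < t" "t \<le> 2 * pi" for t
    by (intro tendsto_Re tendsto_cinner_left F.F_left that)
  show "((\<lambda>t. Re (cinner (G t x) x)) \<longlongrightarrow> Re (cinner (G t x) x)) (at_left t)" if "0 < t" "t \<le> 2 * pi" for t
    by (intro tendsto_Re tendsto_cinner_left G.F_left that)
  fix n :: int
  have "of_real (Re (F.mass N k x x)) = F.mass N k x x" "of_real (Re (G.mass N k x x)) = G.mass N k x x"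
    if "k < N" for N k
    using F.positive_form_mass[OF that] G.positive_form_mass[OF that]
    by (auto simp: positive_form_def complex_nonneg_Reals_iff complex_eq_iff)
  then have "(\<lambda>N. \<Sum>k<N. cis (of_int n * uniform_pt N k) *
      of_real (Re (F.mass N k x x) - Re (G.mass N k x x))) = moment_gap n x x"
    by (simp add: fun_eq_iff F.approx_moment_def G.approx_moment_def right_diff_distrib flip: sum_subtractf)
  with gap[of n x x] show "(\<lambda>N. \<Sum>k<N. cis (of_int n * uniform_pt N k) * of_real
      ((Re (cinner (F (uniform_pt N (Suc k)) x) x) - Re (cinner (F (uniform_pt N k) x) x)) -
       (Re (cinner (G (uniform_pt N (Suc k)) x) x) - Re (cinner (G (uniform_pt N k) x) x)))) \<longlonglongrightarrow> 0"
    by (simp add: F.mass_def G.mass_def cinner_diff_left)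
qed (simp_all add: F.F_0 G.F_0)

end

text \<open>The comparison in both directions yields equal diagonal values, and polarization gives
  the operators. The endpoints lie outside the comparison: at 0 both functions vanish, and at 2 pi
  both are given by the zeroth moment.\<close>

lemma (in moment_data) solutions_unique:
  assumes approx: "(\<forall>h. \<forall>e>0. \<exists>m\<in>dom_set d. nrm (dif (single d h) m) < e) \<or>
      (\<forall>h. \<forall>e>0. \<exists>m\<in>ran_set d. nrm (dif (single 0 h) m) < e)"
    and F: "moment_solution S d F" and G: "moment_solution S d G" and t: "t \<in> {0..2 * pi}"
  shows "F t = G t"
proof -
  interpret FG: two_moment_solutions S d F G by unfold_locales (rule F G)+
  interpret GF: two_moment_solutions S d G F by unfold_locales
  have diag: "Re (cinner (F t x) x) = Re (cinner (G t x) x)" for x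
  proof -
    consider "t = 0" | "t = 2 * pi" | "0 < t" "t < 2 * pi" using t by fastforce
    then show ?thesis
    proof cases
      case 1
      then show ?thesis by (simp add: FG.F.F_0 FG.G.F_0)
    next
      case 2
      then show ?thesis by (simp add: FG.F.F_2pi FG.G.F_2pi)
    next
      case 3
      show ?thesis
        using FG.solutions_le[OF FG.moment_gap_tendsto[OF approx] 3, of x]
          GF.solutions_le[OF GF.moment_gap_tendsto[OF approx] 3, of x] by simp
    qed
  qed
  have pos: "positive_form (\<lambda>x y. cinner (F t x) y)" "positive_form (\<lambda>x y. cinner (G t x) y)"
    using t by (auto intro: FG.F.positive_form_F FG.G.positive_form_F)
  have "cinner (F t x) x = cinner (G t x) x" for x
    using diag[of x] pos by (auto simp: positive_form_def complex_nonneg_Reals_iff complex_eq_iff)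
  moreover have "sesquilinear (\<lambda>x y. cinner (F t x) y)" "sesquilinear (\<lambda>x y. cinner (G t x) y)"
    using pos by (simp_all add: positive_form_def)
  ultimately have "4 * cinner (F t x) y = 4 * cinner (G t x) y" for x y
    using sesquilinear_polarization[of "\<lambda>x y. cinner (F t x) y" x y]
      sesquilinear_polarization[of "\<lambda>x y. cinner (G t x) y" x y] by metis
  then show ?thesis by (intro ext cinner_eqI) simp
qed

section \<open>Determinacy\<close>

context moment_data
begin

lemma s0_bound: "\<exists>K\<ge>0. \<forall>x. Re (s 0 x x) \<le> K * (norm x)\<^sup>2"
proof -
  obtain K where K: "K \<ge> 0" "\<And>x. norm (S 0 x) \<le> K * norm x"
    using bounded_clinear_norm_bound[OF bounded_S[of 0]] by blast
  have "Re (s 0 x x) \<le> K * (norm x)\<^sup>2" for x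
  proof -
    have "Re (s 0 x x) \<le> cmod (cinner (S 0 x) x)" by (simp add: s_def complex_Re_le_cmod)
    also have "\<dots> \<le> norm (S 0 x) * norm x" by (rule cinner_Cauchy_Schwarz)
    also have "\<dots> \<le> K * norm x * norm x" by (intro mult_right_mono K) simp
    finally show ?thesis by (simp add: power2_eq_square mult.assoc)
  qed
  with K(1) show ?thesis by blast
qed

text \<open>With e = d this is solvability; with e = d+1 it produces a solution whose next moment is
  prescribed.\<close>

lemma extended_solution:
  assumes "positive_definite t e" "d \<le> e" "\<And>k. k \<le> d \<Longrightarrow> t k = s k"
  obtains F where "moment_solution S d F"
    "\<And>m. m \<le> e \<Longrightarrow> \<exists>T. has_strong_RS_integral (\<lambda>t. exp (\<i> * of_nat m * of_real t)) F 0 (2 * pi) T \<and>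
       (\<forall>x y. cinner (T x) y = t m x y)"
proof -
  obtain r where r: "\<And>k. k \<le> e \<Longrightarrow> r k = t k" "\<And>N. positive_definite r N"
    using positive_definite_extension[OF assms(1)] by blast
  obtain K where K: "K \<ge> 0" "\<And>x. Re (s 0 x x) \<le> K * (norm x)\<^sup>2"
    using s0_bound by blast
  interpret r: bounded_pd_sequence r K
    using r K assms by unfold_locales auto
  show thesis
  proof (rule r.solution_exists)
    fix F
    assume F: "\<And>S d. (\<And>n x y. n \<le> d \<Longrightarrow> cinner (S n x) y = r n x y) \<Longrightarrow> moment_solution S d F"
      "\<And>m. \<exists>T. has_strong_RS_integral (\<lambda>t. exp (\<i> * of_nat m * of_real t)) F 0 (2 * pi) T \<and>
         (\<forall>x y. cinner (T x) y = r m x y)"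
    show thesis
    proof (rule that)
      show "moment_solution S d F"
        using r(1) assms by (intro F(1)) (simp add: s_def)
      show "\<exists>T. has_strong_RS_integral (\<lambda>t. exp (\<i> * of_nat m * of_real t)) F 0 (2 * pi) T \<and>
         (\<forall>x y. cinner (T x) y = t m x y)" if "m \<le> e" for m
        using F(2)[of m] r(1)[OF that] by simp
    qed
  qed
qed

end

section \<open>Uniqueness of the integral and the equivalence\<close>

lemma fine_tagged_partition_exists:
  assumes "0 < \<delta>"
  shows "\<exists>N t. tagged_partition 0 (2 * pi) N t t \<and> (\<forall>k<N. t (Suc k) - t k < \<delta>)"
proof -
  have "\<forall>\<^sub>F N in sequentially. 2 * pi / real N < \<delta> \<and> N > 0"
    by (rule eventually_conj[OF order_tendstoD(2)[OF uniform_mesh_tendsto assms] eventually_gt_at_top])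
  then obtain N where N: "2 * pi / real N < \<delta>" "N > 0"
    using eventually_happens' sequentially_bot by blast
  then show ?thesis
    using tagged_partition_uniform[OF N(2)] by (intro exI[of _ N] exI[of _ "uniform_pt N"]) (simp add: uniform_pt_Suc)
qed

text \<open>Both families of sums can be evaluated on one common partition that is fine enough for
  each limit. Hence solutions with different moments of order d+1 are different on
  [0, 2 pi].\<close>

lemma RS_integral_unique:
  assumes F: "has_strong_RS_integral f F 0 (2 * pi) T" and G: "has_strong_RS_integral f G 0 (2 * pi) T'"
    and eq: "\<And>t. t \<in> {0..2 * pi} \<Longrightarrow> F t = G t"
  shows "T = T'"
proof
  fix x
  have "dist (T x) (T' x) \<le> 0 + e" if "0 < e" for e
  proof -
    have e2: "0 < e / 2" using that by simp
    obtain \<delta> where \<delta>: "\<delta> > 0" "\<And>N t \<xi>. \<lbrakk>tagged_partition 0 (2 * pi) N t \<xi>; \<forall>k<N. t (Suc k) - t k < \<delta>\<rbrakk> \<Longrightarrow>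
        norm (RS_sum f F N t \<xi> x - T x) < e / 2"
      by (rule has_strong_RS_integralE[OF F e2, of x]) (rule that)
    obtain \<delta>' where \<delta>': "\<delta>' > 0" "\<And>N t \<xi>. \<lbrakk>tagged_partition 0 (2 * pi) N t \<xi>; \<forall>k<N. t (Suc k) - t k < \<delta>'\<rbrakk> \<Longrightarrow>
        norm (RS_sum f G N t \<xi> x - T' x) < e / 2"
      by (rule has_strong_RS_integralE[OF G e2, of x]) (rule that)
    obtain N t where t: "tagged_partition 0 (2 * pi) N t t" "\<forall>k<N. t (Suc k) - t k < \<delta>" "\<forall>k<N. t (Suc k) - t k < \<delta>'"
      using fine_tagged_partition_exists[of "min \<delta> \<delta>'"] \<delta>(1) \<delta>'(1) by auto
    have "t k \<in> {0..2 * pi}" if "k \<le> N" for k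
      using tagged_partition_mono[OF t(1), of 0 k] tagged_partition_mono[OF t(1), of k N] that t(1)
      by (simp add: tagged_partition_def)
    then have "RS_sum f F N t t x = RS_sum f G N t t x"
      unfolding RS_sum_def by (intro sum.cong refl) (simp add: eq)
    then show ?thesis
      using \<delta>(2)[OF t(1,2)] \<delta>'(2)[OF t(1,3)]
        norm_triangle_ineq4[of "RS_sum f F N t t x - T' x" "RS_sum f F N t t x - T x"]
      by (simp add: dist_norm)
  qed
  then have "dist (T x) (T' x) \<le> 0" by (rule field_le_epsilon)
  then show "T x = T' x" by simp
qed

theorem corollary1:
  fixes S :: "nat \<Rightarrow> 'a::complex_hilbert \<Rightarrow> 'a" and d :: nat
  assumes "d \<ge> 1"
    and "\<And>n. n \<le> d \<Longrightarrow> bounded_clinear (S n)"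
    and "\<And>h :: nat \<Rightarrow> 'a.
           (\<Sum>k\<le>d. \<Sum>l\<le>d. cinner (S_ext S (int l - int k) (h l)) (h k)) \<in> \<real>\<^sub>\<ge>\<^sub>0"
  shows "determinate S d \<longleftrightarrow>
           defect_domain (moment_H S d) (moment_A S d) = BNF_Cardinal_Arithmetic.czero \<or>
           defect_range (moment_H S d) (moment_A S d) = BNF_Cardinal_Arithmetic.czero"
proof -
  interpret moment_data S d by (unfold_locales; (erule assms(2) | rule assms(3)))
  show ?thesis
    unfolding defect_domain_eq_czero_iff defect_range_eq_czero_iff
  proof
    assume approx: "(\<forall>h. \<forall>e>0. \<exists>m\<in>dom_set d. nrm (dif (single d h) m) < e) \<or>
      (\<forall>h. \<forall>e>0. \<exists>m\<in>ran_set d. nrm (dif (single 0 h) m) < e)"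
    obtain F where "moment_solution S d F"
      using extended_solution[OF pd order_refl] by metis
    then show "determinate S d"
      unfolding determinate_def using solutions_unique[OF approx] by blast
  next
    assume det: "determinate S d"
    show "(\<forall>h. \<forall>e>0. \<exists>m\<in>dom_set d. nrm (dif (single d h) m) < e) \<or>
      (\<forall>h. \<forall>e>0. \<exists>m\<in>ran_set d. nrm (dif (single 0 h) m) < e)"
    proof (rule ccontr)
      \<comment> \<open>Both defect numbers are then non-zero, and two choices of the next moment
        each lead to a solution of the given problem.\<close>
      assume "\<not> ?thesis"
      then obtain b b' where b: "positive_definite (s(Suc d := b)) (Suc d)"
        "positive_definite (s(Suc d := b')) (Suc d)" "b \<noteq> b'"
        using two_extensions by blast
      obtain F T where F: "moment_solution S d F"
        "has_strong_RS_integral (\<lambda>t. exp (\<i> * of_nat (Suc d) * of_real t)) F 0 (2 * pi) T"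
        "\<And>x y. cinner (T x) y = b x y"
      proof (rule extended_solution[OF b(1)])
        fix F assume *: "moment_solution S d F"
          "\<And>m. m \<le> Suc d \<Longrightarrow> \<exists>T. has_strong_RS_integral (\<lambda>t. exp (\<i> * of_nat m * of_real t)) F 0 (2 * pi) T \<and>
            (\<forall>x y. cinner (T x) y = (s(Suc d := b)) m x y)"
        show thesis using *(2)[of "Suc d"] that[OF *(1)] by auto
      qed auto
      obtain G T' where G: "moment_solution S d G"
        "has_strong_RS_integral (\<lambda>t. exp (\<i> * of_nat (Suc d) * of_real t)) G 0 (2 * pi) T'"
        "\<And>x y. cinner (T' x) y = b' x y"
      proof (rule extended_solution[OF b(2)])
        fix F assume *: "moment_solution S d F"
          "\<And>m. m \<le> Suc d \<Longrightarrow> \<exists>T. has_strong_RS_integral (\<lambda>t. exp (\<i> * of_nat m * of_real t)) F 0 (2 * pi) T \<and>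
            (\<forall>x y. cinner (T x) y = (s(Suc d := b')) m x y)"
        show thesis using *(2)[of "Suc d"] that[OF *(1)] by auto
      qed auto
      have "F t = G t" if "t \<in> {0..2 * pi}" for t
        using det F(1) G(1) that unfolding determinate_def by blast
      then have "T = T'" by (rule RS_integral_unique[OF F(2) G(2)])
      then have "b x y = b' x y" for x y using F(3)[of x y] G(3)[of x y] by simp
      then have "b = b'" by (intro ext)
      with b(3) show False ..
    qed
  qed
qed

end
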